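(* Let $\gamma>0$ be a constant with $\gamma=n/N$, let $\lambda,\mu\ge0$ and $\rho\in(0,1)$ be constants with $F(\lambda,\mu,\rho,\gamma)<1-\epsilon$ for some constant $\epsilon>0$. Let $\pi=\pi_*^{\otimes n}$, where $\pi_*$ is the law of a pair $(\mathbb X,\mathbb Y)$ of real random variables such that (1) $\mathbb E[\mathbb X]=\mathbb E[\mathbb Y]=0$, $\mathbb E[\mathbb X^2]=\mathbb E[\mathbb Y^2]=1$, $\mathbb E[\mathbb X\mathbb Y]=\rho$; (2) $\mathbb X$ and $\mathbb Y$ are $C'$-subgaussian for some constant $C'$; (3) $\mathbb E[\mathbb X^a\mathbb Y^b]^2\ge\mathbb E[\mathbb X^a]^2\,\mathbb E[\mathbb Y^b]^2$ for all $a,b\in\mathbb N$. Then $\chi^2_{\le D}(\overline{\mathbb P};\overline{\mathbb Q})=O_{\lambda,\mu,\rho,\gamma}(1)$ for all $D=D_n=n^{o(1)}$. In particular, no (sequence of) degree-$D$ polynomial(s) can strongly separate $\overline{\mathbb P}$ and $\overline{\mathbb Q}$ when $D=n^{o(1)}$.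
   Context: $F(\lambda,\mu,\rho,\gamma)=\max\Big\{\frac{\lambda^2}{\gamma},\frac{\mu^2}{\gamma},\frac{\lambda^2\rho^2}{\gamma-\lambda^2+\lambda^2\rho^2}+\frac{\mu^2\rho^2}{\gamma-\mu^2+\mu^2\rho^2}\Big\}$. **Model (correlated spiked Wishart).** $(x,y)\sim\pi$ means that $(x_i,y_i)$, $1\le i\le n$, are i.i.d. from $\pi_*$, with $x,y\in\mathbb R^n$. Independently, $\boldsymbol u,\boldsymbol v\sim\mathcal N(0,\mathbb I_N)$ are independent and $\boldsymbol W,\boldsymbol Z\in\mathbb R^{n\times N}$ are independent with i.i.d. standard normal entries. $\overline{\mathbb P}$ is the law of $(\boldsymbol X,\boldsymbol Y)$ with $\boldsymbol X=\frac{\sqrt\lambda}{\sqrt n}x\boldsymbol u^\top+\boldsymbol W$, $\boldsymbol Y=\frac{\sqrt\mu}{\sqrt n}y\boldsymbol v^\top+\boldsymbol Z$; $\overline{\mathbb Q}$ is the law of $(\boldsymbol W,\boldsymbol Z)$. **Low-degree advantage.** For laws $\mathbb P=\mathbb P_n,\mathbb Q=\mathbb Q_n$ of a pair of matrices, $\chi^2_{\le D}(\mathbb P;\mathbb Q):=\sup_{\deg f\le D}\frac{\mathbb E_{\mathbb P}[f]}{\sqrt{\mathbb E_{\mathbb Q}[f^2]}}$, the supremum being over nonzero real multivariate polynomials $f$ of degree at most $D$ in the entries of the two matrices. **Strong separation.** A sequence of polynomials $f=f_n$ strongly separates $\mathbb P_n$ and $\mathbb Q_n$ if, as $n\to\infty$,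 $\sqrt{\max\{\operatorname{Var}_{\mathbb P}(f),\operatorname{Var}_{\mathbb Q}(f)\}}=o\big(|\mathbb E_{\mathbb P}[f]-\mathbb E_{\mathbb Q}[f]|\big)$. *)

theory Defs
  imports "HOL-Probability.Probability" "HOL-Library.Poly_Mapping" "HOL-Library.Landau_Symbols"
begin

definition spike_threshold :: "real \<Rightarrow> real \<Rightarrow> real \<Rightarrow> real \<Rightarrow> real" where
  "spike_threshold lam \<mu> \<rho> \<gamma> =
     Max {lam\<^sup>2 / \<gamma>, \<mu>\<^sup>2 / \<gamma>,
          lam\<^sup>2 * \<rho>\<^sup>2 / (\<gamma> - lam\<^sup>2 + lam\<^sup>2 * \<rho>\<^sup>2) + \<mu>\<^sup>2 * \<rho>\<^sup>2 / (\<gamma> - \<mu>\<^sup>2 + \<mu>\<^sup>2 * \<rho>\<^sup>2)}"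

subsection \<open>The prior\<close>

text \<open>Convention: a centred variable is \<open>c\<close>-subgaussian if its moment generating function is
  dominated by that of a centred Gaussian of standard deviation \<open>c\<close>. The other usual conventions
  (tails, Orlicz norm) agree with this one, for centred variables, up to an absolute factor
  in \<open>c\<close>.\<close>

definition subgaussian :: "'a measure \<Rightarrow> real \<Rightarrow> ('a \<Rightarrow> real) \<Rightarrow> bool" where
  "subgaussian M c X \<longleftrightarrow> 0 < c \<and> X \<in> borel_measurable M \<and>
     (\<forall>t. integrable M (\<lambda>\<omega>. exp (t * X \<omega>)) \<and>
          (\<integral>\<omega>. exp (t * X \<omega>) \<partial>M) \<le> exp (c\<^sup>2 * t\<^sup>2 / 2))"

text \<open>\<open>\<pi>\<close> is the law of the pair, so the two random variables are the coordinates. All moments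
  below are finite because both coordinates are subgaussian.\<close>

definition spike_prior :: "real \<Rightarrow> (real \<times> real) measure \<Rightarrow> bool" where
  "spike_prior \<rho> \<pi> \<longleftrightarrow>
     prob_space \<pi> \<and> sets \<pi> = sets borel \<and>
     (\<integral>p. fst p \<partial>\<pi>) = 0 \<and> (\<integral>p. snd p \<partial>\<pi>) = 0 \<and>
     (\<integral>p. (fst p)\<^sup>2 \<partial>\<pi>) = 1 \<and> (\<integral>p. (snd p)\<^sup>2 \<partial>\<pi>) = 1 \<and>
     (\<integral>p. fst p * snd p \<partial>\<pi>) = \<rho> \<and>
     (\<exists>c. subgaussian \<pi> c fst \<and> subgaussian \<pi> c snd) \<and>
     (\<forall>a b :: nat. (\<integral>p. fst p ^ a * snd p ^ b \<partial>\<pi>)\<^sup>2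
        \<ge> (\<integral>p. fst p ^ a \<partial>\<pi>)\<^sup>2 * (\<integral>p. snd p ^ b \<partial>\<pi>)\<^sup>2)"

subsection \<open>The correlated spiked Wishart model\<close>

text \<open>An \<open>n \<times> N\<close> matrix is a function on index pairs, extensional outside
  \<open>{..<n} \<times> {..<N}\<close>.\<close>

type_synonym rmatrix = "nat \<times> nat \<Rightarrow> real"

definition gauss_vector :: "nat \<Rightarrow> (nat \<Rightarrow> real) measure" where
  "gauss_vector N = PiM {..<N} (\<lambda>_. std_normal_distribution)"

definition gauss_matrix :: "nat \<Rightarrow> nat \<Rightarrow> rmatrix measure" where
  "gauss_matrix n N = PiM ({..<n} \<times> {..<N}) (\<lambda>_. std_normal_distribution)"

definition spiked_matrix ::
  "nat \<Rightarrow> nat \<Rightarrow> real \<Rightarrow> (nat \<Rightarrow> real) \<Rightarrow> (nat \<Rightarrow> real) \<Rightarrow> rmatrix \<Rightarrow> rmatrix" where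
  "spiked_matrix n N s x u W =
     (\<lambda>(i, j)\<in>{..<n} \<times> {..<N}. sqrt s / sqrt (real n) * x i * u j + W (i, j))"

definition wishart_null :: "nat \<Rightarrow> nat \<Rightarrow> (rmatrix \<times> rmatrix) measure" where
  "wishart_null n N = gauss_matrix n N \<Otimes>\<^sub>M gauss_matrix n N"

definition wishart_planted ::
  "(real \<times> real) measure \<Rightarrow> real \<Rightarrow> real \<Rightarrow> nat \<Rightarrow> nat \<Rightarrow> (rmatrix \<times> rmatrix) measure" where
  "wishart_planted \<pi> lam \<mu> n N =
     distr (PiM {..<n} (\<lambda>_. \<pi>) \<Otimes>\<^sub>M gauss_vector N \<Otimes>\<^sub>M gauss_vector N \<Otimes>\<^sub>M
            gauss_matrix n N \<Otimes>\<^sub>M gauss_matrix n N)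
       (wishart_null n N)
       (\<lambda>(xy, u, v, W, Z). (spiked_matrix n N lam (\<lambda>i. fst (xy i)) u W,
                             spiked_matrix n N \<mu> (\<lambda>i. snd (xy i)) v Z))"

subsection \<open>Polynomials in the entries of two matrices\<close>

text \<open>A polynomial is a finitely supported map from monomials (exponent vectors) to coefficients.
  The variables \<open>Inl (i, j)\<close> and \<open>Inr (i, j)\<close> stand for the entries of the first and of the second
  matrix.\<close>

type_synonym entry = "(nat \<times> nat) + (nat \<times> nat)"
type_synonym entry_poly = "(entry \<Rightarrow>\<^sub>0 nat) \<Rightarrow>\<^sub>0 real"

definition entry_polys :: "nat \<Rightarrow> nat \<Rightarrow> nat \<Rightarrow> entry_poly set" where
  "entry_polys n N D =
     {f. \<forall>m\<in>Poly_Mapping.keys f.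
           Poly_Mapping.keys m \<subseteq> ({..<n} \<times> {..<N}) <+> ({..<n} \<times> {..<N}) \<and>
           (\<Sum>e\<in>Poly_Mapping.keys m. Poly_Mapping.lookup m e) \<le> D}"

definition eval_entries :: "entry_poly \<Rightarrow> rmatrix \<times> rmatrix \<Rightarrow> real" where
  "eval_entries f XY =
     (\<Sum>m\<in>Poly_Mapping.keys f. Poly_Mapping.lookup f m *
        (\<Prod>e\<in>Poly_Mapping.keys m. case_sum (fst XY) (snd XY) e ^ Poly_Mapping.lookup m e))"

text \<open>The supremum is taken in the extended reals, where it
  exists without a boundedness argument.\<close>

definition low_degree_advantage ::
  "(rmatrix \<times> rmatrix) measure \<Rightarrow> (rmatrix \<times> rmatrix) measure \<Rightarrow> nat \<Rightarrow> nat \<Rightarrow> nat \<Rightarrow> ereal" where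
  "low_degree_advantage P Q n N D =
     (SUP f\<in>entry_polys n N D - {0}.
        ereal ((\<integral>XY. eval_entries f XY \<partial>P) / sqrt (\<integral>XY. (eval_entries f XY)\<^sup>2 \<partial>Q)))"

subsection \<open>Asymptotics\<close>

definition variance_under :: "'a measure \<Rightarrow> ('a \<Rightarrow> real) \<Rightarrow> real" where
  "variance_under M f = (\<integral>\<omega>. (f \<omega> - (\<integral>\<omega>'. f \<omega>' \<partial>M))\<^sup>2 \<partial>M)"

text \<open>The Landau symbol of the library admits \<open>0 \<in> o(0)\<close>, which would make constant polynomials
  strongly separating; the first conjunct excludes this.\<close>

definition strongly_separates ::
  "(nat \<Rightarrow> 'a measure) \<Rightarrow> (nat \<Rightarrow> 'a measure) \<Rightarrow> (nat \<Rightarrow> 'a \<Rightarrow> real) \<Rightarrow> bool" where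
  "strongly_separates P Q f \<longleftrightarrow>
     (\<forall>\<^sub>F k in sequentially. (\<integral>\<omega>. f k \<omega> \<partial>P k) \<noteq> (\<integral>\<omega>. f k \<omega> \<partial>Q k)) \<and>
     (\<lambda>k. sqrt (max (variance_under (P k) (f k)) (variance_under (Q k) (f k))))
       \<in> o(\<lambda>k. \<bar>(\<integral>\<omega>. f k \<omega> \<partial>P k) - (\<integral>\<omega>. f k \<omega> \<partial>Q k)\<bar>)"

text \<open>\<open>n / N = \<gamma>\<close> exactly, so not every \<open>n\<close> need be admissible; the limit \<open>n \<rightarrow> \<infinity>\<close> is taken along
  arbitrary sequences of admissible sizes.\<close>

definition proportional_regime :: "real \<Rightarrow> (nat \<Rightarrow> nat) \<Rightarrow> (nat \<Rightarrow> nat) \<Rightarrow> bool" where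
  "proportional_regime \<gamma> n N \<longleftrightarrow>
     filterlim n at_top sequentially \<and> (\<forall>k. \<gamma> = real (n k) / real (N k))"

text \<open>\<open>D = n\<^bsup>o(1)\<^esup>\<close>, read as an upper bound, so that \<open>D = 0\<close> is allowed.\<close>

definition subpolynomial :: "(nat \<Rightarrow> nat) \<Rightarrow> (nat \<Rightarrow> nat) \<Rightarrow> bool" where
  "subpolynomial n D \<longleftrightarrow>
     (\<exists>e. e \<longlonglongrightarrow> 0 \<and> (\<forall>\<^sub>F k in sequentially. real (D k) \<le> real (n k) powr e k))"

end

theory Submission
  imports Defs "HOL-Computational_Algebra.Polynomial"
begin

text \<open>Expanding a polynomial of degree at most \<open>D\<close> in products of Hermite polynomials and applying the
  Cauchy-Schwarz inequality bounds the squared advantage by the truncated exponential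
  \<open>\<Sum>d\<le>D. E (S \<bullet> S')\<^sup>d / d!\<close> of the inner product of two independent copies \<open>S\<close>, \<open>S'\<close> of the signal. Here
  \<open>S \<bullet> S' = (\<lambda>/n) p U + (\<mu>/n) q V\<close> with the overlaps \<open>p = x \<bullet> x'\<close>, \<open>q = y \<bullet> y'\<close>, \<open>U = u \<bullet> u'\<close>,
  \<open>V = v \<bullet> v'\<close>. Since \<open>D\<close> is at most a small multiple of \<open>n\<close>, only exponential moments with small tilts
  are needed, and for these \<open>(p, q)\<close> is dominated by a Gaussian pair of correlation \<open>\<rho>\<^sup>2\<close>, up to an
  arbitrarily small relative loss \<open>\<eta>\<close> in the exponent. With \<open>2 s t \<le> \<kappa> s\<^sup>2 + t\<^sup>2 / \<kappa>\<close> the double series of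
  moments factors into two geometric series, both of which converge for a suitable \<open>\<kappa>\<close> exactly when
  \<open>A, B < 1\<close> and \<open>\<rho>\<^sup>4 A B < (1 - A) (1 - B)\<close>, where \<open>A = \<lambda>\<^sup>2/\<gamma>\<close>, \<open>B = \<mu>\<^sup>2/\<gamma>\<close>; this is the condition on the
  threshold. Strong separation is excluded by applying the bound to the polynomial minus its mean
  under the null law.\<close>

section \<open>Random variables with moments of all orders\<close>

text \<open>The truncation cannot be dropped: with \<open>p\<close> held fixed, the mean of exp
  (\<lambda> p U / n) is (1 - (\<lambda> p / n)^2)^(- N / 2) if \<lambda> |p| < n and infinite
  otherwise, so for an unbounded prior the full exponential moment may diverge. The estimate
  therefore runs moment by moment. The term of bidegree (j, k) in p U and q V splits into E p^j q^k,
  E U^j and E V^k, and only the first of these couples the two matrices. Each factor is bounded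
  through an exponential moment whose tilt is adapted to its own j or k. The tilts are of order sqrt
  (j / n), so a degree below \<delta> n keeps them in the range where the moment generating function
  of the prior is governed by its second-order expansion. That range depends on the prior, hence so
  does \<delta>, while the limiting Gaussian exponent, and with it the final constant, depends on
  \<lambda>, \<mu>, \<rho>, \<gamma> only. The correlation of p and q is \<rho>^2 and not \<rho>
  because each overlap multiplies two independent copies: E (x x' y y') = (E x y)^2.\<close>

definition all_moments :: "'a measure \<Rightarrow> ('a \<Rightarrow> real) \<Rightarrow> bool" where
  "all_moments M f \<longleftrightarrow> f \<in> borel_measurable M \<and> (\<forall>k::nat. integrable M (\<lambda>x. \<bar>f x\<bar> ^ k))"

lemma all_moments_measurable: "all_moments M f \<Longrightarrow> f \<in> borel_measurable M"
  by (simp add: all_moments_def)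

lemma all_moments_integrable_abs_power: "all_moments M f \<Longrightarrow> integrable M (\<lambda>x. \<bar>f x\<bar> ^ k)"
  by (simp add: all_moments_def)

lemma all_moments_integrable: "all_moments M f \<Longrightarrow> integrable M f"
  using all_moments_integrable_abs_power[of M f 1]
  by (simp add: all_moments_measurable integrable_abs_iff)

lemma all_moments_const: "finite_measure M \<Longrightarrow> all_moments M (\<lambda>_. c)"
  by (auto simp: all_moments_def finite_measure.integrable_const)

text \<open>The bound |f g|^k \<le> |f|^(2k) + |g|^(2k) trades a product for moments of twice the
  order, which is why all orders are required at once. The resulting class is an algebra, so
  integrability of the polynomial expressions below reduces to closure rules.\<close>

lemma all_moments_mult:
  assumes "all_moments M f" "all_moments M g"
  shows "all_moments M (\<lambda>x. f x * g x)"
  unfolding all_moments_def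
proof (intro conjI allI)
  note [measurable] = assms[THEN all_moments_measurable]
  show "(\<lambda>x. f x * g x) \<in> borel_measurable M" by simp
  fix k
  have "integrable M (\<lambda>x. \<bar>f x\<bar> ^ (2 * k) + \<bar>g x\<bar> ^ (2 * k))"
    using assms by (intro Bochner_Integration.integrable_add all_moments_integrable_abs_power)
  then show "integrable M (\<lambda>x. \<bar>f x * g x\<bar> ^ k)"
  proof (rule Bochner_Integration.integrable_bound)
    show "AE x in M. norm (\<bar>f x * g x\<bar> ^ k) \<le> norm (\<bar>f x\<bar> ^ (2 * k) + \<bar>g x\<bar> ^ (2 * k))"
    proof (rule AE_I2)
      fix x
      have *: "norm ((a * b) ^ k) \<le> norm (a ^ (2 * k) + b ^ (2 * k))" if "0 \<le> a" "0 \<le> b" for a b :: real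
      proof -
        have "2 * (a ^ k * b ^ k) \<le> (a ^ k)\<^sup>2 + (b ^ k)\<^sup>2"
          using sum_squares_bound[of "a ^ k" "b ^ k"] by (simp add: mult.assoc)
        moreover have "0 \<le> a ^ k * b ^ k" using that by simp
        ultimately have "a ^ k * b ^ k \<le> (a ^ k)\<^sup>2 + (b ^ k)\<^sup>2" by linarith
        then show ?thesis
          using that by (simp add: power_mult_distrib power_mult mult.commute[of 2] abs_of_nonneg)
      qed
      show "norm (\<bar>f x * g x\<bar> ^ k) \<le> norm (\<bar>f x\<bar> ^ (2 * k) + \<bar>g x\<bar> ^ (2 * k))"
        unfolding abs_mult by (rule *) simp_all
    qed
  qed simp
qed

lemma all_moments_add:
  assumes "all_moments M f" "all_moments M g"
  shows "all_moments M (\<lambda>x. f x + g x)"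
  unfolding all_moments_def
proof (intro conjI allI)
  note [measurable] = assms[THEN all_moments_measurable]
  show "(\<lambda>x. f x + g x) \<in> borel_measurable M" by simp
  fix k
  have "integrable M (\<lambda>x. 2 ^ k * (\<bar>f x\<bar> ^ k + \<bar>g x\<bar> ^ k))"
    using assms
    by (intro integrable_mult_right Bochner_Integration.integrable_add all_moments_integrable_abs_power)
  then show "integrable M (\<lambda>x. \<bar>f x + g x\<bar> ^ k)"
  proof (rule Bochner_Integration.integrable_bound)
    show "AE x in M. norm (\<bar>f x + g x\<bar> ^ k) \<le> norm (2 ^ k * (\<bar>f x\<bar> ^ k + \<bar>g x\<bar> ^ k))"
    proof (rule AE_I2)
      fix x
      have "\<bar>f x + g x\<bar> ^ k \<le> (2 * max \<bar>f x\<bar> \<bar>g x\<bar>) ^ k"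
        by (intro power_mono) auto
      also have "\<dots> \<le> 2 ^ k * (\<bar>f x\<bar> ^ k + \<bar>g x\<bar> ^ k)"
        by (auto simp: power_mult_distrib max_def)
      finally show "norm (\<bar>f x + g x\<bar> ^ k) \<le> norm (2 ^ k * (\<bar>f x\<bar> ^ k + \<bar>g x\<bar> ^ k))"
        by (simp add: abs_of_nonneg)
    qed
  qed simp
qed

lemma all_moments_cmult:
  "all_moments M f \<Longrightarrow> all_moments M (\<lambda>x. c * f x)"
  by (auto simp: all_moments_def abs_mult power_mult_distrib)

lemma all_moments_sum:
  assumes "finite_measure M" "\<And>i. i \<in> I \<Longrightarrow> all_moments M (f i)"
  shows "all_moments M (\<lambda>x. \<Sum>i\<in>I. f i x)"
  using assms(2)
  by (induction I rule: infinite_finite_induct)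
    (auto intro: all_moments_const assms(1) all_moments_add)

lemma all_moments_prod:
  assumes "finite_measure M" "\<And>i. i \<in> I \<Longrightarrow> all_moments M (f i)"
  shows "all_moments M (\<lambda>x. \<Prod>i\<in>I. f i x)"
  using assms(2)
  by (induction I rule: infinite_finite_induct)
    (auto intro: all_moments_const assms(1) all_moments_mult)

lemma all_moments_power:
  assumes "finite_measure M" "all_moments M f"
  shows "all_moments M (\<lambda>x. f x ^ k)"
  by (induction k) (auto intro: all_moments_const assms all_moments_mult)

text \<open>The hypothesis \<open>distr M N T = N\<close> says that \<open>T\<close> preserves the
  measure. Projections of products of probability spaces are such maps, so moment conditions on a
  factor lift to the product.\<close>

lemma all_moments_compose:
  assumes "all_moments N f" "T \<in> measurable M N" "distr M N T = N"
  shows "all_moments M (\<lambda>x. f (T x))"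
  unfolding all_moments_def
proof (intro conjI allI)
  note [measurable] = assms(2) assms(1)[THEN all_moments_measurable]
  show "(\<lambda>x. f (T x)) \<in> borel_measurable M" by simp
  fix k
  have "integrable (distr M N T) (\<lambda>x. \<bar>f x\<bar> ^ k)"
    using assms by (simp add: all_moments_def)
  then show "integrable M (\<lambda>x. \<bar>f (T x)\<bar> ^ k)"
    by (subst (asm) integrable_distr_eq) simp_all
qed

lemma distr_pair_snd:
  assumes "prob_space M" "sigma_finite_measure N"
  shows "distr (M \<Otimes>\<^sub>M N) N snd = N"
proof -
  interpret M: prob_space M by fact
  interpret N: sigma_finite_measure N by fact
  interpret pair_sigma_finite M N ..
  show ?thesis
  proof (rule measure_eqI)
    fix A assume "A \<in> sets (distr (M \<Otimes>\<^sub>M N) N snd)"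
    then have A: "A \<in> sets N" by simp
    then have "snd -` A \<inter> space (M \<Otimes>\<^sub>M N) = space M \<times> A"
      using sets.sets_into_space[OF A] by (auto simp: space_pair_measure)
    with A show "emeasure (distr (M \<Otimes>\<^sub>M N) N snd) A = emeasure N A"
      by (simp add: emeasure_distr N.emeasure_pair_measure_Times M.emeasure_space_1)
  qed simp
qed

lemma all_moments_fst:
  assumes "prob_space N" "all_moments M f"
  shows "all_moments (M \<Otimes>\<^sub>M N) (\<lambda>p. f (fst p))"
  by (rule all_moments_compose[OF assms(2)]) (auto simp: prob_space.distr_pair_fst[OF assms(1)])

lemma all_moments_snd:
  assumes "prob_space M" "prob_space N" "all_moments N f"
  shows "all_moments (M \<Otimes>\<^sub>M N) (\<lambda>p. f (snd p))"
  using prob_space_imp_sigma_finite[OF assms(2)]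
  by (intro all_moments_compose[OF assms(3)]) (auto simp: distr_pair_snd[OF assms(1)])

lemma all_moments_component:
  assumes "\<And>i. i \<in> I \<Longrightarrow> prob_space (M i)" "finite I" "i \<in> I" "all_moments (M i) f"
  shows "all_moments (PiM I M) (\<lambda>x. f (x i))"
  using assms by (intro all_moments_compose[OF assms(4)]) (auto simp: distr_PiM_component)

section \<open>Hermite polynomials\<close>

abbreviation gauss :: "real measure" where "gauss \<equiv> std_normal_distribution"

lemma prob_space_gauss: "prob_space gauss"
  by (rule prob_space_normal_density) simp

lemma integral_gauss:
  "f \<in> borel_measurable borel \<Longrightarrow> (\<integral>z. f z \<partial>gauss) = (\<integral>z. std_normal_density z * f z \<partial>lborel)"
  for f :: "real \<Rightarrow> real"
  by (subst integral_density) auto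

lemma all_moments_gauss_id: "all_moments gauss (\<lambda>z. z)"
  unfolding all_moments_def
  by (auto simp: integrable_density integrable_std_normal_moment_abs)

lemma all_moments_gauss_poly: "all_moments gauss (\<lambda>z. poly p z)"
proof -
  interpret prob_space gauss by (rule prob_space_gauss)
  show ?thesis
    unfolding poly_altdef
    by (intro all_moments_sum all_moments_cmult all_moments_power all_moments_gauss_id)
      (auto intro: finite_measure_axioms)
qed

text \<open>For even positive k both sides are odd moments and vanish; for k = 2m + 1 the factor k
  is the ratio of consecutive even moments (2m)! / (2^m m!). At k = 0 the factor
  \<open>of_nat k\<close> makes the truncated exponent \<open>k - 1\<close> harmless.\<close>

lemma gauss_stein_power: "(\<integral>z. z * z ^ k \<partial>gauss) = (\<integral>z. of_nat k * z ^ (k - 1) \<partial>gauss)"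
proof (cases "even k")
  case True
  then obtain m where m: "k = 2 * m" by (elim evenE)
  show ?thesis
  proof (cases m)
    case 0
    then show ?thesis using m integral_std_normal_moment_odd[of 0] by (simp add: integral_gauss)
  next
    case (Suc l)
    have "(\<integral>z. std_normal_density z * z ^ (2 * m + 1) \<partial>lborel) = 0"
      "(\<integral>z. std_normal_density z * z ^ (2 * l + 1) \<partial>lborel) = 0"
      by (rule integral_std_normal_moment_odd)+
    moreover have "k - 1 = 2 * l + 1" using m Suc by simp
    ultimately show ?thesis using m Suc by (simp add: integral_gauss)
  qed
next
  case False
  then obtain m where m: "k = 2 * m + 1" by (elim oddE)
  have "(\<integral>z. z * z ^ k \<partial>gauss) = (\<integral>z. std_normal_density z * z ^ (2 * Suc m) \<partial>lborel)"
    by (simp add: integral_gauss m)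
  also have "\<dots> = fact (2 * Suc m) / (2 ^ Suc m * fact (Suc m))"
    by (rule integral_std_normal_moment_even)
  also have "\<dots> = real k * (fact (2 * m) / (2 ^ m * fact m))"
    by (simp add: m divide_simps del: of_nat_Suc) (simp add: algebra_simps)
  also have "fact (2 * m) / (2 ^ m * fact m) = (\<integral>z. std_normal_density z * z ^ (2 * m) \<partial>lborel)"
    by (rule integral_std_normal_moment_even[symmetric])
  finally show ?thesis by (simp add: integral_gauss m)
qed

text \<open>Gaussian integration by parts (Stein's identity), extended linearly from
  monomials.\<close>

lemma gauss_stein: "(\<integral>z. z * poly p z \<partial>gauss) = (\<integral>z. poly (pderiv p) z \<partial>gauss)"
proof -
  interpret prob_space gauss by (rule prob_space_gauss)
  have int: "integrable gauss (\<lambda>z. poly q z)" for q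
    by (rule all_moments_integrable[OF all_moments_gauss_poly])
  have int1: "integrable gauss (\<lambda>z. z * poly q z)" for q
    using int[of "[:0, 1:] * q"] by simp
  have monom: "(\<integral>z. z * poly (Polynomial.monom c k) z \<partial>gauss) = (\<integral>z. poly (pderiv (Polynomial.monom c k)) z \<partial>gauss)"
    for c k
  proof -
    have "(\<integral>z. z * poly (Polynomial.monom c k) z \<partial>gauss) = c * (\<integral>z. z * z ^ k \<partial>gauss)"
      by (simp add: poly_monom mult_ac flip: Bochner_Integration.integral_mult_right_zero)
    also have "\<dots> = (\<integral>z. poly (pderiv (Polynomial.monom c k)) z \<partial>gauss)"
      by (simp only: gauss_stein_power)
         (simp add: pderiv_monom poly_monom mult_ac flip: Bochner_Integration.integral_mult_right_zero)
    finally show ?thesis .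
  qed
  let ?p = "\<lambda>n. \<Sum>i\<le>n. Polynomial.monom (coeff p i) i"
  have "(\<integral>z. z * poly (?p n) z \<partial>gauss) = (\<integral>z. poly (pderiv (?p n)) z \<partial>gauss)" for n
    by (induction n) (simp_all add: monom pderiv_add distrib_left int int1)
  from this[of "degree p"] show ?thesis
    by (simp add: poly_as_sum_of_monoms)
qed

text \<open>The monic, probabilists' Hermite polynomials. The recursion applies z - d/dz, which by
  Stein's identity is the adjoint of d/dz in L^2 of the Gaussian law; orthogonality and the shift
  rule both follow from this form.\<close>

primrec hermite_poly :: "nat \<Rightarrow> real poly" where
  "hermite_poly 0 = 1"
| "hermite_poly (Suc k) = [:0, 1:] * hermite_poly k - pderiv (hermite_poly k)"

lemma degree_hermite_poly_le: "degree (hermite_poly k) \<le> k"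
proof (induction k)
  case (Suc k)
  have "degree ([:0, 1:] * hermite_poly k) \<le> Suc k"
    using degree_mult_le[of "[:0, 1:]" "hermite_poly k"] Suc by simp
  moreover have "degree (pderiv (hermite_poly k)) \<le> Suc k"
    using Suc by (simp add: degree_pderiv)
  ultimately show ?case
    by (simp only: hermite_poly.simps) (rule degree_diff_le)
qed simp

lemma coeff_hermite_poly_top: "coeff (hermite_poly k) k = 1"
proof (induction k)
  case (Suc k)
  have "degree (pderiv (hermite_poly k)) < Suc k"
    using degree_hermite_poly_le[of k] by (simp add: degree_pderiv)
  then have "coeff (pderiv (hermite_poly k)) (Suc k) = 0"
    by (rule coeff_eq_0)
  with Suc show ?case by simp
qed simp

text \<open>Each factor z - d/dz of the Hermite polynomial moves to \<open>p\<close> as one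
  derivative: E ((z h - h') p) = E ((h p)' - h' p) = E (h p').\<close>

lemma gauss_hermite_mult:
  "(\<integral>z. poly (hermite_poly k) z * poly p z \<partial>gauss) = (\<integral>z. poly ((pderiv ^^ k) p) z \<partial>gauss)"
proof (induction k arbitrary: p)
  case (Suc k)
  have int: "integrable gauss (\<lambda>z. poly q z)" for q
    by (rule all_moments_integrable[OF all_moments_gauss_poly])
  let ?h = "hermite_poly k"
  have "(\<integral>z. poly (hermite_poly (Suc k)) z * poly p z \<partial>gauss)
      = (\<integral>z. z * poly (?h * p) z - poly (pderiv ?h * p) z \<partial>gauss)"
    by (simp add: algebra_simps)
  also have "\<dots> = (\<integral>z. poly (pderiv (?h * p)) z \<partial>gauss) - (\<integral>z. poly (pderiv ?h * p) z \<partial>gauss)"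
    using int[of "[:0, 1:] * (?h * p)"] gauss_stein[of "?h * p"]
    by (subst Bochner_Integration.integral_diff) (simp_all add: int del: poly_mult)
  also have "\<dots> = (\<integral>z. poly (pderiv (?h * p) - pderiv ?h * p) z \<partial>gauss)"
    unfolding poly_diff by (subst Bochner_Integration.integral_diff) (auto intro: int)
  also have "pderiv (?h * p) - pderiv ?h * p = ?h * pderiv p"
    by (simp add: pderiv_mult mult.commute)
  also have "(\<integral>z. poly (?h * pderiv p) z \<partial>gauss) = (\<integral>z. poly ((pderiv ^^ Suc k) p) z \<partial>gauss)"
    using Suc[of "pderiv p"] by (simp add: funpow_swap1)
  finally show ?case .
qed simp

lemma gauss_hermite_orthogonal_less:
  assumes "j < k"
  shows "(\<integral>z. poly (hermite_poly k) z * poly (hermite_poly j) z \<partial>gauss) = 0"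
proof -
  have "(pderiv ^^ k) (hermite_poly j) = 0"
    using degree_hermite_poly_le[of j] assms
    by (intro poly_eqI) (auto simp: coeff_higher_pderiv intro!: coeff_eq_0)
  then show ?thesis by (simp add: gauss_hermite_mult)
qed

text \<open>By adjointness it suffices to differentiate the polynomial of smaller index: too many
  derivatives annihilate it by degree, and for equal indices being monic leaves the constant
  k!.\<close>

lemma gauss_hermite_orthogonal:
  "(\<integral>z. poly (hermite_poly j) z * poly (hermite_poly k) z \<partial>gauss) = (if j = k then fact k else 0)"
proof -
  interpret prob_space gauss by (rule prob_space_gauss)
  consider "j < k" | "k < j" | "j = k" by linarith
  then show ?thesis
  proof cases
    case 1
    then show ?thesis using gauss_hermite_orthogonal_less[OF 1] by (simp add: mult.commute)
  next
    case 2
    then show ?thesis using gauss_hermite_orthogonal_less[OF 2] by simp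
  next
    case 3
    have "(pderiv ^^ k) (hermite_poly k) = [:fact k:]"
    proof (rule poly_eqI)
      fix n
      show "coeff ((pderiv ^^ k) (hermite_poly k)) n = coeff [:fact k:] n"
        using degree_hermite_poly_le[of k] coeff_hermite_poly_top[of k]
        by (cases n) (auto simp: coeff_higher_pderiv pochhammer_fact[symmetric] intro!: coeff_eq_0)
    qed
    with 3 show ?thesis using prob_space by (simp add: gauss_hermite_mult)
  qed
qed

text \<open>One step of the recursion produces the factor s + z minus a derivative; Stein's identity
  cancels z against the derivative, and a factor s remains. This rule makes the conditional mean of
  a Hermite product, given the signal, a pure monomial in the signal.\<close>

lemma gauss_hermite_shift: "(\<integral>z. poly (hermite_poly k) (s + z) \<partial>gauss) = s ^ k"
proof (induction k)
  case 0
  interpret prob_space gauss by (rule prob_space_gauss)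
  show ?case using prob_space by simp
next
  case (Suc k)
  let ?q = "pcompose (hermite_poly k) [:s, 1:]"
  have int: "integrable gauss (\<lambda>z. poly q z)" for q
    by (rule all_moments_integrable[OF all_moments_gauss_poly])
  have q: "poly (hermite_poly k) (s + z) = poly ?q z" "poly (pderiv (hermite_poly k)) (s + z) = poly (pderiv ?q) z" for z
    by (simp_all add: poly_pcompose pderiv_pcompose pderiv_pCons)
  have int1: "integrable gauss (\<lambda>z. z * poly ?q z)"
    using int[of "[:0, 1:] * ?q"] by simp
  have "(\<integral>z. poly (hermite_poly (Suc k)) (s + z) \<partial>gauss)
      = (\<integral>z. s * poly ?q z + (z * poly ?q z - poly (pderiv ?q) z) \<partial>gauss)"
    by (simp add: q[symmetric] algebra_simps)
  also have "\<dots> = s * (\<integral>z. poly ?q z \<partial>gauss)"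
    using int1 by (simp add: int gauss_stein)
  finally show ?case using Suc by (simp add: q)
qed

text \<open>Because the Hermite polynomials are monic, the leading coefficient can be stripped off
  one degree at a time.\<close>

lemma poly_hermite_expansion:
  assumes "degree p \<le> m"
  shows "\<exists>c. \<forall>z. poly p z = (\<Sum>k\<le>m. c k * poly (hermite_poly k) z)"
  using assms
proof (induction m arbitrary: p)
  case 0
  then obtain a where "p = [:a:]" by (auto elim: degree_eq_zeroE)
  then show ?case by (auto intro: exI[of _ "\<lambda>_. a"])
next
  case (Suc m)
  let ?a = "coeff p (Suc m)"
  let ?q = "p - smult ?a (hermite_poly (Suc m))"
  have "degree ?q \<le> m"
  proof (rule degree_le, intro allI impI)
    fix i assume "m < i"
    show "coeff ?q i = 0"
    proof (cases "i = Suc m")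
      case True
      then show ?thesis using coeff_hermite_poly_top[of "Suc m"] by (simp del: hermite_poly.simps)
    next
      case False
      with \<open>m < i\<close> have "degree p < i" "degree (hermite_poly (Suc m)) < i"
        using Suc.prems degree_hermite_poly_le[of "Suc m"] by linarith+
      then show ?thesis by (simp add: coeff_eq_0 del: hermite_poly.simps)
    qed
  qed
  then obtain c where c: "poly ?q z = (\<Sum>k\<le>m. c k * poly (hermite_poly k) z)" for z
    using Suc.IH by blast
  have "poly p z = (\<Sum>k\<le>Suc m. (c(Suc m := ?a)) k * poly (hermite_poly k) z)" for z
    using c[of z] by (simp del: hermite_poly.simps)
  then show ?case by blast
qed

lemma power_hermite_expansion:
  "\<exists>c. \<forall>z::real. z ^ m = (\<Sum>k\<le>m. c k * poly (hermite_poly k) z)"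
  using poly_hermite_expansion[of "Polynomial.monom 1 m" m] by (simp add: poly_monom degree_monom_eq)

section \<open>Expansion in products of Hermite polynomials\<close>

lemma pair_sigma_finite_prob: "prob_space M \<Longrightarrow> prob_space N \<Longrightarrow> pair_sigma_finite M N"
  by (simp add: pair_sigma_finite_def prob_space_imp_sigma_finite)

lemma
  fixes f :: "'a \<Rightarrow> real" and g :: "'b \<Rightarrow> real"
  assumes "prob_space M" "prob_space N" and f: "integrable M f" and g: "integrable N g"
  shows integrable_pair_mult: "integrable (M \<Otimes>\<^sub>M N) (\<lambda>p. f (fst p) * g (snd p))"
    and integral_pair_mult: "(\<integral>p. f (fst p) * g (snd p) \<partial>(M \<Otimes>\<^sub>M N)) = (\<integral>x. f x \<partial>M) * (\<integral>y. g y \<partial>N)"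
proof -
  interpret pair_sigma_finite M N by (rule pair_sigma_finite_prob) fact+
  note [measurable] = borel_measurable_integrable[OF f] borel_measurable_integrable[OF g]
  show int: "integrable (M \<Otimes>\<^sub>M N) (\<lambda>p. f (fst p) * g (snd p))"
    by (rule Fubini_integrable) (auto simp: abs_mult f g)
  show "(\<integral>p. f (fst p) * g (snd p) \<partial>(M \<Otimes>\<^sub>M N)) = (\<integral>x. f x \<partial>M) * (\<integral>y. g y \<partial>N)"
    by (subst integral_fst'[OF int, symmetric]) simp
qed

text \<open>A product over the disjoint sum of two index sets splits into one product per matrix,
  and the entries of each matrix are independent.\<close>

lemma
  fixes \<phi> :: "'i + 'j \<Rightarrow> real \<Rightarrow> real"
  assumes J: "finite J" and K: "finite K" and \<phi>: "\<And>e. e \<in> J <+> K \<Longrightarrow> integrable gauss (\<phi> e)"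
  shows integrable_gauss_pair_prod:
      "integrable (PiM J (\<lambda>_. gauss) \<Otimes>\<^sub>M PiM K (\<lambda>_. gauss))
         (\<lambda>w. \<Prod>e\<in>J <+> K. \<phi> e (case_sum (fst w) (snd w) e))"
    and integral_gauss_pair_prod:
      "(\<integral>w. (\<Prod>e\<in>J <+> K. \<phi> e (case_sum (fst w) (snd w) e))
          \<partial>(PiM J (\<lambda>_. gauss) \<Otimes>\<^sub>M PiM K (\<lambda>_. gauss))) = (\<Prod>e\<in>J <+> K. \<integral>z. \<phi> e z \<partial>gauss)"
proof -
  interpret G: prob_space gauss by (rule prob_space_gauss)
  have GI: "product_sigma_finite (\<lambda>_. gauss)"
    by (simp add: product_sigma_finite_def G.sigma_finite_measure_axioms)
  have P: "prob_space (PiM J (\<lambda>_. gauss))" "prob_space (PiM K (\<lambda>_. gauss))"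
    by (auto intro: prob_space_PiM prob_space_gauss)
  have split: "(\<lambda>w. \<Prod>e\<in>J <+> K. \<phi> e (case_sum (fst w) (snd w) e))
      = (\<lambda>w. (\<Prod>j\<in>J. \<phi> (Inl j) (fst w j)) * (\<Prod>k\<in>K. \<phi> (Inr k) (snd w k)))"
    using J K by (simp add: prod.Plus)
  have i: "integrable (PiM J (\<lambda>_. gauss)) (\<lambda>x. \<Prod>j\<in>J. \<phi> (Inl j) (x j))"
    "integrable (PiM K (\<lambda>_. gauss)) (\<lambda>x. \<Prod>k\<in>K. \<phi> (Inr k) (x k))"
    using J K \<phi> by (auto intro!: product_sigma_finite.product_integrable_prod[OF GI])
  show "integrable (PiM J (\<lambda>_. gauss) \<Otimes>\<^sub>M PiM K (\<lambda>_. gauss))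
         (\<lambda>w. \<Prod>e\<in>J <+> K. \<phi> e (case_sum (fst w) (snd w) e))"
    unfolding split by (rule integrable_pair_mult[OF P i])
  show "(\<integral>w. (\<Prod>e\<in>J <+> K. \<phi> e (case_sum (fst w) (snd w) e))
          \<partial>(PiM J (\<lambda>_. gauss) \<Otimes>\<^sub>M PiM K (\<lambda>_. gauss))) = (\<Prod>e\<in>J <+> K. \<integral>z. \<phi> e z \<partial>gauss)"
    unfolding split integral_pair_mult[OF P i]
    using J K \<phi>
    by (simp add: prod.Plus product_sigma_finite.product_integral_prod[OF GI, of J "\<lambda>j. \<phi> (Inl j)"]
      product_sigma_finite.product_integral_prod[OF GI, of K "\<lambda>k. \<phi> (Inr k)"] InlI InrI)
qed

text \<open>Extensionality makes the exponents on \<open>I\<close> determine the index. This gives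
  finiteness, and distinct indices differ at some entry of \<open>I\<close>, as orthogonality
  requires.\<close>

definition multi_indices :: "'e set \<Rightarrow> nat \<Rightarrow> ('e \<Rightarrow> nat) set" where
  "multi_indices I D = {\<beta> \<in> I \<rightarrow>\<^sub>E UNIV. (\<Sum>e\<in>I. \<beta> e) \<le> D}"

definition hermite_prod :: "'e set \<Rightarrow> ('e \<Rightarrow> nat) \<Rightarrow> ('e \<Rightarrow> real) \<Rightarrow> real" where
  "hermite_prod I \<beta> z = (\<Prod>e\<in>I. poly (hermite_poly (\<beta> e)) (z e))"

lemma finite_multi_indices:
  assumes "finite I"
  shows "finite (multi_indices I D)"
proof (rule finite_subset)
  show "multi_indices I D \<subseteq> (\<Pi>\<^sub>E e\<in>I. {..D})"
  proof
    fix \<beta> assume \<beta>: "\<beta> \<in> multi_indices I D"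
    have "\<beta> e \<le> D" if "e \<in> I" for e
      using member_le_sum[of e I \<beta>] that assms \<beta> by (auto simp: multi_indices_def)
    with \<beta> show "\<beta> \<in> (\<Pi>\<^sub>E e\<in>I. {..D})" by (auto simp: multi_indices_def PiE_iff)
  qed
  show "finite (\<Pi>\<^sub>E e\<in>I. {..D})" using assms by (intro finite_PiE) auto
qed

text \<open>A power z^m only involves Hermite polynomials of index at most m, so the expanded
  product stays in the box below \<open>m\<close> and the total degree does not grow.\<close>

lemma monomial_hermite_expansion:
  assumes I: "finite I" and m: "(\<Sum>e\<in>I. m e) \<le> D"
  shows "\<exists>b. \<forall>z. (\<Prod>e\<in>I. z e ^ m e) = (\<Sum>\<beta>\<in>multi_indices I D. b \<beta> * hermite_prod I \<beta> z)"
proof -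
  obtain c :: "nat \<Rightarrow> nat \<Rightarrow> real" where c: "z ^ k = (\<Sum>i\<le>k. c k i * poly (hermite_poly i) z)" for z k
    using power_hermite_expansion by metis
  let ?B = "\<Pi>\<^sub>E e\<in>I. {..m e}"
  \<comment> \<open>Zero outside the box, so that all monomials can be summed over one common index
    set.\<close>
  let ?b = "\<lambda>\<beta>. if \<beta> \<in> ?B then \<Prod>e\<in>I. c (m e) (\<beta> e) else 0"
  have sub: "?B \<subseteq> multi_indices I D"
  proof
    fix \<beta> assume \<beta>: "\<beta> \<in> ?B"
    then have "(\<Sum>e\<in>I. \<beta> e) \<le> (\<Sum>e\<in>I. m e)" by (intro sum_mono) (auto simp: PiE_iff)
    with \<beta> m show "\<beta> \<in> multi_indices I D" by (auto simp: multi_indices_def PiE_iff)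
  qed
  have "(\<Prod>e\<in>I. z e ^ m e) = (\<Sum>\<beta>\<in>multi_indices I D. ?b \<beta> * hermite_prod I \<beta> z)" for z
  proof -
    have "(\<Prod>e\<in>I. z e ^ m e) = (\<Prod>e\<in>I. \<Sum>i\<le>m e. c (m e) i * poly (hermite_poly i) (z e))"
      by (intro prod.cong refl c)
    also have "\<dots> = (\<Sum>\<beta>\<in>?B. \<Prod>e\<in>I. c (m e) (\<beta> e) * poly (hermite_poly (\<beta> e)) (z e))"
      using I by (subst prod_sum_PiE) auto
    also have "\<dots> = (\<Sum>\<beta>\<in>?B. ?b \<beta> * hermite_prod I \<beta> z)"
      by (simp add: hermite_prod_def prod.distrib)
    also have "\<dots> = (\<Sum>\<beta>\<in>multi_indices I D. ?b \<beta> * hermite_prod I \<beta> z)"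
      by (rule sum.mono_neutral_left[OF finite_multi_indices[OF I] sub]) auto
    finally show ?thesis .
  qed
  then show ?thesis by (intro exI[where x = ?b] allI)
qed

lemma polynomial_hermite_expansion:
  fixes K :: "('e \<Rightarrow>\<^sub>0 nat) set" and c :: "('e \<Rightarrow>\<^sub>0 nat) \<Rightarrow> real"
  assumes I: "finite I"
    and K: "\<And>m. m \<in> K \<Longrightarrow> Poly_Mapping.keys m \<subseteq> I \<and> (\<Sum>e\<in>Poly_Mapping.keys m. Poly_Mapping.lookup m e) \<le> D"
  shows "\<exists>b. \<forall>z. (\<Sum>m\<in>K. c m * (\<Prod>e\<in>Poly_Mapping.keys m. z e ^ Poly_Mapping.lookup m e))
                = (\<Sum>\<beta>\<in>multi_indices I D. b \<beta> * hermite_prod I \<beta> z)"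
proof -
  have "\<exists>b. \<forall>z. (\<Prod>e\<in>Poly_Mapping.keys m. z e ^ Poly_Mapping.lookup m e)
                = (\<Sum>\<beta>\<in>multi_indices I D. b \<beta> * hermite_prod I \<beta> z)" if "m \<in> K" for m
  proof -
    from K[OF that] have sub: "Poly_Mapping.keys m \<subseteq> I" by simp
    have "(\<Sum>e\<in>I. Poly_Mapping.lookup m e) = (\<Sum>e\<in>Poly_Mapping.keys m. Poly_Mapping.lookup m e)"
      by (rule sum.mono_neutral_right[OF I sub]) (auto simp: in_keys_iff)
    then have "(\<Sum>e\<in>I. Poly_Mapping.lookup m e) \<le> D" using K[OF that] by simp
    moreover have "(\<Prod>e\<in>Poly_Mapping.keys m. z e ^ Poly_Mapping.lookup m e) = (\<Prod>e\<in>I. z e ^ Poly_Mapping.lookup m e)" for z :: "'e \<Rightarrow> real"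
      by (rule prod.mono_neutral_left[OF I sub]) (auto simp: in_keys_iff)
    ultimately show ?thesis
      using monomial_hermite_expansion[OF I, of "Poly_Mapping.lookup m" D] by presburger
  qed
  then have "\<forall>m\<in>K. \<exists>b. \<forall>z. (\<Prod>e\<in>Poly_Mapping.keys m. z e ^ Poly_Mapping.lookup m e)
                = (\<Sum>\<beta>\<in>multi_indices I D. b \<beta> * hermite_prod I \<beta> z)" by blast
  from bchoice[OF this] obtain b where b: "\<And>m z. m \<in> K \<Longrightarrow> (\<Prod>e\<in>Poly_Mapping.keys m. z e ^ Poly_Mapping.lookup m e)
                = (\<Sum>\<beta>\<in>multi_indices I D. b m \<beta> * hermite_prod I \<beta> z)"
    by blast
  have "(\<Sum>m\<in>K. c m * (\<Prod>e\<in>Poly_Mapping.keys m. z e ^ Poly_Mapping.lookup m e))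
      = (\<Sum>\<beta>\<in>multi_indices I D. (\<Sum>m\<in>K. c m * b m \<beta>) * hermite_prod I \<beta> z)" for z
    by (simp add: b sum_distrib_left sum_distrib_right mult.assoc) (rule sum.swap)
  then show ?thesis by (intro exI[where x = "\<lambda>\<beta>. \<Sum>m\<in>K. c m * b m \<beta>"] allI)
qed

text \<open>Regrouping by total degree turns the truncated Cauchy product of two exponential series
  into binomial sums. This serves both to add one coordinate to a multi-index and to separate the
  contributions of the two matrices.\<close>

lemma sum_triangle_power_div_fact:
  fixes a s :: real
  shows "(\<Sum>k\<le>D. a ^ k / fact k * (\<Sum>d\<le>D - k. s ^ d / fact d)) = (\<Sum>d\<le>D. (a + s) ^ d / fact d)"
proof -
  let ?f = "\<lambda>k d. a ^ k / fact k * (s ^ d / fact d)"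
  have "(\<Sum>k\<le>D. a ^ k / fact k * (\<Sum>d\<le>D - k. s ^ d / fact d)) = (\<Sum>(k, d)\<in>(SIGMA k:{..D}. {..D - k}). ?f k d)"
    by (subst sum.Sigma[symmetric]) (auto simp: sum_distrib_left)
  also have "(SIGMA k:{..D}. {..D - k}) = {(i, j). i + j \<le> D}"
    by auto
  also have "(\<Sum>(k, d)\<in>{(i, j). i + j \<le> D}. ?f k d) = (\<Sum>d\<le>D. \<Sum>k\<le>d. ?f k (d - k))"
    by (rule sum.triangle_reindex_eq)
  also have "\<dots> = (\<Sum>d\<le>D. (a + s) ^ d / fact d)"
    by (intro sum.cong refl) (simp add: binomial_ring sum_divide_distrib binomial_fact)
  finally show ?thesis .
qed

text \<open>The multinomial theorem, truncated by degree. Peeling off one coordinate with exponent k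
  leaves the budget \<open>D - k\<close> for the others.\<close>

lemma sum_multi_indices_prod:
  fixes z :: "'e \<Rightarrow> real"
  assumes "finite I"
  shows "(\<Sum>\<beta>\<in>multi_indices I D. \<Prod>e\<in>I. z e ^ \<beta> e / fact (\<beta> e)) = (\<Sum>d\<le>D. (\<Sum>e\<in>I. z e) ^ d / fact d)"
  using assms
proof (induction I arbitrary: D rule: finite_induct)
  case empty
  have "(\<Sum>d\<le>D. (0::real) ^ d / fact d) = (\<Sum>d\<in>{0}. 0 ^ d / fact d)"
    by (rule sum.mono_neutral_right) auto
  then show ?case by (simp add: multi_indices_def)
next
  case (insert i I)
  let ?t = "\<lambda>I \<beta>. \<Prod>e\<in>I. z e ^ \<beta> e / fact (\<beta> e)"
  have "(\<Sum>\<beta>\<in>multi_indices (insert i I) D. ?t (insert i I) \<beta>)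
      = (\<Sum>(k, \<beta>)\<in>(SIGMA k:{..D}. multi_indices I (D - k)). z i ^ k / fact k * ?t I \<beta>)"
  \<comment> \<open>The removed coordinate is reset to \<open>undefined\<close>, since the remaining
    index has to be extensional on the smaller set.\<close>
  proof (rule sum.reindex_bij_witness[where i = "\<lambda>(k, \<beta>). \<beta>(i := k)" and j = "\<lambda>\<beta>. (\<beta> i, \<beta>(i := undefined))"])
    fix \<beta> assume \<beta>: "\<beta> \<in> multi_indices (insert i I) D"
    have eq: "(\<Sum>e\<in>I. if e = i then undefined else \<beta> e) = (\<Sum>e\<in>I. \<beta> e)"
      using insert.hyps by (intro sum.cong) auto
    show "(\<lambda>(k, \<beta>). \<beta>(i := k)) (\<beta> i, \<beta>(i := undefined)) = \<beta>" by simp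
    show "(\<beta> i, \<beta>(i := undefined)) \<in> (SIGMA k:{..D}. multi_indices I (D - k))"
      using \<beta> insert.hyps by (auto simp: multi_indices_def PiE_iff extensional_def eq)
    have "?t I (\<beta>(i := undefined)) = ?t I \<beta>"
      using insert.hyps by (intro prod.cong) auto
    then show "(case (\<beta> i, \<beta>(i := undefined)) of (k, \<beta>) \<Rightarrow> z i ^ k / fact k * ?t I \<beta>) = ?t (insert i I) \<beta>"
      using insert.hyps by simp
  next
    fix p assume p: "p \<in> (SIGMA k:{..D}. multi_indices I (D - k))"
    obtain k \<beta> where [simp]: "p = (k, \<beta>)" by (cases p)
    have eq: "(\<Sum>e\<in>I. if e = i then k else \<beta> e) = (\<Sum>e\<in>I. \<beta> e)"
      using insert.hyps by (intro sum.cong) auto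
    show "(\<lambda>\<beta>. (\<beta> i, \<beta>(i := undefined))) ((\<lambda>(k, \<beta>). \<beta>(i := k)) p) = p"
      using p insert.hyps by (auto simp: multi_indices_def PiE_iff extensional_def fun_eq_iff)
    show "(case p of (k, \<beta>) \<Rightarrow> \<beta>(i := k)) \<in> multi_indices (insert i I) D"
      using p insert.hyps by (auto simp: multi_indices_def PiE_iff extensional_def eq)
  qed
  also have "\<dots> = (\<Sum>k\<le>D. z i ^ k / fact k * (\<Sum>\<beta>\<in>multi_indices I (D - k). ?t I \<beta>))"
    by (subst sum.Sigma[symmetric]) (auto simp: sum_distrib_left finite_multi_indices insert.hyps)
  also have "\<dots> = (\<Sum>d\<le>D. (z i + (\<Sum>e\<in>I. z e)) ^ d / fact d)"
    by (simp only: insert.IH sum_triangle_power_div_fact)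
  finally show ?case using insert.hyps by simp
qed

text \<open>The shift rule and orthogonality, tensorised over the entries. The shift
  \<open>s\<close> is deterministic: the signal is frozen while the noise is averaged.\<close>

lemma
  assumes J: "finite J" and K: "finite K"
  defines "I \<equiv> J <+> K" and "G \<equiv> PiM J (\<lambda>_. gauss) \<Otimes>\<^sub>M PiM K (\<lambda>_. gauss)"
  shows integrable_hermite_prod_shift:
      "integrable G (\<lambda>w. hermite_prod I \<beta> (\<lambda>e. s e + case_sum (fst w) (snd w) e))" (is ?I1)
    and integral_hermite_prod_shift:
      "(\<integral>w. hermite_prod I \<beta> (\<lambda>e. s e + case_sum (fst w) (snd w) e) \<partial>G) = (\<Prod>e\<in>I. s e ^ \<beta> e)" (is ?S1)
    and integrable_hermite_prod_mult:
      "integrable G (\<lambda>w. hermite_prod I \<alpha> (case_sum (fst w) (snd w)) * hermite_prod I \<beta> (case_sum (fst w) (snd w)))" (is ?I2)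
    and integral_hermite_prod_mult:
      "\<lbrakk>\<alpha> \<in> I \<rightarrow>\<^sub>E UNIV; \<beta> \<in> I \<rightarrow>\<^sub>E UNIV\<rbrakk> \<Longrightarrow>
       (\<integral>w. hermite_prod I \<alpha> (case_sum (fst w) (snd w)) * hermite_prod I \<beta> (case_sum (fst w) (snd w)) \<partial>G)
         = (if \<alpha> = \<beta> then \<Prod>e\<in>I. fact (\<beta> e) else 0)"
proof -
  have int: "integrable gauss (\<lambda>z. poly q z)" for q
    by (rule all_moments_integrable[OF all_moments_gauss_poly])
  have int1: "integrable gauss (\<lambda>z. poly (hermite_poly k) (t + z))" for k t
    using int[of "pcompose (hermite_poly k) [:t, 1:]"] by (simp add: poly_pcompose)
  have int2: "integrable gauss (\<lambda>z. poly (hermite_poly j) z * poly (hermite_poly k) z)" for j k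
    using int[of "hermite_poly j * hermite_poly k"] by simp
  show ?I1 unfolding hermite_prod_def I_def G_def
    by (rule integrable_gauss_pair_prod[OF J K, of "\<lambda>e z. poly (hermite_poly (\<beta> e)) (s e + z)"]) (rule int1)
  show ?S1 unfolding hermite_prod_def I_def G_def
    by (subst integral_gauss_pair_prod[OF J K, of "\<lambda>e z. poly (hermite_poly (\<beta> e)) (s e + z)"])
       (simp_all add: int1 gauss_hermite_shift)
  show ?I2 unfolding hermite_prod_def I_def G_def prod.distrib[symmetric]
    by (rule integrable_gauss_pair_prod[OF J K, of "\<lambda>e z. poly (hermite_poly (\<alpha> e)) z * poly (hermite_poly (\<beta> e)) z"])
       (rule int2)
  assume ab: "\<alpha> \<in> I \<rightarrow>\<^sub>E UNIV" "\<beta> \<in> I \<rightarrow>\<^sub>E UNIV"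
  have "(\<integral>w. hermite_prod I \<alpha> (case_sum (fst w) (snd w)) * hermite_prod I \<beta> (case_sum (fst w) (snd w)) \<partial>G)
      = (\<Prod>e\<in>I. if \<alpha> e = \<beta> e then fact (\<beta> e) else 0)"
    unfolding hermite_prod_def I_def G_def prod.distrib[symmetric]
    by (subst integral_gauss_pair_prod[OF J K, of "\<lambda>e z. poly (hermite_poly (\<alpha> e)) z * poly (hermite_poly (\<beta> e)) z"])
       (auto simp: int2 gauss_hermite_orthogonal intro!: prod.cong)
  also have "\<dots> = (if \<alpha> = \<beta> then \<Prod>e\<in>I. fact (\<beta> e) else 0)"
  proof (cases "\<alpha> = \<beta>")
    case False
    then obtain e where "e \<in> I" "\<alpha> e \<noteq> \<beta> e" using ab by (meson PiE_ext)
    moreover have "finite I" using J K by (simp add: I_def)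
    ultimately show ?thesis using False by (auto intro!: prod_zero)
  qed simp
  finally show "(\<integral>w. hermite_prod I \<alpha> (case_sum (fst w) (snd w)) * hermite_prod I \<beta> (case_sum (fst w) (snd w)) \<partial>G)
         = (if \<alpha> = \<beta> then \<Prod>e\<in>I. fact (\<beta> e) else 0)" .
qed

text \<open>A squared mean is a mean over two independent copies; this is where the second replica
  enters.\<close>

lemma square_integral_eq_iterated:
  fixes f :: "'a \<Rightarrow> real"
  shows "(\<integral>x. f x \<partial>M)\<^sup>2 = (\<integral>x. \<integral>y. f x * f y \<partial>M \<partial>M)"
  by (simp add: power2_eq_square)

text \<open>Given the signal, the mean of the Hermite product with index \<beta> is the monomial
  \<open>s \<beta>\<close>, and under pure noise the second moment is diagonal with weights
  \<open>r \<beta>\<close>, the products of factorials. Cauchy-Schwarz with these weights leaves the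
  squared signal moments divided by \<open>r \<beta>\<close>; written over two replicas they are
  summed by the truncated multinomial theorem. The product form needs no separate case for a
  vanishing second moment.\<close>

lemma low_degree_second_moment_bound:
  fixes c :: "('i + 'j \<Rightarrow>\<^sub>0 nat) \<Rightarrow> real" and S :: "'m \<Rightarrow> 'i + 'j \<Rightarrow> real"
  assumes J: "finite J" and K: "finite K"
  defines "I \<equiv> J <+> K" and "G \<equiv> PiM J (\<lambda>_. gauss) \<Otimes>\<^sub>M PiM K (\<lambda>_. gauss)"
  assumes A: "\<And>m. m \<in> A \<Longrightarrow> Poly_Mapping.keys m \<subseteq> I \<and> (\<Sum>e\<in>Poly_Mapping.keys m. Poly_Mapping.lookup m e) \<le> D"
    and M: "prob_space M" and S: "\<And>e. e \<in> I \<Longrightarrow> all_moments M (\<lambda>\<omega>. S \<omega> e)"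
  defines "F \<equiv> \<lambda>z. \<Sum>m\<in>A. c m * (\<Prod>e\<in>Poly_Mapping.keys m. z e ^ Poly_Mapping.lookup m e)"
  shows "(\<integral>\<omega>. \<integral>w. F (\<lambda>e. S \<omega> e + case_sum (fst w) (snd w) e) \<partial>G \<partial>M)\<^sup>2
    \<le> (\<integral>w. (F (case_sum (fst w) (snd w)))\<^sup>2 \<partial>G)
       * (\<integral>\<omega>. \<integral>\<omega>'. (\<Sum>d\<le>D. (\<Sum>e\<in>I. S \<omega> e * S \<omega>' e) ^ d / fact d) \<partial>M \<partial>M)"
proof -
  interpret M: prob_space M by fact
  have I: "finite I" using J K by (simp add: I_def)
  let ?B = "multi_indices I D"
  note fin = finite_multi_indices[OF I, of D]
  obtain b where b: "\<And>z. F z = (\<Sum>\<beta>\<in>?B. b \<beta> * hermite_prod I \<beta> z)"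
    using polynomial_hermite_expansion[OF I A, where c = c] unfolding F_def by blast
  define r where "r \<beta> = (\<Prod>e\<in>I. fact (\<beta> e) :: real)" for \<beta>
  have r: "r \<beta> > 0" for \<beta> unfolding r_def by (intro prod_pos) simp
  define s where "s \<beta> \<omega> = (\<Prod>e\<in>I. S \<omega> e ^ \<beta> e)" for \<beta> \<omega>
  have s_int: "integrable M (s \<beta>)" for \<beta>
    unfolding s_def
    by (intro all_moments_integrable all_moments_prod all_moments_power S M.finite_measure_axioms)
  have shift: "(\<integral>w. F (\<lambda>e. S \<omega> e + case_sum (fst w) (snd w) e) \<partial>G) = (\<Sum>\<beta>\<in>?B. b \<beta> * s \<beta> \<omega>)" for \<omega>
    using integrable_hermite_prod_shift[OF J K, folded I_def G_def]
      integral_hermite_prod_shift[OF J K, folded I_def G_def]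
    by (simp add: b s_def)
  have mean: "(\<integral>\<omega>. \<integral>w. F (\<lambda>e. S \<omega> e + case_sum (fst w) (snd w) e) \<partial>G \<partial>M) = (\<Sum>\<beta>\<in>?B. b \<beta> * (\<integral>\<omega>. s \<beta> \<omega> \<partial>M))"
    unfolding shift using s_int by simp
  have "(\<integral>w. (F (case_sum (fst w) (snd w)))\<^sup>2 \<partial>G)
      = (\<integral>w. (\<Sum>\<alpha>\<in>?B. \<Sum>\<beta>\<in>?B. b \<alpha> * b \<beta> *
           (hermite_prod I \<alpha> (case_sum (fst w) (snd w)) * hermite_prod I \<beta> (case_sum (fst w) (snd w)))) \<partial>G)"
    by (simp add: b power2_eq_square sum_product mult_ac)
  also have "\<dots> = (\<Sum>\<alpha>\<in>?B. \<Sum>\<beta>\<in>?B. b \<alpha> * b \<beta> *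
           (\<integral>w. hermite_prod I \<alpha> (case_sum (fst w) (snd w)) * hermite_prod I \<beta> (case_sum (fst w) (snd w)) \<partial>G))"
    by (simp add: integrable_hermite_prod_mult[OF J K, folded I_def G_def])
  also have "\<dots> = (\<Sum>\<alpha>\<in>?B. \<Sum>\<beta>\<in>?B. b \<alpha> * b \<beta> * (if \<alpha> = \<beta> then r \<beta> else 0))"
  proof (intro sum.cong refl)
    fix \<alpha> \<beta> assume "\<alpha> \<in> ?B" "\<beta> \<in> ?B"
    then have "\<alpha> \<in> I \<rightarrow>\<^sub>E UNIV" "\<beta> \<in> I \<rightarrow>\<^sub>E UNIV" by (simp_all add: multi_indices_def)
    note integral_hermite_prod_mult[OF J K, folded I_def G_def, OF this]
    then show "b \<alpha> * b \<beta> * (\<integral>w. hermite_prod I \<alpha> (case_sum (fst w) (snd w)) * hermite_prod I \<beta> (case_sum (fst w) (snd w)) \<partial>G)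
        = b \<alpha> * b \<beta> * (if \<alpha> = \<beta> then r \<beta> else 0)"
      by (simp only: r_def)
  qed
  also have "\<dots> = (\<Sum>\<alpha>\<in>?B. (b \<alpha>)\<^sup>2 * r \<alpha>)"
  proof (intro sum.cong refl)
    fix \<alpha> assume "\<alpha> \<in> ?B"
    then show "(\<Sum>\<beta>\<in>?B. b \<alpha> * b \<beta> * (if \<alpha> = \<beta> then r \<beta> else 0)) = (b \<alpha>)\<^sup>2 * r \<alpha>"
      using fin by (simp add: power2_eq_square if_distrib[of "\<lambda>x. _ * x"] sum.delta' cong: if_cong)
  qed
  finally have null: "(\<integral>w. (F (case_sum (fst w) (snd w)))\<^sup>2 \<partial>G) = (\<Sum>\<alpha>\<in>?B. (b \<alpha>)\<^sup>2 * r \<alpha>)" .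
  have "(\<Sum>\<beta>\<in>?B. (\<integral>\<omega>. s \<beta> \<omega> \<partial>M)\<^sup>2 / r \<beta>) = (\<Sum>\<beta>\<in>?B. \<integral>\<omega>. \<integral>\<omega>'. s \<beta> \<omega> * s \<beta> \<omega>' / r \<beta> \<partial>M \<partial>M)"
    by (simp add: square_integral_eq_iterated)
  also have "\<dots> = (\<integral>\<omega>. \<integral>\<omega>'. (\<Sum>\<beta>\<in>?B. s \<beta> \<omega> * s \<beta> \<omega>' / r \<beta>) \<partial>M \<partial>M)"
    using s_int by simp
  also have "\<dots> = (\<integral>\<omega>. \<integral>\<omega>'. (\<Sum>d\<le>D. (\<Sum>e\<in>I. S \<omega> e * S \<omega>' e) ^ d / fact d) \<partial>M \<partial>M)"
  proof -
    have "(\<Sum>\<beta>\<in>?B. s \<beta> \<omega> * s \<beta> \<omega>' / r \<beta>) = (\<Sum>d\<le>D. (\<Sum>e\<in>I. S \<omega> e * S \<omega>' e) ^ d / fact d)" for \<omega> \<omega>'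
      by (subst sum_multi_indices_prod[OF I, symmetric])
         (simp add: s_def r_def power_mult_distrib prod.distrib prod_dividef)
    then show ?thesis by simp
  qed
  finally have kernel: "(\<Sum>\<beta>\<in>?B. (\<integral>\<omega>. s \<beta> \<omega> \<partial>M)\<^sup>2 / r \<beta>)
      = (\<integral>\<omega>. \<integral>\<omega>'. (\<Sum>d\<le>D. (\<Sum>e\<in>I. S \<omega> e * S \<omega>' e) ^ d / fact d) \<partial>M \<partial>M)" .
  have "(\<Sum>\<beta>\<in>?B. b \<beta> * (\<integral>\<omega>. s \<beta> \<omega> \<partial>M))\<^sup>2 = (\<Sum>\<beta>\<in>?B. (b \<beta> * sqrt (r \<beta>)) * ((\<integral>\<omega>. s \<beta> \<omega> \<partial>M) / sqrt (r \<beta>)))\<^sup>2"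
    using r by (simp add: less_imp_neq[symmetric])
  also have "\<dots> \<le> (\<Sum>\<beta>\<in>?B. (b \<beta> * sqrt (r \<beta>))\<^sup>2) * (\<Sum>\<beta>\<in>?B. ((\<integral>\<omega>. s \<beta> \<omega> \<partial>M) / sqrt (r \<beta>))\<^sup>2)"
    by (rule Cauchy_Schwarz_ineq_sum)
  also have "\<dots> = (\<Sum>\<beta>\<in>?B. (b \<beta>)\<^sup>2 * r \<beta>) * (\<Sum>\<beta>\<in>?B. (\<integral>\<omega>. s \<beta> \<omega> \<partial>M)\<^sup>2 / r \<beta>)"
    using r by (simp add: power_mult_distrib power_divide less_imp_le)
  finally show ?thesis unfolding mean null kernel .
qed

section \<open>Exponential moments of overlaps\<close>

lemma nn_integral_gauss:
  "f \<in> borel_measurable borel \<Longrightarrow> (\<integral>\<^sup>+z. f z \<partial>gauss) = (\<integral>\<^sup>+z. ennreal (std_normal_density z) * f z \<partial>lborel)"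
  by (rule nn_integral_density) auto

lemma nn_integral_normal_density: "\<sigma> > 0 \<Longrightarrow> (\<integral>\<^sup>+z. ennreal (normal_density m \<sigma> z) \<partial>lborel) = 1"
  by (subst nn_integral_eq_integral) (auto simp: integral_normal_density integrable_normal_density)

text \<open>Completing the square moves the centre of the density to \<open>t\<close>.\<close>

lemma gauss_mgf: "(\<integral>\<^sup>+z. ennreal (exp (t * z)) \<partial>gauss) = ennreal (exp (t\<^sup>2 / 2))"
proof -
  have eq: "std_normal_density z * exp (t * z) = exp (t\<^sup>2 / 2) * normal_density t 1 z" for z
    by (simp add: normal_density_def exp_add[symmetric] power2_eq_square field_simps)
  have "(\<integral>\<^sup>+z. ennreal (exp (t * z)) \<partial>gauss)
      = (\<integral>\<^sup>+z. ennreal (exp (t\<^sup>2 / 2)) * ennreal (normal_density t 1 z) \<partial>lborel)"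
    by (subst nn_integral_gauss) (simp_all flip: ennreal_mult'' add: eq)
  also have "\<dots> = ennreal (exp (t\<^sup>2 / 2))"
    by (subst nn_integral_cmult) (simp_all add: nn_integral_normal_density)
  finally show ?thesis .
qed

text \<open>The tilt z^2 / 4 turns the standard density into \<open>sqrt 2\<close> times the centred
  density of variance 2.\<close>

lemma gauss_exp_square: "(\<integral>\<^sup>+z. ennreal (exp (z\<^sup>2 / 4)) \<partial>gauss) = ennreal (sqrt 2)"
proof -
  have eq: "std_normal_density z * exp (z\<^sup>2 / 4) = sqrt 2 * normal_density 0 (sqrt 2) z" for z
    by (simp add: normal_density_def exp_add[symmetric] real_sqrt_mult field_simps)
  have "(\<integral>\<^sup>+z. ennreal (exp (z\<^sup>2 / 4)) \<partial>gauss)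
      = (\<integral>\<^sup>+z. ennreal (sqrt 2) * ennreal (normal_density 0 (sqrt 2) z) \<partial>lborel)"
    by (subst nn_integral_gauss) (simp_all flip: ennreal_mult'' add: eq)
  also have "\<dots> = ennreal (sqrt 2)"
    by (subst nn_integral_cmult) (simp_all add: nn_integral_normal_density)
  finally show ?thesis .
qed

text \<open>With this, the Gaussian vectors \<open>u\<close> and \<open>v\<close> fall under the
  same overlap bound as the prior.\<close>

lemma subgaussian_gauss: "subgaussian gauss 1 (\<lambda>z. z)"
proof -
  have "integrable gauss (\<lambda>z. exp (t * z))" for t
    by (rule integrableI_nonneg) (simp_all add: gauss_mgf)
  moreover have "(\<integral>z. exp (t * z) \<partial>gauss) = exp (t\<^sup>2 / 2)" for t
    by (subst integral_eq_nn_integral) (simp_all add: gauss_mgf)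
  ultimately show ?thesis by (simp add: subgaussian_def)
qed

text \<open>Gaussian linearisation: \<open>exp (x\<^sup>2 / (4 c\<^sup>2))\<close> is the Gaussian average over \<open>z\<close> of
  \<open>exp (t x)\<close> with \<open>t = z / (sqrt 2 c)\<close>.\<close>

lemma subgaussian_integrable_exp_square:
  assumes "prob_space M" and X: "subgaussian M c X"
  shows "integrable M (\<lambda>\<omega>. exp ((X \<omega>)\<^sup>2 / (4 * c\<^sup>2)))"
proof (rule integrableI_nonneg)
  interpret M: prob_space M by fact
  interpret G: prob_space gauss by (rule prob_space_gauss)
  interpret pair_sigma_finite M gauss ..
  have [measurable]: "X \<in> borel_measurable M" and c: "c > 0" using X by (auto simp: subgaussian_def)
  have X_int: "integrable M (\<lambda>\<omega>. exp (t * X \<omega>))"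
    and X_le: "(\<integral>\<omega>. exp (t * X \<omega>) \<partial>M) \<le> exp (c\<^sup>2 * t\<^sup>2 / 2)" for t
    using X by (auto simp: subgaussian_def)
  show "(\<lambda>\<omega>. exp ((X \<omega>)\<^sup>2 / (4 * c\<^sup>2))) \<in> borel_measurable M" by simp
  have "(\<integral>\<^sup>+\<omega>. ennreal (exp ((X \<omega>)\<^sup>2 / (4 * c\<^sup>2))) \<partial>M)
      = (\<integral>\<^sup>+\<omega>. \<integral>\<^sup>+z. ennreal (exp (X \<omega> / (sqrt 2 * c) * z)) \<partial>gauss \<partial>M)"
    unfolding gauss_mgf by (simp add: power_divide power_mult_distrib)
  also have "\<dots> = (\<integral>\<^sup>+z. \<integral>\<^sup>+\<omega>. ennreal (exp (X \<omega> / (sqrt 2 * c) * z)) \<partial>M \<partial>gauss)"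
    by (rule Fubini'[symmetric]) simp
  also have "\<dots> \<le> (\<integral>\<^sup>+z. ennreal (exp (z\<^sup>2 / 4)) \<partial>gauss)"
  proof (rule nn_integral_mono)
    fix z
    let ?t = "z / (sqrt 2 * c)"
    have "(\<integral>\<^sup>+\<omega>. ennreal (exp (X \<omega> / (sqrt 2 * c) * z)) \<partial>M) = (\<integral>\<^sup>+\<omega>. ennreal (exp (?t * X \<omega>)) \<partial>M)"
      by (simp add: mult.commute)
    also have "\<dots> = ennreal (\<integral>\<omega>. exp (?t * X \<omega>) \<partial>M)"
      by (intro nn_integral_eq_integral X_int) simp
    also have "\<dots> \<le> ennreal (exp (c\<^sup>2 * ?t\<^sup>2 / 2))"
      by (intro ennreal_leI X_le)
    also have "c\<^sup>2 * ?t\<^sup>2 / 2 = z\<^sup>2 / 4"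
      using c by (simp add: power_divide power_mult_distrib)
    finally show "(\<integral>\<^sup>+\<omega>. ennreal (exp (X \<omega> / (sqrt 2 * c) * z)) \<partial>M) \<le> ennreal (exp (z\<^sup>2 / 4))" .
  qed
  also have "\<dots> < \<infinity>" by (simp add: gauss_exp_square)
  finally show "(\<integral>\<^sup>+\<omega>. ennreal (exp ((X \<omega>)\<^sup>2 / (4 * c\<^sup>2))) \<partial>M) < \<infinity>" .
qed simp

lemma power_le_fact_mult_exp: "0 \<le> x \<Longrightarrow> x ^ k \<le> fact k * exp x" for x :: real
proof -
  assume x: "0 \<le> x"
  have "(\<Sum>n\<in>{k}. x ^ n /\<^sub>R fact n) \<le> suminf (\<lambda>n. x ^ n /\<^sub>R fact n)"
    using x by (intro sum_le_suminf summable_exp_generic) auto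
  then show ?thesis by (simp add: exp_def divide_simps mult.commute)
qed

lemma exp_abs_le: "exp \<bar>x\<bar> \<le> exp x + exp (- x)" for x :: real
  by (auto simp: abs_if)

lemma subgaussian_all_moments:
  assumes X: "subgaussian M c X"
  shows "all_moments M X"
  unfolding all_moments_def
proof (intro conjI allI)
  show [measurable]: "X \<in> borel_measurable M" using X by (auto simp: subgaussian_def)
  fix k
  have "integrable M (\<lambda>\<omega>. fact k * (exp (1 * X \<omega>) + exp ((-1) * X \<omega>)) :: real)"
    using X unfolding subgaussian_def by (intro integrable_mult_right Bochner_Integration.integrable_add) blast+
  then show "integrable M (\<lambda>\<omega>. \<bar>X \<omega>\<bar> ^ k)"
  proof (rule Bochner_Integration.integrable_bound)
    show "AE \<omega> in M. norm (\<bar>X \<omega>\<bar> ^ k) \<le> norm (fact k * (exp (1 * X \<omega>) + exp ((-1) * X \<omega>)) :: real)"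
    proof (rule AE_I2)
      fix \<omega>
      have "\<bar>X \<omega>\<bar> ^ k \<le> fact k * exp \<bar>X \<omega>\<bar>" by (rule power_le_fact_mult_exp) simp
      also have "\<dots> \<le> fact k * (exp (X \<omega>) + exp (- X \<omega>))"
        by (intro mult_left_mono exp_abs_le) simp
      finally show "norm (\<bar>X \<omega>\<bar> ^ k) \<le> norm (fact k * (exp (1 * X \<omega>) + exp ((-1) * X \<omega>)) :: real)"
        by (simp add: abs_of_nonneg add_nonneg_nonneg)
    qed
  qed simp
qed

text \<open>Taylor's formula of order three. The terms up to second order are kept exact because
  their mean gives the sharp exponent; only the cubic term is estimated.\<close>

lemma exp_le_cubic_remainder:
  "exp x \<le> 1 + x + x\<^sup>2 / 2 + \<bar>x\<bar> ^ 3 / 6 * exp \<bar>x\<bar>" for x :: real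
proof -
  obtain t where t: "\<bar>t\<bar> \<le> \<bar>x\<bar>" and eq: "exp x = (\<Sum>m<3. x ^ m / fact m) + exp t / fact 3 * x ^ 3"
    using Maclaurin_exp_le[of x 3] by blast
  have "exp t / fact 3 * x ^ 3 \<le> exp \<bar>x\<bar> / 6 * \<bar>x\<bar> ^ 3"
  proof (rule order_trans[OF abs_ge_self])
    have "exp t \<le> exp \<bar>x\<bar>" using t by simp
    then show "\<bar>exp t / fact 3 * x ^ 3\<bar> \<le> exp \<bar>x\<bar> / 6 * \<bar>x\<bar> ^ 3"
      by (simp add: abs_mult power_abs fact_numeral mult_right_mono)
  qed
  then show ?thesis using eq by (simp add: eval_nat_numeral mult_ac)
qed

section \<open>Moment generating function of one coordinate of the overlaps\<close>

definition cross_exponent :: "('a \<Rightarrow> real) \<Rightarrow> ('a \<Rightarrow> real) \<Rightarrow> real \<Rightarrow> real \<Rightarrow> 'a \<times> 'a \<Rightarrow> real" where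
  "cross_exponent X Y s t p = s * (X (fst p) * X (snd p)) + t * (Y (fst p) * Y (snd p))"

text \<open>In the second-order expansion the linear term vanishes by centring, and the quadratic
  term has exactly the Gaussian mean by independence of the copies. The cubic remainder is of order
  m^3 with m the larger tilt, hence at most an arbitrarily small multiple of m^2 for small tilts;
  this is the loss \<eta>. Finally 1 + z \<le> exp z restores the exponential.\<close>

lemma subgaussian_cross_mgf:
  assumes M: "prob_space M" and X: "subgaussian M c X" and Y: "subgaussian M c Y"
    and X1: "(\<integral>\<omega>. X \<omega> \<partial>M) = 0" and Y1: "(\<integral>\<omega>. Y \<omega> \<partial>M) = 0"
    and X2: "(\<integral>\<omega>. (X \<omega>)\<^sup>2 \<partial>M) = 1" and Y2: "(\<integral>\<omega>. (Y \<omega>)\<^sup>2 \<partial>M) = 1"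
    and XY: "(\<integral>\<omega>. X \<omega> * Y \<omega> \<partial>M) = r" and \<eta>: "\<eta> > 0"
  shows "\<exists>\<delta>>0. \<forall>s t. \<bar>s\<bar> \<le> \<delta> \<longrightarrow> \<bar>t\<bar> \<le> \<delta> \<longrightarrow>
    (\<integral>\<^sup>+p. ennreal (exp (cross_exponent X Y s t p)) \<partial>(M \<Otimes>\<^sub>M M))
      \<le> ennreal (exp ((s\<^sup>2 + 2 * r\<^sup>2 * (s * t) + t\<^sup>2 + \<eta> * (s\<^sup>2 + t\<^sup>2)) / 2))"
proof -
  interpret M: prob_space M by fact
  interpret MM: prob_space "M \<Otimes>\<^sub>M M" by (rule prob_space_pair[OF M M])
  have c: "c > 0" and [measurable]: "X \<in> borel_measurable M" "Y \<in> borel_measurable M"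
    using X Y by (auto simp: subgaussian_def)
  note XA = subgaussian_all_moments[OF X] and YA = subgaussian_all_moments[OF Y]
  \<comment> \<open>Half of the exponent 1 / (4 c^2) at which a single square is exponentially
    integrable: the sum of two squares is at most twice the larger one.\<close>
  define \<theta> where "\<theta> = 1 / (8 * c\<^sup>2)"
  have \<theta>: "\<theta> > 0" using c by (simp add: \<theta>_def)
  define g where "g \<omega> = exp (\<theta> * ((X \<omega>)\<^sup>2 + (Y \<omega>)\<^sup>2))" for \<omega>
  have [measurable]: "g \<in> borel_measurable M" unfolding g_def by simp
  have g_int: "integrable M g"
  proof (rule Bochner_Integration.integrable_bound)
    show "integrable M (\<lambda>\<omega>. exp ((X \<omega>)\<^sup>2 / (4 * c\<^sup>2)) + exp ((Y \<omega>)\<^sup>2 / (4 * c\<^sup>2)))"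
      by (intro Bochner_Integration.integrable_add subgaussian_integrable_exp_square M X Y)
    show "AE \<omega> in M. norm (g \<omega>) \<le> norm (exp ((X \<omega>)\<^sup>2 / (4 * c\<^sup>2)) + exp ((Y \<omega>)\<^sup>2 / (4 * c\<^sup>2)))"
    proof (rule AE_I2)
      fix \<omega>
      have *: "exp (\<theta> * (a + b)) \<le> exp (a / (4 * c\<^sup>2)) + exp (b / (4 * c\<^sup>2))" for a b
      proof -
        have "\<theta> * (a + b) \<le> max (a / (4 * c\<^sup>2)) (b / (4 * c\<^sup>2))"
          using c by (auto simp: \<theta>_def max_def divide_simps)
        then have "exp (\<theta> * (a + b)) \<le> exp (max (a / (4 * c\<^sup>2)) (b / (4 * c\<^sup>2)))" by simp
        also have "\<dots> \<le> exp (a / (4 * c\<^sup>2)) + exp (b / (4 * c\<^sup>2))" by (simp add: max_def)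
        finally show ?thesis .
      qed
      show "norm (g \<omega>) \<le> norm (exp ((X \<omega>)\<^sup>2 / (4 * c\<^sup>2)) + exp ((Y \<omega>)\<^sup>2 / (4 * c\<^sup>2)))"
        using *[of "(X \<omega>)\<^sup>2" "(Y \<omega>)\<^sup>2"] by (simp add: g_def abs_of_nonneg add_nonneg_nonneg)
    qed
  qed simp
  define E where "E = (\<integral>p. g (fst p) * g (snd p) \<partial>(M \<Otimes>\<^sub>M M))"
  have E_int: "integrable (M \<Otimes>\<^sub>M M) (\<lambda>p. g (fst p) * g (snd p))"
    by (rule integrable_pair_mult[OF M M g_int g_int])
  have E0: "E \<ge> 0" unfolding E_def by (rule Bochner_Integration.integral_nonneg) (simp add: g_def)
  \<comment> \<open>Makes the cubic remainder m^3 E / \<theta>^3 at most m^2 \<eta> / 2 for m \<le>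
    \<delta>; the summand 1 in \<open>E + 1\<close> keeps the divisor positive.\<close>
  define \<delta> where "\<delta> = min \<theta> (\<eta> * \<theta> ^ 3 / (2 * (E + 1)))"
  have \<delta>: "\<delta> > 0" "\<delta> \<le> \<theta>" "\<delta> * E / \<theta> ^ 3 \<le> \<eta> / 2"
  proof -
    show "\<delta> > 0" "\<delta> \<le> \<theta>" using \<theta> \<eta> E0 by (auto simp: \<delta>_def)
    have "\<delta> * E \<le> \<eta> * \<theta> ^ 3 / (2 * (E + 1)) * (E + 1)"
      using E0 \<theta> \<eta> by (intro mult_mono) (auto simp: \<delta>_def)
    also have "\<dots> = \<eta> / 2 * \<theta> ^ 3" using E0 by (simp add: field_simps)
    finally show "\<delta> * E / \<theta> ^ 3 \<le> \<eta> / 2" using \<theta> by (simp add: pos_divide_le_eq)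
  qed
  have bound: "(\<integral>\<^sup>+p. ennreal (exp (cross_exponent X Y s t p)) \<partial>(M \<Otimes>\<^sub>M M))
      \<le> ennreal (exp ((s\<^sup>2 + 2 * r\<^sup>2 * (s * t) + t\<^sup>2 + \<eta> * (s\<^sup>2 + t\<^sup>2)) / 2))"
    if st: "\<bar>s\<bar> \<le> \<delta>" "\<bar>t\<bar> \<le> \<delta>" for s t
  proof -
    define m where "m = max \<bar>s\<bar> \<bar>t\<bar>"
    have m: "0 \<le> m" "m \<le> \<delta>" "m \<le> \<theta>" "m\<^sup>2 \<le> s\<^sup>2 + t\<^sup>2"
      using st \<delta> by (auto simp: m_def max_def)
    define W where "W = cross_exponent X Y s t"
    define a where "a p = 1 + W p + (W p)\<^sup>2 / 2 + (m / \<theta>) ^ 3 * (g (fst p) * g (snd p))" for p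
    have W: "all_moments (M \<Otimes>\<^sub>M M) W"
      unfolding W_def cross_exponent_def
      by (intro all_moments_add all_moments_cmult all_moments_mult all_moments_fst all_moments_snd XA YA M)
    note [measurable] = all_moments_measurable[OF W]
    have a: "exp (W p) \<le> a p" for p
    proof -
      \<comment> \<open>|W| is at most m R. One factor exp (\<theta> R) absorbs the cube of \<theta>
        R and another one bounds exp |W|; their product is exactly
        \<open>g (fst p) * g (snd p)\<close>.\<close>
      define R where "R = ((X (fst p))\<^sup>2 + (Y (fst p))\<^sup>2 + (X (snd p))\<^sup>2 + (Y (snd p))\<^sup>2) / 2"
      have R0: "R \<ge> 0" by (simp add: R_def)
      have prod: "\<bar>x * y\<bar> \<le> (x\<^sup>2 + y\<^sup>2) / 2" for x y :: real
        using sum_squares_bound[of "\<bar>x\<bar>" "\<bar>y\<bar>"] by (simp add: abs_mult)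
      have "\<bar>W p\<bar> \<le> \<bar>s\<bar> * \<bar>X (fst p) * X (snd p)\<bar> + \<bar>t\<bar> * \<bar>Y (fst p) * Y (snd p)\<bar>"
        unfolding W_def cross_exponent_def by (rule order_trans[OF abs_triangle_ineq]) (simp add: abs_mult)
      also have "\<dots> \<le> m * (((X (fst p))\<^sup>2 + (X (snd p))\<^sup>2) / 2) + m * (((Y (fst p))\<^sup>2 + (Y (snd p))\<^sup>2) / 2)"
        using m by (intro add_mono mult_mono prod) (auto simp: m_def)
      also have "\<dots> = m * R" by (simp add: R_def algebra_simps add_divide_distrib)
      finally have WR: "\<bar>W p\<bar> \<le> m * R" .
      have "\<bar>W p\<bar> ^ 3 / 6 * exp \<bar>W p\<bar> \<le> (m * R) ^ 3 / 6 * exp (\<theta> * R)"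
      proof (intro mult_mono divide_right_mono power_mono WR)
        have "\<bar>W p\<bar> \<le> \<theta> * R" using WR m R0 by (meson order_trans mult_right_mono)
        then show "exp \<bar>W p\<bar> \<le> exp (\<theta> * R)" by simp
      qed (use m R0 in auto)
      also have "\<dots> = (m / \<theta>) ^ 3 * ((\<theta> * R) ^ 3 / 6) * exp (\<theta> * R)"
        using \<theta> by (simp add: power_mult_distrib power_divide)
      also have "\<dots> \<le> (m / \<theta>) ^ 3 * exp (\<theta> * R) * exp (\<theta> * R)"
        using power_le_fact_mult_exp[of "\<theta> * R" 3] \<theta> R0 m
        by (intro mult_right_mono mult_left_mono) (auto simp: fact_numeral)
      also have "\<dots> = (m / \<theta>) ^ 3 * (g (fst p) * g (snd p))"
      proof -
        have "exp (\<theta> * R) * exp (\<theta> * R) = g (fst p) * g (snd p)"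
          by (simp add: g_def exp_add[symmetric] R_def algebra_simps add_divide_distrib)
        then show ?thesis by (simp add: mult.assoc)
      qed
      finally show ?thesis using exp_le_cubic_remainder[of "W p"] by (simp add: a_def)
    qed
    have W_int: "integrable (M \<Otimes>\<^sub>M M) W" "integrable (M \<Otimes>\<^sub>M M) (\<lambda>p. (W p)\<^sup>2)"
      by (auto intro!: all_moments_integrable W all_moments_power MM.finite_measure_axioms)
    have a_int: "integrable (M \<Otimes>\<^sub>M M) a"
      unfolding a_def using W_int E_int by auto
    have pair: "(\<integral>p. f (fst p) * h (snd p) \<partial>(M \<Otimes>\<^sub>M M)) = (\<integral>\<omega>. f \<omega> \<partial>M) * (\<integral>\<omega>. h \<omega> \<partial>M)"
      "integrable (M \<Otimes>\<^sub>M M) (\<lambda>p. f (fst p) * h (snd p))"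
      if "all_moments M f" "all_moments M h" for f h
      using integral_pair_mult[OF M M that[THEN all_moments_integrable]]
        integrable_pair_mult[OF M M that[THEN all_moments_integrable]] by simp_all
    have XX: "all_moments M (\<lambda>\<omega>. (X \<omega>)\<^sup>2)" and YY: "all_moments M (\<lambda>\<omega>. (Y \<omega>)\<^sup>2)"
      and XY': "all_moments M (\<lambda>\<omega>. X \<omega> * Y \<omega>)"
      by (auto intro!: all_moments_power all_moments_mult XA YA M.finite_measure_axioms)
    have EW: "(\<integral>p. W p \<partial>(M \<Otimes>\<^sub>M M)) = 0"
      unfolding W_def cross_exponent_def by (simp add: pair XA YA X1 Y1)
    have W2: "(W p)\<^sup>2 = s\<^sup>2 * ((X (fst p))\<^sup>2 * (X (snd p))\<^sup>2) + (2 * (s * t)) * ((X (fst p) * Y (fst p)) * (X (snd p) * Y (snd p)))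
          + t\<^sup>2 * ((Y (fst p))\<^sup>2 * (Y (snd p))\<^sup>2)" for p
      unfolding W_def cross_exponent_def by (simp add: power2_eq_square algebra_simps)
    have EW2: "(\<integral>p. (W p)\<^sup>2 \<partial>(M \<Otimes>\<^sub>M M)) = s\<^sup>2 + 2 * r\<^sup>2 * (s * t) + t\<^sup>2"
      unfolding W2
      by (simp add: pair[OF XX XX] pair[OF YY YY] pair[OF XY' XY'] X2 Y2 XY power2_eq_square[of r])
    have "(\<integral>p. a p \<partial>(M \<Otimes>\<^sub>M M)) = 1 + (s\<^sup>2 + 2 * r\<^sup>2 * (s * t) + t\<^sup>2) / 2 + (m / \<theta>) ^ 3 * E"
      unfolding a_def using W_int E_int MM.prob_space by (simp add: EW EW2 E_def)
    also have "(m / \<theta>) ^ 3 * E \<le> \<eta> * (s\<^sup>2 + t\<^sup>2) / 2"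
    proof -
      have "(m / \<theta>) ^ 3 * E = m\<^sup>2 * (m * E / \<theta> ^ 3)" by (simp add: power_divide eval_nat_numeral)
      also have "\<dots> \<le> (s\<^sup>2 + t\<^sup>2) * (\<eta> / 2)"
      proof (intro mult_mono m)
        have "m * E / \<theta> ^ 3 \<le> \<delta> * E / \<theta> ^ 3"
          using m \<theta> E0 by (intro divide_right_mono mult_right_mono) auto
        then show "m * E / \<theta> ^ 3 \<le> \<eta> / 2" using \<delta> by linarith
      qed (use m \<theta> E0 in auto)
      finally show ?thesis by (simp add: mult.commute)
    qed
    finally have "(\<integral>p. a p \<partial>(M \<Otimes>\<^sub>M M)) \<le> 1 + (s\<^sup>2 + 2 * r\<^sup>2 * (s * t) + t\<^sup>2 + \<eta> * (s\<^sup>2 + t\<^sup>2)) / 2"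
      by (simp add: add_divide_distrib)
    also have "\<dots> \<le> exp ((s\<^sup>2 + 2 * r\<^sup>2 * (s * t) + t\<^sup>2 + \<eta> * (s\<^sup>2 + t\<^sup>2)) / 2)"
      by (rule exp_ge_add_one_self)
    finally have ea: "(\<integral>p. a p \<partial>(M \<Otimes>\<^sub>M M)) \<le> exp ((s\<^sup>2 + 2 * r\<^sup>2 * (s * t) + t\<^sup>2 + \<eta> * (s\<^sup>2 + t\<^sup>2)) / 2)" .
    have "(\<integral>\<^sup>+p. ennreal (exp (W p)) \<partial>(M \<Otimes>\<^sub>M M)) \<le> (\<integral>\<^sup>+p. ennreal (a p) \<partial>(M \<Otimes>\<^sub>M M))"
      by (intro nn_integral_mono ennreal_leI a)
    also have "\<dots> = ennreal (\<integral>p. a p \<partial>(M \<Otimes>\<^sub>M M))"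
      by (intro nn_integral_eq_integral a_int AE_I2 order_trans[OF _ a]) simp
    also have "\<dots> \<le> ennreal (exp ((s\<^sup>2 + 2 * r\<^sup>2 * (s * t) + t\<^sup>2 + \<eta> * (s\<^sup>2 + t\<^sup>2)) / 2))"
      by (rule ennreal_leI[OF ea])
    finally show ?thesis by (simp add: W_def)
  qed
  with \<delta>(1) show ?thesis by blast
qed

text \<open>The coordinates of the two replicas form independent pairs, so the integral factorises;
  Tonelli makes integrability irrelevant.\<close>

lemma nn_integral_replica_prod:
  fixes w :: "'a \<times> 'a \<Rightarrow> ennreal"
  assumes M: "prob_space M" and I: "finite I" and w[measurable]: "w \<in> borel_measurable (M \<Otimes>\<^sub>M M)"
  shows "(\<integral>\<^sup>+p. (\<Prod>i\<in>I. w (fst p i, snd p i)) \<partial>(PiM I (\<lambda>_. M) \<Otimes>\<^sub>M PiM I (\<lambda>_. M)))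
    = (\<integral>\<^sup>+p. w p \<partial>(M \<Otimes>\<^sub>M M)) ^ card I"
proof -
  interpret M: prob_space M by fact
  have P: "product_sigma_finite (\<lambda>_. M)"
    by (simp add: product_sigma_finite_def M.sigma_finite_measure_axioms)
  interpret PI: prob_space "PiM I (\<lambda>_. M)" by (rule prob_space_PiM) (rule M)
  have "(\<integral>\<^sup>+p. (\<Prod>i\<in>I. w (fst p i, snd p i)) \<partial>(PiM I (\<lambda>_. M) \<Otimes>\<^sub>M PiM I (\<lambda>_. M)))
      = (\<integral>\<^sup>+x. \<integral>\<^sup>+y. (\<Prod>i\<in>I. w (x i, y i)) \<partial>PiM I (\<lambda>_. M) \<partial>PiM I (\<lambda>_. M))"
    by (subst PI.nn_integral_fst[symmetric]) simp_all
  also have "\<dots> = (\<integral>\<^sup>+x. (\<Prod>i\<in>I. \<integral>\<^sup>+b. w (x i, b) \<partial>M) \<partial>PiM I (\<lambda>_. M))"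
  proof (rule nn_integral_cong)
    fix x assume "x \<in> space (PiM I (\<lambda>_. M))"
    then have "x i \<in> space M" if "i \<in> I" for i using that by (auto simp: space_PiM)
    then show "(\<integral>\<^sup>+y. (\<Prod>i\<in>I. w (x i, y i)) \<partial>PiM I (\<lambda>_. M)) = (\<Prod>i\<in>I. \<integral>\<^sup>+b. w (x i, b) \<partial>M)"
      by (intro product_sigma_finite.product_nn_integral_prod[OF P I]) simp
  qed
  also have "\<dots> = (\<Prod>i\<in>I. \<integral>\<^sup>+x. \<integral>\<^sup>+b. w (x, b) \<partial>M \<partial>M)"
    by (intro product_sigma_finite.product_nn_integral_prod[OF P I]) simp
  also have "\<dots> = (\<integral>\<^sup>+p. w p \<partial>(M \<Otimes>\<^sub>M M)) ^ card I"
    by (simp add: M.nn_integral_fst)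
  finally show ?thesis .
qed

text \<open>The feature \<open>X\<close> selects the component to be compared: \<open>fst\<close>
  and \<open>snd\<close> for the two spikes, the identity for the Gaussian vectors.\<close>

definition overlap :: "nat \<Rightarrow> ('a \<Rightarrow> real) \<Rightarrow> (nat \<Rightarrow> 'a) \<times> (nat \<Rightarrow> 'a) \<Rightarrow> real" where
  "overlap n X p = (\<Sum>i<n. X (fst p i) * X (snd p i))"

lemma all_moments_overlap:
  assumes "prob_space M" "all_moments M X"
  shows "all_moments (PiM {..<n} (\<lambda>_. M) \<Otimes>\<^sub>M PiM {..<n} (\<lambda>_. M)) (overlap n X)"
proof -
  have P: "prob_space (PiM {..<n} (\<lambda>_. M))" by (rule prob_space_PiM) (rule assms)
  have "finite_measure (PiM {..<n} (\<lambda>_. M) \<Otimes>\<^sub>M PiM {..<n} (\<lambda>_. M))"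
    by (intro prob_space.finite_measure prob_space_pair P)
  then show ?thesis
    unfolding overlap_def using assms
    by (intro all_moments_sum all_moments_mult all_moments_fst[of _ _ "\<lambda>x. X (x _)"]
          all_moments_snd[of _ _ "\<lambda>x. X (x _)"] P all_moments_component) auto
qed

text \<open>Powers are bounded by |z|^j \<le> j! (exp z + exp (- z)); the four sign patterns give
  the factor 4. For nonnegative tilts the quadratic form is largest when the signs agree, so one
  bound serves all four. Since the exponential moment factorises over coordinates, the \<delta> of a
  single coordinate works for every \<open>n\<close>, \<open>j\<close> and \<open>k\<close>.\<close>

lemma overlap_moment_bound:
  assumes M: "prob_space M" and X: "subgaussian M c X" and Y: "subgaussian M c Y"
    and X1: "(\<integral>\<omega>. X \<omega> \<partial>M) = 0" and Y1: "(\<integral>\<omega>. Y \<omega> \<partial>M) = 0"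
    and X2: "(\<integral>\<omega>. (X \<omega>)\<^sup>2 \<partial>M) = 1" and Y2: "(\<integral>\<omega>. (Y \<omega>)\<^sup>2 \<partial>M) = 1"
    and XY: "(\<integral>\<omega>. X \<omega> * Y \<omega> \<partial>M) = r" and \<eta>: "\<eta> > 0"
  shows "\<exists>\<delta>>0. \<forall>n j k s t. 0 \<le> s \<longrightarrow> s \<le> \<delta> \<longrightarrow> 0 \<le> t \<longrightarrow> t \<le> \<delta> \<longrightarrow>
    s ^ j * t ^ k * (\<integral>p. \<bar>overlap n X p\<bar> ^ j * \<bar>overlap n Y p\<bar> ^ k \<partial>(PiM {..<n} (\<lambda>_. M) \<Otimes>\<^sub>M PiM {..<n} (\<lambda>_. M)))
      \<le> 4 * fact j * fact k * exp (real n * ((s\<^sup>2 + 2 * r\<^sup>2 * (s * t) + t\<^sup>2 + \<eta> * (s\<^sup>2 + t\<^sup>2)) / 2))"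
proof -
  define q where "q s t = (s\<^sup>2 + 2 * r\<^sup>2 * (s * t) + t\<^sup>2 + \<eta> * (s\<^sup>2 + t\<^sup>2)) / 2" for s t :: real
  obtain \<delta> where \<delta>: "\<delta> > 0" and mgf: "\<And>s t. \<bar>s\<bar> \<le> \<delta> \<Longrightarrow> \<bar>t\<bar> \<le> \<delta> \<Longrightarrow>
      (\<integral>\<^sup>+p. ennreal (exp (cross_exponent X Y s t p)) \<partial>(M \<Otimes>\<^sub>M M)) \<le> ennreal (exp (q s t))"
    using subgaussian_cross_mgf[OF assms] unfolding q_def by blast
  note XA = subgaussian_all_moments[OF X] and YA = subgaussian_all_moments[OF Y]
  have [measurable]: "X \<in> borel_measurable M" "Y \<in> borel_measurable M"
    using X Y by (auto simp: subgaussian_def)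
  have main: "s ^ j * t ^ k * (\<integral>p. \<bar>overlap n X p\<bar> ^ j * \<bar>overlap n Y p\<bar> ^ k \<partial>(PiM {..<n} (\<lambda>_. M) \<Otimes>\<^sub>M PiM {..<n} (\<lambda>_. M)))
      \<le> 4 * fact j * fact k * exp (real n * q s t)"
    if s: "0 \<le> s" "s \<le> \<delta>" and t: "0 \<le> t" "t \<le> \<delta>" for n j k s t
  proof -
    let ?P = "PiM {..<n} (\<lambda>_. M) \<Otimes>\<^sub>M PiM {..<n} (\<lambda>_. M)"
    let ?p = "overlap n X" and ?q = "overlap n Y"
    note [measurable] = all_moments_measurable[OF all_moments_overlap[OF M XA, of n]]
      all_moments_measurable[OF all_moments_overlap[OF M YA, of n]]
    have mgf_n: "(\<integral>\<^sup>+p. ennreal (exp (a * ?p p + b * ?q p)) \<partial>?P) \<le> ennreal (exp (real n * q s t))"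
      if ab: "\<bar>a\<bar> = s" "\<bar>b\<bar> = t" for a b
    proof -
      have "(\<integral>\<^sup>+p. ennreal (exp (a * ?p p + b * ?q p)) \<partial>?P)
          = (\<integral>\<^sup>+p. (\<Prod>i<n. ennreal (exp (cross_exponent X Y a b (fst p i, snd p i)))) \<partial>?P)"
        by (simp add: prod_ennreal exp_sum[symmetric] overlap_def cross_exponent_def sum.distrib sum_distrib_left)
      also have "\<dots> = (\<integral>\<^sup>+p. ennreal (exp (cross_exponent X Y a b p)) \<partial>(M \<Otimes>\<^sub>M M)) ^ n"
        by (subst nn_integral_replica_prod[OF M, where w = "\<lambda>p. ennreal (exp (cross_exponent X Y a b p))"])
           (simp_all add: cross_exponent_def)
      also have "\<dots> \<le> ennreal (exp (q a b)) ^ n"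
        using s t ab by (intro power_mono mgf) auto
      also have "\<dots> = ennreal (exp (real n * q a b))"
        by (simp add: ennreal_power exp_of_nat_mult)
      also have "\<dots> \<le> ennreal (exp (real n * q s t))"
      proof -
        have "a * b \<le> s * t" using ab by (metis abs_ge_self abs_mult)
        then have "r\<^sup>2 * (a * b) \<le> r\<^sup>2 * (s * t)" by (intro mult_left_mono) auto
        moreover have "a\<^sup>2 = s\<^sup>2" "b\<^sup>2 = t\<^sup>2" using ab by auto
        ultimately have "q a b \<le> q s t" by (simp add: q_def)
        then show ?thesis by (intro ennreal_leI) (simp add: mult_left_mono)
      qed
      finally show ?thesis .
    qed
    have pt: "s ^ j * t ^ k * (\<bar>x\<bar> ^ j * \<bar>y\<bar> ^ k)
        \<le> fact j * fact k * (exp (s * x + t * y) + exp (s * x + (- t) * y) + exp ((- s) * x + t * y) + exp ((- s) * x + (- t) * y))"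
      for x y
    proof -
      have "s ^ j * t ^ k * (\<bar>x\<bar> ^ j * \<bar>y\<bar> ^ k) = \<bar>s * x\<bar> ^ j * \<bar>t * y\<bar> ^ k"
        using s t by (simp add: abs_mult power_mult_distrib)
      also have "\<dots> \<le> (fact j * exp \<bar>s * x\<bar>) * (fact k * exp \<bar>t * y\<bar>)"
        by (intro mult_mono power_le_fact_mult_exp) auto
      also have "\<dots> \<le> (fact j * (exp (s * x) + exp (- (s * x)))) * (fact k * (exp (t * y) + exp (- (t * y))))"
        by (intro mult_mono mult_left_mono exp_abs_le) auto
      also have "\<dots> = fact j * fact k * (exp (s * x + t * y) + exp (s * x + (- t) * y) + exp ((- s) * x + t * y) + exp ((- s) * x + (- t) * y))"
        by (simp add: exp_add[symmetric] algebra_simps flip: exp_add)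
      finally show ?thesis .
    qed
    let ?e = "\<lambda>a b p. ennreal (exp (a * ?p p + b * ?q p))"
    have "(\<integral>\<^sup>+p. ennreal (s ^ j * t ^ k * (\<bar>?p p\<bar> ^ j * \<bar>?q p\<bar> ^ k)) \<partial>?P)
        \<le> (\<integral>\<^sup>+p. ennreal (fact j * fact k) * (?e s t p + ?e s (- t) p + ?e (- s) t p + ?e (- s) (- t) p) \<partial>?P)"
      by (intro nn_integral_mono) (use pt in \<open>simp add: ennreal_mult'[symmetric] ennreal_plus[symmetric] del: ennreal_plus\<close>)
    also have "\<dots> = ennreal (fact j * fact k) * ((\<integral>\<^sup>+p. ?e s t p \<partial>?P) + (\<integral>\<^sup>+p. ?e s (- t) p \<partial>?P)
        + (\<integral>\<^sup>+p. ?e (- s) t p \<partial>?P) + (\<integral>\<^sup>+p. ?e (- s) (- t) p \<partial>?P))"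
      by (subst nn_integral_cmult, simp, (subst nn_integral_add; simp?)+)
    also have "\<dots> \<le> ennreal (fact j * fact k) * (ennreal (exp (real n * q s t)) + ennreal (exp (real n * q s t))
        + ennreal (exp (real n * q s t)) + ennreal (exp (real n * q s t)))"
      using s t by (intro mult_left_mono add_mono mgf_n) auto
    also have "\<dots> = ennreal (4 * fact j * fact k * exp (real n * q s t))"
      by (simp add: ennreal_mult'[symmetric] ennreal_plus[symmetric] algebra_simps del: ennreal_plus)
    finally have nn: "(\<integral>\<^sup>+p. ennreal (s ^ j * t ^ k * (\<bar>?p p\<bar> ^ j * \<bar>?q p\<bar> ^ k)) \<partial>?P)
        \<le> ennreal (4 * fact j * fact k * exp (real n * q s t))" .
    have "s ^ j * t ^ k * (\<integral>p. \<bar>?p p\<bar> ^ j * \<bar>?q p\<bar> ^ k \<partial>?P)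
        = (\<integral>p. s ^ j * t ^ k * (\<bar>?p p\<bar> ^ j * \<bar>?q p\<bar> ^ k) \<partial>?P)" by simp
    also have "\<dots> = enn2real (\<integral>\<^sup>+p. ennreal (s ^ j * t ^ k * (\<bar>?p p\<bar> ^ j * \<bar>?q p\<bar> ^ k)) \<partial>?P)"
      using s t by (intro integral_eq_nn_integral) auto
    also have "\<dots> \<le> 4 * fact j * fact k * exp (real n * q s t)"
      using nn by (intro enn2real_leI) auto
    finally show ?thesis .
  qed
  show ?thesis
    using \<delta> main unfolding q_def by blast
qed

section \<open>Integrals over two replicas\<close>

text \<open>Inner integrability is required at every point, not only almost everywhere, so that
  iterated integrals split over sums and products by plain congruence.\<close>

definition replica_integrable :: "'a measure \<Rightarrow> ('a \<Rightarrow> 'a \<Rightarrow> real) \<Rightarrow> bool" where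
  "replica_integrable M f \<longleftrightarrow> (\<forall>a\<in>space M. integrable M (f a)) \<and> integrable M (\<lambda>a. \<integral>a'. f a a' \<partial>M)"

text \<open>Independent blocks of the signal contribute separate factors; applied twice, this
  separates the prior from \<open>u\<close> and from \<open>v\<close>.\<close>

lemma
  assumes A: "prob_space A" and B: "prob_space B"
    and f: "replica_integrable A f" and g: "replica_integrable B g"
  shows replica_integrable_pair_mult:
      "replica_integrable (A \<Otimes>\<^sub>M B) (\<lambda>\<omega> \<omega>'. f (fst \<omega>) (fst \<omega>') * g (snd \<omega>) (snd \<omega>'))"
    and replica_integral_pair_mult:
      "(\<integral>\<omega>. \<integral>\<omega>'. f (fst \<omega>) (fst \<omega>') * g (snd \<omega>) (snd \<omega>') \<partial>(A \<Otimes>\<^sub>M B) \<partial>(A \<Otimes>\<^sub>M B))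
        = (\<integral>a. \<integral>a'. f a a' \<partial>A \<partial>A) * (\<integral>b. \<integral>b'. g b b' \<partial>B \<partial>B)"
proof -
  let ?F = "\<lambda>a. \<integral>a'. f a a' \<partial>A" and ?G = "\<lambda>b. \<integral>b'. g b b' \<partial>B"
  have inner: "(\<integral>\<omega>'. f (fst \<omega>) (fst \<omega>') * g (snd \<omega>) (snd \<omega>') \<partial>(A \<Otimes>\<^sub>M B)) = ?F (fst \<omega>) * ?G (snd \<omega>)"
    and int: "integrable (A \<Otimes>\<^sub>M B) (\<lambda>\<omega>'. f (fst \<omega>) (fst \<omega>') * g (snd \<omega>) (snd \<omega>'))"
    if "\<omega> \<in> space (A \<Otimes>\<^sub>M B)" for \<omega>
  proof -
    have i: "integrable A (f (fst \<omega>))" "integrable B (g (snd \<omega>))"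
      using that f g by (auto simp: replica_integrable_def space_pair_measure)
    show "(\<integral>\<omega>'. f (fst \<omega>) (fst \<omega>') * g (snd \<omega>) (snd \<omega>') \<partial>(A \<Otimes>\<^sub>M B)) = ?F (fst \<omega>) * ?G (snd \<omega>)"
      by (rule integral_pair_mult[OF A B i])
    show "integrable (A \<Otimes>\<^sub>M B) (\<lambda>\<omega>'. f (fst \<omega>) (fst \<omega>') * g (snd \<omega>) (snd \<omega>'))"
      by (rule integrable_pair_mult[OF A B i])
  qed
  have o: "integrable A ?F" "integrable B ?G" using f g by (auto simp: replica_integrable_def)
  show "replica_integrable (A \<Otimes>\<^sub>M B) (\<lambda>\<omega> \<omega>'. f (fst \<omega>) (fst \<omega>') * g (snd \<omega>) (snd \<omega>'))"
    unfolding replica_integrable_def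
    using integrable_pair_mult[OF A B o] inner int by (simp cong: Bochner_Integration.integrable_cong)
  show "(\<integral>\<omega>. \<integral>\<omega>'. f (fst \<omega>) (fst \<omega>') * g (snd \<omega>) (snd \<omega>') \<partial>(A \<Otimes>\<^sub>M B) \<partial>(A \<Otimes>\<^sub>M B))
        = (\<integral>a. \<integral>a'. f a a' \<partial>A \<partial>A) * (\<integral>b. \<integral>b'. g b b' \<partial>B \<partial>B)"
    using integral_pair_mult[OF A B o] inner by (simp cong: Bochner_Integration.integral_cong)
qed

lemma replica_integral_sum:
  assumes "\<And>i. i \<in> I \<Longrightarrow> replica_integrable M (f i)"
  shows "(\<integral>\<omega>. \<integral>\<omega>'. (\<Sum>i\<in>I. c i * f i \<omega> \<omega>') \<partial>M \<partial>M) = (\<Sum>i\<in>I. c i * (\<integral>\<omega>. \<integral>\<omega>'. f i \<omega> \<omega>' \<partial>M \<partial>M))"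
proof -
  have "(\<integral>\<omega>. \<integral>\<omega>'. (\<Sum>i\<in>I. c i * f i \<omega> \<omega>') \<partial>M \<partial>M) = (\<integral>\<omega>. (\<Sum>i\<in>I. c i * (\<integral>\<omega>'. f i \<omega> \<omega>' \<partial>M)) \<partial>M)"
    using assms by (intro Bochner_Integration.integral_cong refl) (simp add: replica_integrable_def)
  also have "\<dots> = (\<Sum>i\<in>I. c i * (\<integral>\<omega>. \<integral>\<omega>'. f i \<omega> \<omega>' \<partial>M \<partial>M))"
    using assms by (simp add: replica_integrable_def)
  finally show ?thesis .
qed

text \<open>For a fixed first replica the overlap is linear in the features of the coordinates of
  the second one, which gives integrability at every point. Absolute moments are what the
  exponential bounds control, so signs are discarded here.\<close>

lemma
  fixes n j k :: nat
  assumes M: "prob_space M" and X: "all_moments M X" and Y: "all_moments M Y"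
  defines "P \<equiv> PiM {..<n} (\<lambda>_. M)"
  shows replica_integrable_overlap:
      "replica_integrable P (\<lambda>x x'. overlap n X (x, x') ^ j * overlap n Y (x, x') ^ k)"
    and replica_integral_overlap_le:
      "\<bar>\<integral>x. \<integral>x'. overlap n X (x, x') ^ j * overlap n Y (x, x') ^ k \<partial>P \<partial>P\<bar>
        \<le> (\<integral>p. \<bar>overlap n X p\<bar> ^ j * \<bar>overlap n Y p\<bar> ^ k \<partial>(P \<Otimes>\<^sub>M P))"
proof -
  have P: "prob_space P" unfolding P_def by (rule prob_space_PiM) (rule M)
  interpret P: prob_space P by fact
  interpret PP: prob_space "P \<Otimes>\<^sub>M P" by (rule prob_space_pair[OF P P])
  interpret pair_sigma_finite P P ..
  let ?f = "\<lambda>p. overlap n X p ^ j * overlap n Y p ^ k"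
  have f: "all_moments (P \<Otimes>\<^sub>M P) ?f"
    unfolding P_def
    by (intro all_moments_mult all_moments_power all_moments_overlap M X Y
          PP.finite_measure_axioms[unfolded P_def])
  have slice_overlap: "all_moments P (\<lambda>x'. overlap n Z (x, x'))" if "all_moments M Z" for Z x
    unfolding P_def overlap_def using P.finite_measure_axioms that M
    by (auto intro!: all_moments_sum all_moments_cmult all_moments_component simp: P_def)
  have slice: "integrable P (\<lambda>x'. ?f (x, x'))" for x
    by (intro all_moments_integrable all_moments_mult all_moments_power slice_overlap X Y P.finite_measure_axioms)
  then show "replica_integrable P (\<lambda>x x'. overlap n X (x, x') ^ j * overlap n Y (x, x') ^ k)"
    using integrable_fst'[OF all_moments_integrable[OF f]] by (simp add: replica_integrable_def)
  have "(\<integral>x. \<integral>x'. ?f (x, x') \<partial>P \<partial>P) = (\<integral>p. ?f p \<partial>(P \<Otimes>\<^sub>M P))"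
    by (rule integral_fst'[OF all_moments_integrable[OF f]])
  also have "\<bar>\<dots>\<bar> \<le> (\<integral>p. \<bar>?f p\<bar> \<partial>(P \<Otimes>\<^sub>M P))"
    by (rule integral_abs_bound)
  finally show "\<bar>\<integral>x. \<integral>x'. overlap n X (x, x') ^ j * overlap n Y (x, x') ^ k \<partial>P \<partial>P\<bar>
        \<le> (\<integral>p. \<bar>overlap n X p\<bar> ^ j * \<bar>overlap n Y p\<bar> ^ k \<partial>(P \<Otimes>\<^sub>M P))"
    by (simp add: abs_mult power_abs)
qed

text \<open>Stirling's bound up to a linear factor. For positive j it is proved with j in place of j
  + 1, the induction step being (1 + 1/m)^(m+1) \<ge> e. The factor j + 1 covers j = 0, where 0^0 =
  1.\<close>

lemma fact_mult_exp_le: "fact j * exp (real j) \<le> exp 1 * real (Suc j) * real j ^ j"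
proof (cases j)
  case (Suc i)
  have "fact (Suc i) * exp (real (Suc i)) \<le> exp 1 * real (Suc i) * real (Suc i) ^ Suc i"
  proof (induction i)
    case (Suc i)
    let ?m = "real (Suc i)"
    have "?m / (?m + 1) \<le> exp (- (1 / (?m + 1)))"
      using exp_ge_add_one_self[of "- (1 / (?m + 1))"] by (simp add: field_simps)
    then have "(?m / (?m + 1)) ^ Suc (Suc i) \<le> exp (- (1 / (?m + 1))) ^ Suc (Suc i)"
      by (intro power_mono) auto
    also have "\<dots> = exp (- 1)"
      by (subst exp_of_nat_mult[symmetric]) (simp add: field_simps)
    finally have "exp 1 * ?m ^ Suc (Suc i) \<le> (?m + 1) ^ Suc (Suc i)"
      by (simp add: power_divide exp_minus divide_simps mult.commute split: if_splits)
    then have key: "exp 1 * (?m * ?m ^ Suc i) \<le> (?m + 1) ^ Suc (Suc i)" by simp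
    have "fact (Suc (Suc i)) * exp (real (Suc (Suc i))) = (?m + 1) * exp 1 * (fact (Suc i) * exp ?m)"
    proof -
      have "exp (real (Suc (Suc i))) = exp 1 * exp ?m" by (simp flip: exp_add add: add.commute)
      moreover have "fact (Suc (Suc i)) = (?m + 1) * fact (Suc i)"
        by (subst fact_Suc) (simp only: of_nat_Suc add.commute)
      ultimately show ?thesis by (simp only: mult_ac)
    qed
    also have "\<dots> \<le> (?m + 1) * exp 1 * (exp 1 * ?m * ?m ^ Suc i)"
      using Suc by (intro mult_left_mono) auto
    also have "\<dots> = exp 1 * (?m + 1) * (exp 1 * (?m * ?m ^ Suc i))" by (simp add: mult_ac)
    also have "\<dots> \<le> exp 1 * (?m + 1) * (?m + 1) ^ Suc (Suc i)"
      using key by (intro mult_left_mono) auto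
    finally show ?case by (simp add: add.commute)
  qed simp
  also have "\<dots> \<le> exp 1 * real (Suc (Suc i)) * real (Suc i) ^ Suc i"
    by (intro mult_right_mono mult_left_mono) auto
  finally show ?thesis using Suc by simp
qed simp

text \<open>The conditional mean of the observation given \<open>\<omega>\<close>, which holds the
  spike pairs and the two Gaussian vectors. Indexing by the disjoint sum treats both matrices as one
  family of variables, as the polynomials do.\<close>

definition wishart_signal ::
  "nat \<Rightarrow> real \<Rightarrow> real \<Rightarrow> (nat \<Rightarrow> real \<times> real) \<times> (nat \<Rightarrow> real) \<times> (nat \<Rightarrow> real) \<Rightarrow> entry \<Rightarrow> real" where
  "wishart_signal n lam \<mu> \<omega> = case_sum
     (\<lambda>(i, j). sqrt lam / sqrt (real n) * fst (fst \<omega> i) * fst (snd \<omega>) j)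
     (\<lambda>(i, j). sqrt \<mu> / sqrt (real n) * snd (fst \<omega> i) * snd (snd \<omega>) j)"

text \<open>The inner product of the rank-one matrices a b^T and a' b'^T is the product of the inner
  products of a with a' and of b with b'.\<close>

lemma sum_wishart_signal:
  assumes "lam \<ge> 0" "\<mu> \<ge> 0"
  shows "(\<Sum>e\<in>({..<n} \<times> {..<N}) <+> ({..<n} \<times> {..<N}). wishart_signal n lam \<mu> \<omega> e * wishart_signal n lam \<mu> \<omega>' e)
    = lam / real n * (overlap n fst (fst \<omega>, fst \<omega>') * overlap N (\<lambda>z. z) (fst (snd \<omega>), fst (snd \<omega>')))
    + \<mu> / real n * (overlap n snd (fst \<omega>, fst \<omega>') * overlap N (\<lambda>z. z) (snd (snd \<omega>), snd (snd \<omega>')))"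
proof -
  have *: "(\<Sum>(i, j)\<in>{..<n} \<times> {..<N}. (sqrt s / sqrt (real n) * a i * b j) * (sqrt s / sqrt (real n) * a' i * b' j))
      = s / real n * ((\<Sum>i<n. a i * a' i) * (\<Sum>j<N. b j * b' j))"
    if "s \<ge> 0" for s and a a' b b' :: "nat \<Rightarrow> real"
  proof -
    have "(sqrt s / sqrt (real n) * x * y) * (sqrt s / sqrt (real n) * x' * y') = s / real n * ((x * x') * (y * y'))"
      for x x' y y'
    proof -
      have "(sqrt s / sqrt (real n)) * (sqrt s / sqrt (real n)) = s / real n"
        using that by (simp add: real_sqrt_divide[symmetric])
      then show ?thesis by (metis (no_types, lifting) mult.assoc mult.left_commute)
    qed
    then have "(\<Sum>(i, j)\<in>{..<n} \<times> {..<N}. (sqrt s / sqrt (real n) * a i * b j) * (sqrt s / sqrt (real n) * a' i * b' j))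
      = (\<Sum>(i, j)\<in>{..<n} \<times> {..<N}. s / real n * ((a i * a' i) * (b j * b' j)))"
      by (intro sum.cong refl) auto
    also have "\<dots> = s / real n * ((\<Sum>i<n. a i * a' i) * (\<Sum>j<N. b j * b' j))"
    proof -
      have "(\<Sum>i<n. a i * a' i) * (\<Sum>j<N. b j * b' j) = (\<Sum>(i, j)\<in>{..<n} \<times> {..<N}. (a i * a' i) * (b j * b' j))"
        by (simp only: sum_product sum.cartesian_product)
      then show ?thesis by (simp only: sum_distrib_left split_def)
    qed
    finally show ?thesis .
  qed
  show ?thesis
    using *[OF assms(1), of "\<lambda>i. fst (fst \<omega> i)" "fst (snd \<omega>)" "\<lambda>i. fst (fst \<omega>' i)" "fst (snd \<omega>')"]
      *[OF assms(2), of "\<lambda>i. snd (fst \<omega> i)" "snd (snd \<omega>)" "\<lambda>i. snd (fst \<omega>' i)" "snd (snd \<omega>')"]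
    by (simp add: sum.Plus wishart_signal_def overlap_def split_def)
qed

section \<open>The kernel below the threshold\<close>

lemma prob_space_gauss_vector: "prob_space (gauss_vector N)"
  unfolding gauss_vector_def by (rule prob_space_PiM) (rule prob_space_gauss)

text \<open>With a = A \<rho>^2, b = B \<rho>^2 and \<eta> = 0 the two inequalities read a \<kappa>
  < 1 - A and b / (1 - B) < \<kappa>. Such a \<kappa> exists because a b < (1 - A) (1 - B), which is
  what the third entry of the maximum says after clearing its denominators; these are positive as A,
  B < 1. Both inequalities being strict, continuity at 0 leaves room for a small \<eta>.\<close>

lemma spike_threshold_parameters:
  assumes "\<gamma> > 0" "\<epsilon> > 0" and F: "spike_threshold lam \<mu> \<rho> \<gamma> < 1 - \<epsilon>"
  shows "\<exists>\<kappa>>0. \<exists>\<eta>>0. (1 + \<eta> + \<rho>\<^sup>2 * \<kappa>) * exp \<eta> * (lam\<^sup>2 / \<gamma>) < 1 \<and> (1 + \<eta> + \<rho>\<^sup>2 / \<kappa>) * exp \<eta> * (\<mu>\<^sup>2 / \<gamma>) < 1"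
proof -
  define A where "A = lam\<^sup>2 / \<gamma>"
  define B where "B = \<mu>\<^sup>2 / \<gamma>"
  define a where "a = A * \<rho>\<^sup>2"
  define b where "b = B * \<rho>\<^sup>2"
  have lm: "lam\<^sup>2 = A * \<gamma>" "\<mu>\<^sup>2 = B * \<gamma>" using assms by (simp_all add: A_def B_def)
  have nn: "A \<ge> 0" "B \<ge> 0" "a \<ge> 0" "b \<ge> 0" using assms by (auto simp: A_def B_def a_def b_def)
  have thr: "A < 1" "B < 1"
    "lam\<^sup>2 * \<rho>\<^sup>2 / (\<gamma> - lam\<^sup>2 + lam\<^sup>2 * \<rho>\<^sup>2) + \<mu>\<^sup>2 * \<rho>\<^sup>2 / (\<gamma> - \<mu>\<^sup>2 + \<mu>\<^sup>2 * \<rho>\<^sup>2) < 1"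
    using F \<open>\<epsilon> > 0\<close> by (auto simp: spike_threshold_def A_def B_def)
  have "lam\<^sup>2 * \<rho>\<^sup>2 / (\<gamma> - lam\<^sup>2 + lam\<^sup>2 * \<rho>\<^sup>2) = a / (1 - A + a)"
  proof -
    have "lam\<^sup>2 * \<rho>\<^sup>2 / (\<gamma> - lam\<^sup>2 + lam\<^sup>2 * \<rho>\<^sup>2) = (\<gamma> * a) / (\<gamma> * (1 - A + a))"
      by (simp add: lm a_def algebra_simps)
    then show ?thesis using \<open>\<gamma> > 0\<close> by simp
  qed
  moreover have "\<mu>\<^sup>2 * \<rho>\<^sup>2 / (\<gamma> - \<mu>\<^sup>2 + \<mu>\<^sup>2 * \<rho>\<^sup>2) = b / (1 - B + b)"
  proof -
    have "\<mu>\<^sup>2 * \<rho>\<^sup>2 / (\<gamma> - \<mu>\<^sup>2 + \<mu>\<^sup>2 * \<rho>\<^sup>2) = (\<gamma> * b) / (\<gamma> * (1 - B + b))"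
      by (simp add: lm b_def algebra_simps)
    then show ?thesis using \<open>\<gamma> > 0\<close> by simp
  qed
  ultimately have "a / (1 - A + a) + b / (1 - B + b) < 1" using thr by simp
  then have ab: "a * b < (1 - A) * (1 - B)"
  proof -
    have pos: "1 - A + a > 0" "1 - B + b > 0" using thr nn by auto
    assume "a / (1 - A + a) + b / (1 - B + b) < 1"
    then have "a * (1 - B + b) + b * (1 - A + a) < (1 - A + a) * (1 - B + b)"
      using pos by (simp add: add_frac_eq pos_divide_less_eq)
    then show ?thesis by (simp add: algebra_simps)
  qed
  \<comment> \<open>A fraction of the room left above the lower bound b / (1 - B) for \<kappa>. The
    divisor 2 (1 + a) keeps a \<xi> below the gap and stays positive when a = 0.\<close>
  define \<xi> where "\<xi> = (1 - A - a * (b / (1 - B))) / (2 * (1 + a))"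
  define \<kappa> where "\<kappa> = b / (1 - B) + \<xi>"
  have gap: "a * (b / (1 - B)) < 1 - A" using ab thr by (simp add: divide_simps mult.commute)
  then have \<xi>: "\<xi> > 0" using nn by (simp add: \<xi>_def)
  have \<kappa>: "\<kappa> > 0" using \<xi> nn thr by (simp add: \<kappa>_def add_nonneg_pos)
  have "a * \<xi> < 1 - A - a * (b / (1 - B))"
  proof -
    have "a * \<xi> = (1 - A - a * (b / (1 - B))) * (a / (2 * (1 + a)))" by (simp add: \<xi>_def)
    also have "\<dots> < (1 - A - a * (b / (1 - B))) * 1"
      using gap nn by (intro mult_strict_left_mono) auto
    finally show ?thesis by simp
  qed
  then have k1: "(1 + 0 + \<rho>\<^sup>2 * \<kappa>) * exp 0 * A < 1" by (simp add: \<kappa>_def a_def algebra_simps)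
  have "b < \<kappa> * (1 - B)"
    using \<xi> thr by (simp add: \<kappa>_def distrib_right)
  then have "b / \<kappa> < 1 - B" using \<kappa> by (simp add: pos_divide_less_eq mult.commute)
  then have k2: "(1 + 0 + \<rho>\<^sup>2 / \<kappa>) * exp 0 * B < 1" by (simp add: b_def algebra_simps)
  have "((\<lambda>\<eta>. (1 + \<eta> + \<rho>\<^sup>2 * \<kappa>) * exp \<eta> * A) \<longlongrightarrow> (1 + 0 + \<rho>\<^sup>2 * \<kappa>) * exp 0 * A) (at_right 0)"
    by (intro tendsto_intros)
  then have e1: "\<forall>\<^sub>F \<eta> in at_right 0. (1 + \<eta> + \<rho>\<^sup>2 * \<kappa>) * exp \<eta> * A < 1"
    using k1 by (rule order_tendstoD)
  have "((\<lambda>\<eta>. (1 + \<eta> + \<rho>\<^sup>2 / \<kappa>) * exp \<eta> * B) \<longlongrightarrow> (1 + 0 + \<rho>\<^sup>2 / \<kappa>) * exp 0 * B) (at_right 0)"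
    using \<kappa> by (intro tendsto_intros)
  then have e2: "\<forall>\<^sub>F \<eta> in at_right 0. (1 + \<eta> + \<rho>\<^sup>2 / \<kappa>) * exp \<eta> * B < 1"
    using k2 by (rule order_tendstoD)
  have "\<forall>\<^sub>F \<eta> in at_right 0. (1 + \<eta> + \<rho>\<^sup>2 * \<kappa>) * exp \<eta> * A < 1 \<and> (1 + \<eta> + \<rho>\<^sup>2 / \<kappa>) * exp \<eta> * B < 1 \<and> \<eta> > 0"
    using e1 e2 eventually_at_right_less[of 0] by eventually_elim simp
  then obtain \<eta> where "(1 + \<eta> + \<rho>\<^sup>2 * \<kappa>) * exp \<eta> * A < 1" "(1 + \<eta> + \<rho>\<^sup>2 / \<kappa>) * exp \<eta> * B < 1" "\<eta> > 0"
    using eventually_happens[of _ "at_right (0::real)"] by (auto simp: trivial_limit_at_right_real)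
  with \<kappa> show ?thesis unfolding A_def B_def by blast
qed

text \<open>Partial sums of the derivative of the geometric series; the bound is uniform in the
  truncation degree.\<close>

lemma sum_Suc_geometric_le:
  fixes x :: real
  assumes "0 \<le> x" "x < 1"
  shows "(\<Sum>j\<le>D. real (Suc j) * x ^ j) \<le> 1 / (1 - x)\<^sup>2"
proof -
  have "(\<lambda>j. real (Suc j) * x ^ j) sums (1 / (1 - x)\<^sup>2)"
    using geometric_deriv_sums[of x] assms by simp
  moreover have "(\<Sum>j\<le>D. real (Suc j) * x ^ j) \<le> suminf (\<lambda>j. real (Suc j) * x ^ j)"
    using assms calculation by (intro sum_le_suminf) (auto simp: sums_iff)
  ultimately show ?thesis by (simp add: sums_iff)
qed

text \<open>The tilts \<open>sqrt (j / (\<alpha> n))\<close> and \<open>sqrt (j / N)\<close> minimise the exponential bounds for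
  the \<open>j\<close>-th moments of the two overlaps. Compared with the exact Gaussian moments the loss is only
  the linear factor \<open>j + 1\<close>, which a geometric series absorbs.\<close>

lemma tilted_weight_le:
  fixes n N j :: nat and lam \<gamma> \<alpha> \<eta> :: real
  assumes n: "n \<ge> 1" and \<gamma>: "\<gamma> > 0" "\<gamma> = real n / real N" and lam: "lam \<ge> 0" and \<alpha>: "\<alpha> > 0"
  shows "(lam / real n) ^ j * (fact j * exp (real j / 2) / sqrt (real j / (\<alpha> * real n)) ^ j)
      * (4 * exp ((1 + \<eta>) * real j / 2) / sqrt (real j / real N) ^ j)
    \<le> 4 * exp 1 * (real (Suc j) * sqrt (\<alpha> * exp \<eta> * (lam\<^sup>2 / \<gamma>)) ^ j)" (is "?L \<le> 4 * exp 1 * (real (Suc j) * ?x ^ j)")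
proof (cases "j = 0")
  case True
  then show ?thesis by simp
next
  case False
  have N: "N > 0" using \<gamma> by (cases N) auto
  \<comment> \<open>The base common to all j-th powers in \<open>?L\<close>. With these tilts it
    collapses to e ?x / j, and j! (e / j)^j grows only linearly.\<close>
  define y where "y = lam / real n * (exp (1 / 2) / sqrt (real j / (\<alpha> * real n))) * (exp ((1 + \<eta>) / 2) / sqrt (real j / real N))"
  have pw: "exp (real j / 2) = exp (1 / 2) ^ j" "exp ((1 + \<eta>) * real j / 2) = exp ((1 + \<eta>) / 2) ^ j"
    by (simp_all flip: exp_of_nat_mult add: field_simps)
  have "?L = 4 * fact j * y ^ j"
    unfolding pw y_def by (simp add: power_mult_distrib power_divide)
  also have "y = exp 1 * ?x / real j"
  proof -
    have e1: "exp (1 / 2) * exp ((1 + \<eta>) / 2) = exp 1 * sqrt (exp \<eta>)"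
    proof -
      have "sqrt (exp \<eta>) = exp (\<eta> / 2)"
        by (rule real_sqrt_unique) (simp_all add: power2_eq_square flip: exp_add)
      then show ?thesis by (simp add: add_divide_distrib flip: exp_add)
    qed
    have e2: "sqrt (real j / (\<alpha> * real n)) * sqrt (real j / real N) = real j / (sqrt \<alpha> * sqrt (real n) * sqrt (real N))"
      by (simp add: real_sqrt_divide real_sqrt_mult)
    have e3: "lam / real n * (sqrt (real n) * sqrt (real N)) = sqrt (lam\<^sup>2 / \<gamma>)"
    proof -
      have "sqrt (lam\<^sup>2 / \<gamma>) = lam * sqrt (real N) / sqrt (real n)"
        using lam by (simp add: \<gamma> real_sqrt_mult real_sqrt_divide)
      also have "\<dots> = lam * sqrt (real N) * sqrt (real n) / (sqrt (real n) * sqrt (real n))"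
        by (rule nonzero_mult_divide_mult_cancel_right[symmetric]) (use n in simp)
      finally show ?thesis by simp
    qed
    have "y = lam / real n * (exp (1 / 2) * exp ((1 + \<eta>) / 2)) / (sqrt (real j / (\<alpha> * real n)) * sqrt (real j / real N))"
      by (simp add: y_def)
    also have "\<dots> = exp 1 * sqrt (exp \<eta>) * sqrt \<alpha> * (lam / real n * (sqrt (real n) * sqrt (real N))) / real j"
      unfolding e1 e2 by simp
    also have "\<dots> = exp 1 * sqrt (exp \<eta>) * sqrt \<alpha> * sqrt (lam\<^sup>2 / \<gamma>) / real j"
      unfolding e3 ..
    finally have "y = exp 1 * sqrt (exp \<eta>) * sqrt \<alpha> * sqrt (lam\<^sup>2 / \<gamma>) / real j" .
    then show ?thesis by (simp only: real_sqrt_mult mult_ac)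
  qed
  also have "4 * fact j * (exp 1 * ?x / real j) ^ j = 4 * ?x ^ j * (fact j * exp (real j) / real j ^ j)"
    by (simp add: power_mult_distrib power_divide exp_of_nat_mult[symmetric])
  also have "\<dots> \<le> 4 * ?x ^ j * (exp 1 * real (Suc j))"
  proof (intro mult_left_mono)
    show "fact j * exp (real j) / real j ^ j \<le> exp 1 * real (Suc j)"
      using fact_mult_exp_le[of j] False by (simp add: pos_divide_le_eq)
    show "0 \<le> 4 * ?x ^ j" using \<alpha> \<gamma> by simp
  qed
  finally show ?thesis by (simp add: mult_ac)
qed

lemma sqrt_div_le:
  fixes j a d :: real
  assumes "j \<le> d\<^sup>2 * a" "a > 0" "d \<ge> 0"
  shows "sqrt (j / a) \<le> d"
  using assms by (intro real_le_lsqrt) (auto simp: pos_divide_le_eq)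

lemma gauss_first_moments:
  "(\<integral>z. z \<partial>gauss) = 0" "(\<integral>z. z\<^sup>2 \<partial>gauss) = 1" "(\<integral>z. z * z \<partial>gauss) = 1"
proof -
  interpret prob_space gauss by (rule prob_space_gauss)
  show "(\<integral>z. z \<partial>gauss) = 0" using gauss_stein_power[of 0] by simp
  show "(\<integral>z. z\<^sup>2 \<partial>gauss) = 1" and "(\<integral>z. z * z \<partial>gauss) = 1"
    using gauss_stein_power[of 1] prob_space by (simp_all add: power2_eq_square)
qed

text \<open>In the constant, the leading 4 comes from the joint moments of the prior overlaps; in
  each bracket 4 comes from a Gaussian overlap, e from Stirling's bound and the square from the
  series with ratio \<open>x\<close> or \<open>y\<close>. The prior influences only
  \<delta>.\<close>

lemma wishart_kernel_bound:
  assumes lam: "lam \<ge> 0" and \<mu>: "\<mu> \<ge> 0" and \<gamma>: "\<gamma> > 0" and \<kappa>: "\<kappa> > 0" and \<eta>: "\<eta> > 0"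
    and x_def: "x = sqrt ((1 + \<eta> + \<rho>\<^sup>2 * \<kappa>) * exp \<eta> * (lam\<^sup>2 / \<gamma>))" and x1: "x < 1"
    and y_def: "y = sqrt ((1 + \<eta> + \<rho>\<^sup>2 / \<kappa>) * exp \<eta> * (\<mu>\<^sup>2 / \<gamma>))" and y1: "y < 1"
    and \<pi>: "spike_prior \<rho> \<pi>"
  shows "\<exists>\<delta>>0. \<forall>n N D. n \<ge> 1 \<longrightarrow> \<gamma> = real n / real N \<longrightarrow> real D \<le> \<delta> * real n \<longrightarrow>
    (\<integral>\<omega>. \<integral>\<omega>'. (\<Sum>d\<le>D. (\<Sum>e\<in>({..<n} \<times> {..<N}) <+> ({..<n} \<times> {..<N}).
          wishart_signal n lam \<mu> \<omega> e * wishart_signal n lam \<mu> \<omega>' e) ^ d / fact d)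
        \<partial>(PiM {..<n} (\<lambda>_. \<pi>) \<Otimes>\<^sub>M gauss_vector N \<Otimes>\<^sub>M gauss_vector N)
        \<partial>(PiM {..<n} (\<lambda>_. \<pi>) \<Otimes>\<^sub>M gauss_vector N \<Otimes>\<^sub>M gauss_vector N))
      \<le> 4 * (4 * exp 1 / (1 - x)\<^sup>2) * (4 * exp 1 / (1 - y)\<^sup>2)"
proof -
  obtain c where P\<pi>: "prob_space \<pi>" and X: "subgaussian \<pi> c fst" and Y: "subgaussian \<pi> c snd"
    and mom: "(\<integral>p. fst p \<partial>\<pi>) = 0" "(\<integral>p. snd p \<partial>\<pi>) = 0" "(\<integral>p. (fst p)\<^sup>2 \<partial>\<pi>) = 1" "(\<integral>p. (snd p)\<^sup>2 \<partial>\<pi>) = 1"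
      "(\<integral>p. fst p * snd p \<partial>\<pi>) = \<rho>"
    using \<pi> by (auto simp: spike_prior_def)
  note XA = subgaussian_all_moments[OF X] and YA = subgaussian_all_moments[OF Y]
  obtain \<delta>1 where \<delta>1: "\<delta>1 > 0" and mb1: "\<And>n j k s t. 0 \<le> s \<Longrightarrow> s \<le> \<delta>1 \<Longrightarrow> 0 \<le> t \<Longrightarrow> t \<le> \<delta>1 \<Longrightarrow>
    s ^ j * t ^ k * (\<integral>p. \<bar>overlap n fst p\<bar> ^ j * \<bar>overlap n snd p\<bar> ^ k \<partial>(PiM {..<n} (\<lambda>_. \<pi>) \<Otimes>\<^sub>M PiM {..<n} (\<lambda>_. \<pi>)))
      \<le> 4 * fact j * fact k * exp (real n * ((s\<^sup>2 + 2 * \<rho>\<^sup>2 * (s * t) + t\<^sup>2 + \<eta> * (s\<^sup>2 + t\<^sup>2)) / 2))"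
    using overlap_moment_bound[OF P\<pi> X Y mom \<eta>] by blast
  \<comment> \<open>The pair bound with both features equal to the identity. It is used with second
    tilt and second power 0, which leaves a single Gaussian overlap.\<close>
  obtain \<delta>2 where \<delta>2: "\<delta>2 > 0" and mb2: "\<And>n j k s t. 0 \<le> s \<Longrightarrow> s \<le> \<delta>2 \<Longrightarrow> 0 \<le> t \<Longrightarrow> t \<le> \<delta>2 \<Longrightarrow>
    s ^ j * t ^ k * (\<integral>p. \<bar>overlap n (\<lambda>z. z) p\<bar> ^ j * \<bar>overlap n (\<lambda>z. z) p\<bar> ^ k \<partial>(PiM {..<n} (\<lambda>_. gauss) \<Otimes>\<^sub>M PiM {..<n} (\<lambda>_. gauss)))
      \<le> 4 * fact j * fact k * exp (real n * ((s\<^sup>2 + 2 * 1\<^sup>2 * (s * t) + t\<^sup>2 + \<eta> * (s\<^sup>2 + t\<^sup>2)) / 2))"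
    using overlap_moment_bound[OF prob_space_gauss subgaussian_gauss subgaussian_gauss
        gauss_first_moments(1,1,2,2,3) \<eta>] by blast
  define \<alpha> where "\<alpha> = 1 + \<eta> + \<rho>\<^sup>2 * \<kappa>"
  define \<beta> where "\<beta> = 1 + \<eta> + \<rho>\<^sup>2 / \<kappa>"
  have \<alpha>\<beta>: "\<alpha> \<ge> 1" "\<beta> \<ge> 1" using \<eta> \<kappa> by (auto simp: \<alpha>_def \<beta>_def)
  have quad: "s\<^sup>2 + 2 * \<rho>\<^sup>2 * (s * t) + t\<^sup>2 + \<eta> * (s\<^sup>2 + t\<^sup>2) \<le> \<alpha> * s\<^sup>2 + \<beta> * t\<^sup>2" for s t
  proof -
    have "0 \<le> (\<kappa> * s - t)\<^sup>2 / \<kappa>" using \<kappa> by simp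
    also have "\<dots> = \<kappa> * s\<^sup>2 + t\<^sup>2 / \<kappa> - 2 * (s * t)"
      using \<kappa> by (simp add: power2_eq_square field_simps)
    finally have "\<rho>\<^sup>2 * (2 * (s * t)) \<le> \<rho>\<^sup>2 * (\<kappa> * s\<^sup>2 + t\<^sup>2 / \<kappa>)" by (intro mult_left_mono) auto
    then show ?thesis by (simp add: \<alpha>_def \<beta>_def algebra_simps)
  qed
  \<comment> \<open>For j \<le> \<delta> n the tilt of the prior overlap, sqrt (j / (\<alpha> n)),
    is at most \<delta>1 because \<alpha> \<ge> 1, and the Gaussian tilt sqrt (j / N) is at most
    \<delta>2 because n = \<gamma> N.\<close>
  define \<delta> where "\<delta> = min (\<delta>1\<^sup>2) (\<delta>2\<^sup>2 / \<gamma>)"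
  have \<delta>: "\<delta> > 0" using \<delta>1 \<delta>2 \<gamma> by (simp add: \<delta>_def)
  have x0: "x \<ge> 0" and y0: "y \<ge> 0" using \<alpha>\<beta> \<gamma> by (auto simp: x_def y_def \<alpha>_def[symmetric] \<beta>_def[symmetric])
  have main: "(\<integral>\<omega>. \<integral>\<omega>'. (\<Sum>d\<le>D. (\<Sum>e\<in>({..<n} \<times> {..<N}) <+> ({..<n} \<times> {..<N}).
          wishart_signal n lam \<mu> \<omega> e * wishart_signal n lam \<mu> \<omega>' e) ^ d / fact d)
        \<partial>(PiM {..<n} (\<lambda>_. \<pi>) \<Otimes>\<^sub>M gauss_vector N \<Otimes>\<^sub>M gauss_vector N)
        \<partial>(PiM {..<n} (\<lambda>_. \<pi>) \<Otimes>\<^sub>M gauss_vector N \<Otimes>\<^sub>M gauss_vector N))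
      \<le> 4 * (4 * exp 1 / (1 - x)\<^sup>2) * (4 * exp 1 / (1 - y)\<^sup>2)"
    if n: "n \<ge> 1" and N: "\<gamma> = real n / real N" and D: "real D \<le> \<delta> * real n" for n N D
  proof -
    let ?A = "PiM {..<n} (\<lambda>_. \<pi>)" and ?G = "gauss_vector N"
    let ?M = "?A \<Otimes>\<^sub>M ?G \<Otimes>\<^sub>M ?G"
    have N0: "N > 0" using \<gamma> N by (cases N) auto
    have nN: "real n = \<gamma> * real N" using N N0 by simp
    have PA: "prob_space ?A" by (rule prob_space_PiM) (rule P\<pi>)
    define f where "f j k x x' = overlap n fst (x, x') ^ j * overlap n snd (x, x') ^ k"
      for j k and x x' :: "nat \<Rightarrow> real \<times> real"
    define g where "g j u u' = overlap N (\<lambda>z. z) (u, u') ^ j" for j u u'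
    define h where "h j k \<omega> \<omega>' = f j k (fst \<omega>) (fst \<omega>') * (g j (fst (snd \<omega>)) (fst (snd \<omega>')) * g k (snd (snd \<omega>)) (snd (snd \<omega>')))"
      for j k \<omega> \<omega>'
    define b where "b j k = (\<integral>x. \<integral>x'. f j k x x' \<partial>?A \<partial>?A)" for j k
    define m where "m j = (\<integral>u. \<integral>u'. g j u u' \<partial>?G \<partial>?G)" for j
    have f_int: "replica_integrable ?A (f j k)" for j k
      unfolding f_def using replica_integrable_overlap[OF P\<pi> XA YA] by simp
    have g_int: "replica_integrable ?G (g j)" for j
      unfolding g_def gauss_vector_def
      using replica_integrable_overlap[OF prob_space_gauss all_moments_gauss_id all_moments_gauss_id, of N j 0] by simp
    note gg_int = replica_integrable_pair_mult[OF prob_space_gauss_vector prob_space_gauss_vector g_int g_int]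
    note PGG = prob_space_pair[OF prob_space_gauss_vector prob_space_gauss_vector]
    have h_int: "replica_integrable ?M (h j k)" for j k
      unfolding h_def by (rule replica_integrable_pair_mult[OF PA PGG f_int gg_int])
    have h_eq: "(\<integral>\<omega>. \<integral>\<omega>'. h j k \<omega> \<omega>' \<partial>?M \<partial>?M) = b j k * (m j * m k)" for j k
      unfolding h_def replica_integral_pair_mult[OF PA PGG f_int gg_int] b_def m_def
      by (simp add: replica_integral_pair_mult[OF prob_space_gauss_vector prob_space_gauss_vector g_int g_int])
    \<comment> \<open>The coefficient of \<open>h j k\<close> when the truncated exponential of a
      sum of two terms is expanded in bidegree; total degree at most \<open>D\<close> gives the
      triangle \<open>?T\<close>.\<close>
    define coef where "coef j k = (lam / real n) ^ j / fact j * ((\<mu> / real n) ^ k / fact k)" for j k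
    have coef0: "coef j k \<ge> 0" for j k using lam \<mu> by (simp add: coef_def)
    let ?T = "SIGMA j:{..D}. {..D - j}"
    have "(\<integral>\<omega>. \<integral>\<omega>'. (\<Sum>d\<le>D. (\<Sum>e\<in>({..<n} \<times> {..<N}) <+> ({..<n} \<times> {..<N}).
          wishart_signal n lam \<mu> \<omega> e * wishart_signal n lam \<mu> \<omega>' e) ^ d / fact d) \<partial>?M \<partial>?M)
        = (\<integral>\<omega>. \<integral>\<omega>'. (\<Sum>p\<in>?T. coef (fst p) (snd p) * h (fst p) (snd p) \<omega> \<omega>') \<partial>?M \<partial>?M)"
      unfolding sum_wishart_signal[OF lam \<mu>] sum_triangle_power_div_fact[symmetric]
      by (simp add: sum.Sigma split_def sum_distrib_left coef_def h_def f_def g_def power_mult_distrib power_divide mult_ac)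
    also have "\<dots> = (\<Sum>p\<in>?T. coef (fst p) (snd p) * (b (fst p) (snd p) * (m (fst p) * m (snd p))))"
      by (subst replica_integral_sum) (auto simp: h_int h_eq)
    also have "\<dots> \<le> (\<Sum>p\<in>?T. 4 * (4 * exp 1 * (real (Suc (fst p)) * x ^ fst p)) * (4 * exp 1 * (real (Suc (snd p)) * y ^ snd p)))"
    proof (rule sum_mono)
      fix p assume "p \<in> ?T"
      then obtain j k where p: "p = (j, k)" and jk: "j \<le> D" "k \<le> D" by (cases p) auto
      have jD: "real i \<le> \<delta>1\<^sup>2 * real n" "real i \<le> \<delta>2\<^sup>2 * real N" if "i \<le> D" for i
      proof -
        have "real i \<le> \<delta> * real n" using that D by linarith
        moreover have "\<delta> * real n \<le> \<delta>1\<^sup>2 * real n" by (intro mult_right_mono) (auto simp: \<delta>_def)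
        moreover have "\<delta> * real n \<le> \<delta>2\<^sup>2 / \<gamma> * real n" by (intro mult_right_mono) (auto simp: \<delta>_def)
        moreover have "\<delta>2\<^sup>2 / \<gamma> * real n = \<delta>2\<^sup>2 * real N" using nN \<gamma> by simp
        ultimately show "real i \<le> \<delta>1\<^sup>2 * real n" "real i \<le> \<delta>2\<^sup>2 * real N" by linarith+
      qed
      define s where "s = sqrt (real j / (\<alpha> * real n))"
      define t where "t = sqrt (real k / (\<beta> * real n))"
      define \<tau> where "\<tau> i = sqrt (real i / real N)" for i :: nat
      have scale: "real i \<le> \<delta>1\<^sup>2 * (a * real n)" if "a \<ge> 1" "i \<le> D" for a i
      proof -
        have "\<delta>1\<^sup>2 * (1 * real n) \<le> \<delta>1\<^sup>2 * (a * real n)"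
          using that by (intro mult_left_mono mult_right_mono) auto
        then show ?thesis using jD(1)[OF that(2)] by simp
      qed
      have s: "0 \<le> s" "s \<le> \<delta>1" and t: "0 \<le> t" "t \<le> \<delta>1"
        using n \<alpha>\<beta> \<delta>1 scale jk by (auto simp: s_def t_def intro!: sqrt_div_le)
      have \<tau>: "0 \<le> \<tau> i" "\<tau> i \<le> \<delta>2" if "i \<le> D" for i
        using N0 \<delta>2 jD(2)[OF that] by (auto simp: \<tau>_def intro!: sqrt_div_le)
      \<comment> \<open>For exponent 0 the tilt itself is 0, but 0^0 = 1, so division by these
        powers is always legitimate.\<close>
      have pos: "s ^ j > 0" "t ^ k > 0" "\<tau> i ^ i > 0" for i
        using n N0 \<alpha>\<beta> by (cases "j = 0"; cases "k = 0"; cases "i = 0"; simp add: s_def t_def \<tau>_def)+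
      have "s ^ j * t ^ k * \<bar>b j k\<bar> \<le> 4 * fact j * fact k * (exp (real j / 2) * exp (real k / 2))"
      proof -
        have "s ^ j * t ^ k * \<bar>b j k\<bar> \<le> s ^ j * t ^ k * (\<integral>p. \<bar>overlap n fst p\<bar> ^ j * \<bar>overlap n snd p\<bar> ^ k \<partial>(?A \<Otimes>\<^sub>M ?A))"
          using s t unfolding b_def f_def
          by (intro mult_left_mono replica_integral_overlap_le[OF P\<pi> XA YA]) auto
        also have "\<dots> \<le> 4 * fact j * fact k * exp (real n * ((s\<^sup>2 + 2 * \<rho>\<^sup>2 * (s * t) + t\<^sup>2 + \<eta> * (s\<^sup>2 + t\<^sup>2)) / 2))"
          by (rule mb1[OF s t])
        also have "\<dots> \<le> 4 * fact j * fact k * exp (real n * ((\<alpha> * s\<^sup>2 + \<beta> * t\<^sup>2) / 2))"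
          using quad[of s t] by (intro mult_left_mono) (auto intro!: mult_left_mono)
        also have "real n * ((\<alpha> * s\<^sup>2 + \<beta> * t\<^sup>2) / 2) = real j / 2 + real k / 2"
          using n \<alpha>\<beta> by (simp add: s_def t_def field_simps)
        finally show ?thesis by (simp only: exp_add)
      qed
      then have b_le: "\<bar>b j k\<bar> \<le> 4 * (fact j * exp (real j / 2) / s ^ j) * (fact k * exp (real k / 2) / t ^ k)"
        using pos by (simp add: field_simps)
      have m_le: "\<bar>m i\<bar> \<le> 4 * (fact i * exp ((1 + \<eta>) * real i / 2) / \<tau> i ^ i)" if "i \<le> D" for i
      proof -
        have "\<tau> i ^ i * \<bar>m i\<bar> \<le> \<tau> i ^ i * (\<integral>p. \<bar>overlap N (\<lambda>z. z) p\<bar> ^ i * \<bar>overlap N (\<lambda>z. z) p\<bar> ^ 0 \<partial>(?G \<Otimes>\<^sub>M ?G))"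
          unfolding m_def g_def gauss_vector_def
          using replica_integral_overlap_le[OF prob_space_gauss all_moments_gauss_id all_moments_gauss_id, of N i 0] \<tau>(1)[OF that]
          by (intro mult_left_mono) auto
        also have "\<dots> \<le> 4 * fact i * exp (real N * (((\<tau> i)\<^sup>2 + \<eta> * (\<tau> i)\<^sup>2) / 2))"
          using mb2[OF \<tau>[OF that], of 0 i 0 N] \<delta>2 by (simp add: gauss_vector_def)
        also have "real N * (((\<tau> i)\<^sup>2 + \<eta> * (\<tau> i)\<^sup>2) / 2) = (1 + \<eta>) * real i / 2"
          using N0 by (simp add: \<tau>_def field_simps)
        finally show ?thesis using pos(3)[of i] by (simp add: field_simps)
      qed
      let ?w = "\<lambda>r i u v. (r / real n) ^ i * (fact i * exp (real i / 2) / u ^ i) * (4 * exp ((1 + \<eta>) * real i / 2) / v ^ i)"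
      have "coef j k * (b j k * (m j * m k)) \<le> coef j k * \<bar>b j k * (m j * m k)\<bar>"
        by (intro mult_left_mono coef0 abs_ge_self)
      also have "\<dots> = coef j k * (\<bar>b j k\<bar> * (\<bar>m j\<bar> * \<bar>m k\<bar>))"
        by (simp add: abs_mult)
      also have "\<dots> \<le> coef j k * ((4 * (fact j * exp (real j / 2) / s ^ j) * (fact k * exp (real k / 2) / t ^ k))
          * ((4 * (fact j * exp ((1 + \<eta>) * real j / 2) / \<tau> j ^ j)) * (4 * (fact k * exp ((1 + \<eta>) * real k / 2) / \<tau> k ^ k))))"
        using pos s t \<tau> jk by (intro mult_left_mono mult_mono b_le m_le coef0) (auto simp: less_imp_le)
      \<comment> \<open>\<open>coef\<close> divides by j! k!, while the moment bounds carry j! and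
        k! twice each; one of each survives in \<open>?w\<close>.\<close>
      also have "\<dots> = 4 * ?w lam j s (\<tau> j) * ?w \<mu> k t (\<tau> k)"
        by (simp add: coef_def mult_ac)
      also have "\<dots> \<le> 4 * (4 * exp 1 * (real (Suc j) * x ^ j)) * (4 * exp 1 * (real (Suc k) * y ^ k))"
      proof (rule mult_mono[OF mult_left_mono])
        show "?w lam j s (\<tau> j) \<le> 4 * exp 1 * (real (Suc j) * x ^ j)"
          using tilted_weight_le[OF n \<gamma> N lam, of \<alpha> j \<eta>] \<alpha>\<beta> by (simp add: s_def \<tau>_def x_def \<alpha>_def)
        show "?w \<mu> k t (\<tau> k) \<le> 4 * exp 1 * (real (Suc k) * y ^ k)"
          using tilted_weight_le[OF n \<gamma> N \<mu>, of \<beta> k \<eta>] \<alpha>\<beta> by (simp add: t_def \<tau>_def y_def \<beta>_def)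
        show "0 \<le> ?w \<mu> k t (\<tau> k)"
          using \<mu> pos(2) pos(3)[of k] by (intro mult_nonneg_nonneg divide_nonneg_pos) auto
      qed (use x0 in auto)
      finally show "coef (fst p) (snd p) * (b (fst p) (snd p) * (m (fst p) * m (snd p)))
          \<le> 4 * (4 * exp 1 * (real (Suc (fst p)) * x ^ fst p)) * (4 * exp 1 * (real (Suc (snd p)) * y ^ snd p))"
        by (simp only: p fst_conv snd_conv)
    qed
    \<comment> \<open>Enlarging the triangle to the square lets the double sum factor.\<close>
    also have "\<dots> \<le> (\<Sum>p\<in>{..D} \<times> {..D}. 4 * (4 * exp 1 * (real (Suc (fst p)) * x ^ fst p)) * (4 * exp 1 * (real (Suc (snd p)) * y ^ snd p)))"
      using x0 y0 by (intro sum_mono2) auto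
    also have "\<dots> = 4 * (4 * exp 1 * (\<Sum>j\<le>D. real (Suc j) * x ^ j)) * (4 * exp 1 * (\<Sum>k\<le>D. real (Suc k) * y ^ k))"
    proof -
      have "(\<Sum>j\<le>D. F j) * (\<Sum>k\<le>D. H k) = (\<Sum>p\<in>{..D} \<times> {..D}. F (fst p) * H (snd p))" for F H :: "nat \<Rightarrow> real"
        by (simp only: sum_product sum.cartesian_product split_def)
      then show ?thesis by (simp only: sum_distrib_left)
    qed
    also have "\<dots> \<le> 4 * (4 * exp 1 * (1 / (1 - x)\<^sup>2)) * (4 * exp 1 * (1 / (1 - y)\<^sup>2))"
      using x0 y0 x1 y1 by (intro mult_mono mult_left_mono sum_Suc_geometric_le mult_nonneg_nonneg sum_nonneg) auto
    finally show ?thesis by simp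
  qed
  show ?thesis using \<delta> main by blast
qed

section \<open>The planted law\<close>

text \<open>Conditioning on the signal needs the signal as a single factor, whereas
  \<open>wishart_planted\<close> nests signal and noise in one product. The two groupings agree on
  every measurable set by Tonelli for its indicator.\<close>

lemma distr_pair_reassoc:
  assumes "prob_space A" "prob_space B" "prob_space C" "prob_space G"
  shows "distr ((A \<Otimes>\<^sub>M B \<Otimes>\<^sub>M C) \<Otimes>\<^sub>M G) (A \<Otimes>\<^sub>M B \<Otimes>\<^sub>M C \<Otimes>\<^sub>M G)
      (\<lambda>p. (fst (fst p), fst (snd (fst p)), snd (snd (fst p)), snd p)) = A \<Otimes>\<^sub>M B \<Otimes>\<^sub>M C \<Otimes>\<^sub>M G"
    (is "distr ?L ?R ?T = _")
proof (rule measure_eqI)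
  interpret A: prob_space A by fact
  interpret B: prob_space B by fact
  interpret C: prob_space C by fact
  interpret G: prob_space G by fact
  interpret BC: prob_space "B \<Otimes>\<^sub>M C" by (rule prob_space_pair) fact+
  interpret CG: prob_space "C \<Otimes>\<^sub>M G" by (rule prob_space_pair) fact+
  interpret BCG: prob_space "B \<Otimes>\<^sub>M C \<Otimes>\<^sub>M G" by (intro prob_space_pair) fact+
  fix E assume "E \<in> sets (distr ?L ?R ?T)"
  then have [measurable]: "E \<in> sets ?R" by simp
  have "emeasure (distr ?L ?R ?T) E = (\<integral>\<^sup>+p. indicator E p \<partial>distr ?L ?R ?T)" by simp
  also have "\<dots> = (\<integral>\<^sup>+p. indicator E (?T p) \<partial>?L)"
    by (rule nn_integral_distr) measurable
  also have "\<dots> = (\<integral>\<^sup>+\<omega>. \<integral>\<^sup>+g. indicator E (?T (\<omega>, g)) \<partial>G \<partial>(A \<Otimes>\<^sub>M B \<Otimes>\<^sub>M C))"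
    by (rule G.nn_integral_fst[symmetric]) measurable
  also have "\<dots> = (\<integral>\<^sup>+a. \<integral>\<^sup>+bc. \<integral>\<^sup>+g. indicator E (?T ((a, bc), g)) \<partial>G \<partial>(B \<Otimes>\<^sub>M C) \<partial>A)"
    by (rule BC.nn_integral_fst[symmetric]) measurable
  also have "\<dots> = (\<integral>\<^sup>+a. \<integral>\<^sup>+b. \<integral>\<^sup>+c. \<integral>\<^sup>+g. indicator E (a, b, c, g) \<partial>G \<partial>C \<partial>B \<partial>A)"
    by (intro nn_integral_cong, subst C.nn_integral_fst[symmetric]) simp_all
  also have "\<dots> = (\<integral>\<^sup>+a. \<integral>\<^sup>+b. \<integral>\<^sup>+cg. indicator E (a, b, cg) \<partial>(C \<Otimes>\<^sub>M G) \<partial>B \<partial>A)"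
    by (intro nn_integral_cong, subst G.nn_integral_fst[symmetric]) simp_all
  also have "\<dots> = (\<integral>\<^sup>+a. \<integral>\<^sup>+bcg. indicator E (a, bcg) \<partial>(B \<Otimes>\<^sub>M C \<Otimes>\<^sub>M G) \<partial>A)"
    by (intro nn_integral_cong, subst CG.nn_integral_fst[symmetric]) simp_all
  also have "\<dots> = (\<integral>\<^sup>+p. indicator E p \<partial>?R)"
    by (rule BCG.nn_integral_fst) simp
  finally show "emeasure (distr ?L ?R ?T) E = emeasure ?R E" by simp
qed simp

text \<open>The map of \<open>wishart_planted\<close> in the form signal plus noise, on the
  regrouped space.\<close>

definition wishart_observation ::
  "nat \<Rightarrow> nat \<Rightarrow> real \<Rightarrow> real \<Rightarrow> ((nat \<Rightarrow> real \<times> real) \<times> (nat \<Rightarrow> real) \<times> (nat \<Rightarrow> real)) \<times> rmatrix \<times> rmatrix \<Rightarrow> rmatrix \<times> rmatrix" where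
  "wishart_observation n N lam \<mu> p =
     (\<lambda>ij\<in>{..<n} \<times> {..<N}. wishart_signal n lam \<mu> (fst p) (Inl ij) + fst (snd p) ij,
      \<lambda>ij\<in>{..<n} \<times> {..<N}. wishart_signal n lam \<mu> (fst p) (Inr ij) + snd (snd p) ij)"

lemma
  assumes \<pi>: "spike_prior \<rho> \<pi>"
  defines "M \<equiv> \<lambda>n N. PiM {..<n} (\<lambda>_. \<pi>) \<Otimes>\<^sub>M gauss_vector N \<Otimes>\<^sub>M gauss_vector N"
  shows prob_space_wishart_signal: "prob_space (M n N)"
    and all_moments_wishart_signal:
      "e \<in> ({..<n} \<times> {..<N}) <+> ({..<n} \<times> {..<N}) \<Longrightarrow> all_moments (M n N) (\<lambda>\<omega>. wishart_signal n lam \<mu> \<omega> e)"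
    and prob_space_wishart_null: "prob_space (wishart_null n N)"
    and all_moments_wishart_null:
      "e \<in> ({..<n} \<times> {..<N}) <+> ({..<n} \<times> {..<N}) \<Longrightarrow> all_moments (wishart_null n N) (\<lambda>w. case_sum (fst w) (snd w) e)"
proof -
  obtain c where P: "prob_space \<pi>" and X: "subgaussian \<pi> c fst" and Y: "subgaussian \<pi> c snd"
    using \<pi> by (auto simp: spike_prior_def)
  note XA = subgaussian_all_moments[OF X] and YA = subgaussian_all_moments[OF Y]
  have PA: "prob_space (PiM {..<n} (\<lambda>_. \<pi>))" by (rule prob_space_PiM) (rule P)
  note PG = prob_space_gauss_vector
  note PGG = prob_space_pair[OF PG PG]
  have PM: "prob_space (gauss_matrix n N)"
    unfolding gauss_matrix_def by (rule prob_space_PiM) (rule prob_space_gauss)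
  show "prob_space (M n N)" unfolding M_def by (intro prob_space_pair PA PG)
  show "prob_space (wishart_null n N)" unfolding wishart_null_def by (intro prob_space_pair PM)
  have x: "all_moments (PiM {..<n} (\<lambda>_. \<pi>)) (\<lambda>x. fst (x i))" "all_moments (PiM {..<n} (\<lambda>_. \<pi>)) (\<lambda>x. snd (x i))"
    if "i < n" for i
    using that P by (auto intro!: all_moments_component[of _ _ _ fst] all_moments_component[of _ _ _ snd] XA YA)
  have u: "all_moments (gauss_vector N) (\<lambda>u. u j)" if "j < N" for j
    unfolding gauss_vector_def using that prob_space_gauss
    by (intro all_moments_component[of _ _ _ "\<lambda>z. z"] all_moments_gauss_id) auto
  have w: "all_moments (gauss_matrix n N) (\<lambda>u. u ij)" if "ij \<in> {..<n} \<times> {..<N}" for ij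
    unfolding gauss_matrix_def using that prob_space_gauss
    by (intro all_moments_component[of _ _ _ "\<lambda>z. z"] all_moments_gauss_id) auto
  show "all_moments (M n N) (\<lambda>\<omega>. wishart_signal n lam \<mu> \<omega> e)"
    if "e \<in> ({..<n} \<times> {..<N}) <+> ({..<n} \<times> {..<N})"
  proof -
    have 1: "all_moments (M n N) (\<lambda>\<omega>. a * fst (fst \<omega> i) * fst (snd \<omega>) j)" if "i < n" "j < N" for i j a
      unfolding M_def
      by (intro all_moments_mult all_moments_cmult all_moments_fst[OF PGG x(1)[OF that(1)]]
          all_moments_snd[OF PA PGG all_moments_fst[OF PG u[OF that(2)]]])
    have 2: "all_moments (M n N) (\<lambda>\<omega>. a * snd (fst \<omega> i) * snd (snd \<omega>) j)" if "i < n" "j < N" for i j a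
      unfolding M_def
      by (intro all_moments_mult all_moments_cmult all_moments_fst[OF PGG x(2)[OF that(1)]]
          all_moments_snd[OF PA PGG all_moments_snd[OF PG PG u[OF that(2)]]])
    show ?thesis using that 1 2 by (auto simp: wishart_signal_def simp del: times_divide_eq_left times_divide_eq_right)
  qed
  show "all_moments (wishart_null n N) (\<lambda>w. case_sum (fst w) (snd w) e)"
    if "e \<in> ({..<n} \<times> {..<N}) <+> ({..<n} \<times> {..<N})"
    unfolding wishart_null_def
    using that all_moments_fst[OF PM w] all_moments_snd[OF PM PM w] by auto
qed

lemma all_moments_wishart_entry:
  assumes \<pi>: "spike_prior \<rho> \<pi>" and e: "e \<in> ({..<n} \<times> {..<N}) <+> ({..<n} \<times> {..<N})"
  shows "all_moments ((PiM {..<n} (\<lambda>_. \<pi>) \<Otimes>\<^sub>M gauss_vector N \<Otimes>\<^sub>M gauss_vector N) \<Otimes>\<^sub>M wishart_null n N)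
    (\<lambda>p. wishart_signal n lam \<mu> (fst p) e + case_sum (fst (snd p)) (snd (snd p)) e)"
  by (intro all_moments_add
      all_moments_fst[OF prob_space_wishart_null[OF \<pi>] all_moments_wishart_signal[OF \<pi> e]]
      all_moments_snd[OF prob_space_wishart_signal[OF \<pi>] prob_space_wishart_null[OF \<pi>] all_moments_wishart_null[OF \<pi> e]])

lemma measurable_wishart_observation:
  assumes \<pi>: "spike_prior \<rho> \<pi>"
  shows "wishart_observation n N lam \<mu> \<in> measurable
    ((PiM {..<n} (\<lambda>_. \<pi>) \<Otimes>\<^sub>M gauss_vector N \<Otimes>\<^sub>M gauss_vector N) \<Otimes>\<^sub>M wishart_null n N) (wishart_null n N)"
    (is "_ \<in> measurable ?R _")
proof -
  note m = all_moments_measurable[OF all_moments_wishart_entry[OF \<pi>, of _ n N lam \<mu>]]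
  have "(\<lambda>p. wishart_signal n lam \<mu> (fst p) (Inl ij) + fst (snd p) ij) \<in> measurable ?R gauss"
    "(\<lambda>p. wishart_signal n lam \<mu> (fst p) (Inr ij) + snd (snd p) ij) \<in> measurable ?R gauss"
    if "ij \<in> {..<n} \<times> {..<N}" for ij
    using m[OF InlI[OF that]] m[OF InrI[OF that]] by simp_all
  then have "wishart_observation n N lam \<mu> \<in> measurable ?R (gauss_matrix n N \<Otimes>\<^sub>M gauss_matrix n N)"
    unfolding wishart_observation_def gauss_matrix_def
    by (intro measurable_Pair measurable_restrict)
  then show ?thesis by (simp only: wishart_null_def)
qed

lemma wishart_planted_eq_distr:
  assumes \<pi>: "spike_prior \<rho> \<pi>"
  shows "wishart_planted \<pi> lam \<mu> n N =
    distr ((PiM {..<n} (\<lambda>_. \<pi>) \<Otimes>\<^sub>M gauss_vector N \<Otimes>\<^sub>M gauss_vector N) \<Otimes>\<^sub>M wishart_null n N)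
      (wishart_null n N) (wishart_observation n N lam \<mu>)"
proof -
  have P: "prob_space \<pi>" using \<pi> by (auto simp: spike_prior_def)
  have PA: "prob_space (PiM {..<n} (\<lambda>_. \<pi>))" by (rule prob_space_PiM) (rule P)
  let ?A = "PiM {..<n} (\<lambda>_. \<pi>)" and ?G = "gauss_vector N" and ?W = "wishart_null n N"
  let ?f = "\<lambda>(xy, u, v, W, Z). (spiked_matrix n N lam (\<lambda>i. fst (xy i)) u W,
                             spiked_matrix n N \<mu> (\<lambda>i. snd (xy i)) v Z)"
  let ?T = "\<lambda>p. (fst (fst p), fst (snd (fst p)), snd (snd (fst p)), snd p)"
  have T: "?T \<in> measurable ((?A \<Otimes>\<^sub>M ?G \<Otimes>\<^sub>M ?G) \<Otimes>\<^sub>M ?W) (?A \<Otimes>\<^sub>M ?G \<Otimes>\<^sub>M ?G \<Otimes>\<^sub>M ?W)"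
    by measurable
  have U: "(\<lambda>(a, b, c, w). ((a, b, c), w)) \<in> measurable (?A \<Otimes>\<^sub>M ?G \<Otimes>\<^sub>M ?G \<Otimes>\<^sub>M ?W) ((?A \<Otimes>\<^sub>M ?G \<Otimes>\<^sub>M ?G) \<Otimes>\<^sub>M ?W)"
    by measurable
  \<comment> \<open>Factoring through the inverse regrouping transfers measurability from
    \<open>wishart_observation\<close>.\<close>
  have f_eq: "?f = wishart_observation n N lam \<mu> \<circ> (\<lambda>(a, b, c, w). ((a, b, c), w))"
    by (auto simp: fun_eq_iff wishart_observation_def spiked_matrix_def wishart_signal_def split_def restrict_def)
  have f: "?f \<in> measurable (?A \<Otimes>\<^sub>M ?G \<Otimes>\<^sub>M ?G \<Otimes>\<^sub>M ?W) ?W"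
    unfolding f_eq by (rule measurable_comp[OF U measurable_wishart_observation[OF \<pi>]])
  have comp: "?f \<circ> ?T = wishart_observation n N lam \<mu>"
    unfolding f_eq by (auto simp: fun_eq_iff)
  have "wishart_planted \<pi> lam \<mu> n N = distr (?A \<Otimes>\<^sub>M ?G \<Otimes>\<^sub>M ?G \<Otimes>\<^sub>M ?W) ?W ?f"
    by (simp add: wishart_planted_def wishart_null_def)
  also have "\<dots> = distr (distr ((?A \<Otimes>\<^sub>M ?G \<Otimes>\<^sub>M ?G) \<Otimes>\<^sub>M ?W) (?A \<Otimes>\<^sub>M ?G \<Otimes>\<^sub>M ?G \<Otimes>\<^sub>M ?W) ?T) ?W ?f"
    by (subst distr_pair_reassoc[OF PA prob_space_gauss_vector prob_space_gauss_vector prob_space_wishart_null[OF \<pi>]]) simp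
  also have "\<dots> = distr ((?A \<Otimes>\<^sub>M ?G \<Otimes>\<^sub>M ?G) \<Otimes>\<^sub>M ?W) ?W (wishart_observation n N lam \<mu>)"
    by (subst distr_distr[OF f T]) (simp only: comp)
  finally show "wishart_planted \<pi> lam \<mu> n N = distr ((?A \<Otimes>\<^sub>M ?G \<Otimes>\<^sub>M ?G) \<Otimes>\<^sub>M ?W) ?W (wishart_observation n N lam \<mu>)" .
qed

section \<open>Polynomials of bounded degree under the two laws\<close>

definition entry_monomials :: "nat \<Rightarrow> nat \<Rightarrow> nat \<Rightarrow> (entry \<Rightarrow>\<^sub>0 nat) set" where
  "entry_monomials n N D = {m. Poly_Mapping.keys m \<subseteq> ({..<n} \<times> {..<N}) <+> ({..<n} \<times> {..<N}) \<and>
     (\<Sum>e\<in>Poly_Mapping.keys m. Poly_Mapping.lookup m e) \<le> D}"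

text \<open>The coefficients are not tied to the support of a polynomial, so subtracting a constant
  only changes the coefficient at the monomial 0.\<close>

definition monomial_sum :: "(entry \<Rightarrow>\<^sub>0 nat) set \<Rightarrow> ((entry \<Rightarrow>\<^sub>0 nat) \<Rightarrow> real) \<Rightarrow> (entry \<Rightarrow> real) \<Rightarrow> real" where
  "monomial_sum A c z = (\<Sum>m\<in>A. c m * (\<Prod>e\<in>Poly_Mapping.keys m. z e ^ Poly_Mapping.lookup m e))"

lemma eval_entries_monomial_sum:
  "eval_entries f XY = monomial_sum (Poly_Mapping.keys f) (Poly_Mapping.lookup f) (case_sum (fst XY) (snd XY))"
  by (simp add: eval_entries_def monomial_sum_def)

lemma all_moments_monomial_sum:
  assumes "finite_measure M" "A \<subseteq> entry_monomials n N D"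
    and "\<And>e. e \<in> ({..<n} \<times> {..<N}) <+> ({..<n} \<times> {..<N}) \<Longrightarrow> all_moments M (\<lambda>\<omega>. z \<omega> e)"
  shows "all_moments M (\<lambda>\<omega>. monomial_sum A c (z \<omega>))"
  unfolding monomial_sum_def
  by (intro all_moments_sum all_moments_cmult all_moments_prod all_moments_power assms(1,3))
     (use assms(2) in \<open>auto simp: entry_monomials_def\<close>)

lemma monomial_sum_cong:
  assumes "A \<subseteq> entry_monomials n N D"
    and "\<And>e. e \<in> ({..<n} \<times> {..<N}) <+> ({..<n} \<times> {..<N}) \<Longrightarrow> z e = z' e"
  shows "monomial_sum A c z = monomial_sum A c z'"
  unfolding monomial_sum_def
  by (intro sum.cong refl arg_cong2[of _ _ _ _ "(*)"] prod.cong arg_cong2[of _ _ _ _ "(^)"] assms(2))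
     (use assms(1) in \<open>auto simp: entry_monomials_def\<close>)

text \<open>Fubini averages the noise first, for a frozen signal; this is the form to which the
  Hermite shift rule applies.\<close>

lemma
  fixes c :: "(entry \<Rightarrow>\<^sub>0 nat) \<Rightarrow> real"
  assumes \<pi>: "spike_prior \<rho> \<pi>" and A: "A \<subseteq> entry_monomials n N D"
  defines "M \<equiv> PiM {..<n} (\<lambda>_. \<pi>) \<Otimes>\<^sub>M gauss_vector N \<Otimes>\<^sub>M gauss_vector N"
    and "F \<equiv> \<lambda>XY. monomial_sum A c (case_sum (fst XY) (snd XY))"
  shows integrable_monomial_sum_planted: "integrable (wishart_planted \<pi> lam \<mu> n N) F"
    and integral_monomial_sum_planted: "(\<integral>XY. F XY \<partial>wishart_planted \<pi> lam \<mu> n N)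
      = (\<integral>\<omega>. \<integral>w. monomial_sum A c (\<lambda>e. wishart_signal n lam \<mu> \<omega> e + case_sum (fst w) (snd w) e) \<partial>wishart_null n N \<partial>M)"
proof -
  let ?W = "wishart_null n N"
  have PM: "prob_space M" unfolding M_def by (rule prob_space_wishart_signal[OF \<pi>])
  have PW: "prob_space ?W" by (rule prob_space_wishart_null[OF \<pi>])
  interpret W: prob_space ?W by fact
  interpret M: prob_space M by fact
  interpret MW: prob_space "M \<Otimes>\<^sub>M ?W" by (rule prob_space_pair[OF PM PW])
  interpret pair_sigma_finite M ?W ..
  have F: "all_moments ?W F"
    unfolding F_def
    by (rule all_moments_monomial_sum[OF W.finite_measure_axioms A]) (rule all_moments_wishart_null[OF \<pi>])
  note [measurable] = all_moments_measurable[OF F]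
  define H where "H p = monomial_sum A c (\<lambda>e. wishart_signal n lam \<mu> (fst p) e + case_sum (fst (snd p)) (snd (snd p)) e)" for p
  have H: "integrable (M \<Otimes>\<^sub>M ?W) H"
    unfolding H_def M_def
    by (intro all_moments_integrable all_moments_monomial_sum[OF MW.finite_measure_axioms[unfolded M_def] A]
        all_moments_wishart_entry[OF \<pi>])
  \<comment> \<open>The observation is extensional and equals signal plus noise only at the
    admissible entries, which are the only ones that the monomials see.\<close>
  have FH: "F (wishart_observation n N lam \<mu> p) = H p" for p
    unfolding F_def H_def
    by (rule monomial_sum_cong[OF A]) (auto simp: wishart_observation_def)
  note T = measurable_wishart_observation[OF \<pi>, of n N lam \<mu>, folded M_def]
  show "integrable (wishart_planted \<pi> lam \<mu> n N) F"
    unfolding wishart_planted_eq_distr[OF \<pi>] M_def[symmetric]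
    using T H by (subst integrable_distr_eq) (auto simp: FH)
  have "(\<integral>XY. F XY \<partial>wishart_planted \<pi> lam \<mu> n N) = (\<integral>p. H p \<partial>(M \<Otimes>\<^sub>M ?W))"
    unfolding wishart_planted_eq_distr[OF \<pi>] M_def[symmetric]
    using T by (subst integral_distr) (auto simp: FH)
  also have "\<dots> = (\<integral>\<omega>. \<integral>w. H (\<omega>, w) \<partial>?W \<partial>M)"
    by (rule integral_fst'[OF H, symmetric])
  finally show "(\<integral>XY. F XY \<partial>wishart_planted \<pi> lam \<mu> n N)
      = (\<integral>\<omega>. \<integral>w. monomial_sum A c (\<lambda>e. wishart_signal n lam \<mu> \<omega> e + case_sum (fst w) (snd w) e) \<partial>?W \<partial>M)"
    unfolding H_def fst_conv snd_conv .
qed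

lemma prob_space_wishart_planted:
  assumes \<pi>: "spike_prior \<rho> \<pi>"
  shows "prob_space (wishart_planted \<pi> lam \<mu> n N)"
  unfolding wishart_planted_eq_distr[OF \<pi>]
  by (intro prob_space.prob_space_distr prob_space_pair prob_space_wishart_signal[OF \<pi>]
      prob_space_wishart_null[OF \<pi>] measurable_wishart_observation[OF \<pi>])

text \<open>The order of quantifiers carries the uniformity: \<kappa>, \<eta> and hence
  \<open>C\<close> are fixed before the prior, which only decides how small \<delta> must be.
  Ranging over all \<open>A\<close> and \<open>c\<close> also covers polynomials shifted by a
  constant.\<close>

lemma wishart_low_degree_bound:
  assumes "\<gamma> > 0" "lam \<ge> 0" "\<mu> \<ge> 0" "\<epsilon> > 0" "spike_threshold lam \<mu> \<rho> \<gamma> < 1 - \<epsilon>"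
  shows "\<exists>C\<ge>0. \<forall>\<pi>. spike_prior \<rho> \<pi> \<longrightarrow> (\<exists>\<delta>>0. \<forall>n N D A c. n \<ge> 1 \<longrightarrow> \<gamma> = real n / real N \<longrightarrow>
    real D \<le> \<delta> * real n \<longrightarrow> A \<subseteq> entry_monomials n N D \<longrightarrow>
    \<bar>\<integral>XY. monomial_sum A c (case_sum (fst XY) (snd XY)) \<partial>wishart_planted \<pi> lam \<mu> n N\<bar>
      \<le> C * sqrt (\<integral>XY. (monomial_sum A c (case_sum (fst XY) (snd XY)))\<^sup>2 \<partial>wishart_null n N))"
proof -
  obtain \<kappa> \<eta> where \<kappa>: "\<kappa> > 0" and \<eta>: "\<eta> > 0"
    and lt: "(1 + \<eta> + \<rho>\<^sup>2 * \<kappa>) * exp \<eta> * (lam\<^sup>2 / \<gamma>) < 1" "(1 + \<eta> + \<rho>\<^sup>2 / \<kappa>) * exp \<eta> * (\<mu>\<^sup>2 / \<gamma>) < 1"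
    using spike_threshold_parameters[OF assms(1,4,5)] by blast
  define x where "x = sqrt ((1 + \<eta> + \<rho>\<^sup>2 * \<kappa>) * exp \<eta> * (lam\<^sup>2 / \<gamma>))"
  define y where "y = sqrt ((1 + \<eta> + \<rho>\<^sup>2 / \<kappa>) * exp \<eta> * (\<mu>\<^sup>2 / \<gamma>))"
  have xy: "x < 1" "y < 1" using lt by (simp_all add: x_def y_def)
  define C where "C = 4 * (4 * exp 1 / (1 - x)\<^sup>2) * (4 * exp 1 / (1 - y)\<^sup>2)"
  have bound: "\<exists>\<delta>>0. \<forall>n N D A c. n \<ge> 1 \<longrightarrow> \<gamma> = real n / real N \<longrightarrow>
    real D \<le> \<delta> * real n \<longrightarrow> A \<subseteq> entry_monomials n N D \<longrightarrow>
    \<bar>\<integral>XY. monomial_sum A c (case_sum (fst XY) (snd XY)) \<partial>wishart_planted \<pi> lam \<mu> n N\<bar>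
      \<le> sqrt C * sqrt (\<integral>XY. (monomial_sum A c (case_sum (fst XY) (snd XY)))\<^sup>2 \<partial>wishart_null n N)"
    if \<pi>: "spike_prior \<rho> \<pi>" for \<pi>
  proof -
    obtain \<delta> where \<delta>: "\<delta> > 0" and kernel: "\<And>n N D. n \<ge> 1 \<Longrightarrow> \<gamma> = real n / real N \<Longrightarrow> real D \<le> \<delta> * real n \<Longrightarrow>
      (\<integral>\<omega>. \<integral>\<omega>'. (\<Sum>d\<le>D. (\<Sum>e\<in>({..<n} \<times> {..<N}) <+> ({..<n} \<times> {..<N}).
          wishart_signal n lam \<mu> \<omega> e * wishart_signal n lam \<mu> \<omega>' e) ^ d / fact d)
        \<partial>(PiM {..<n} (\<lambda>_. \<pi>) \<Otimes>\<^sub>M gauss_vector N \<Otimes>\<^sub>M gauss_vector N)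
        \<partial>(PiM {..<n} (\<lambda>_. \<pi>) \<Otimes>\<^sub>M gauss_vector N \<Otimes>\<^sub>M gauss_vector N)) \<le> C"
      using wishart_kernel_bound[OF assms(2,3,1) \<kappa> \<eta> x_def xy(1) y_def xy(2) \<pi>] unfolding C_def by blast
    have "\<bar>\<integral>XY. monomial_sum A c (case_sum (fst XY) (snd XY)) \<partial>wishart_planted \<pi> lam \<mu> n N\<bar>
      \<le> sqrt C * sqrt (\<integral>XY. (monomial_sum A c (case_sum (fst XY) (snd XY)))\<^sup>2 \<partial>wishart_null n N)"
      if n: "n \<ge> 1" "\<gamma> = real n / real N" "real D \<le> \<delta> * real n" and A: "A \<subseteq> entry_monomials n N D" for n N D A c
    proof -
      let ?M = "PiM {..<n} (\<lambda>_. \<pi>) \<Otimes>\<^sub>M gauss_vector N \<Otimes>\<^sub>M gauss_vector N"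
      let ?P = "\<integral>XY. monomial_sum A c (case_sum (fst XY) (snd XY)) \<partial>wishart_planted \<pi> lam \<mu> n N"
      let ?Q = "\<integral>XY. (monomial_sum A c (case_sum (fst XY) (snd XY)))\<^sup>2 \<partial>wishart_null n N"
      have Q0: "?Q \<ge> 0" by (rule Bochner_Integration.integral_nonneg) simp
      have "?P\<^sup>2 \<le> ?Q * (\<integral>\<omega>. \<integral>\<omega>'. (\<Sum>d\<le>D. (\<Sum>e\<in>({..<n} \<times> {..<N}) <+> ({..<n} \<times> {..<N}).
          wishart_signal n lam \<mu> \<omega> e * wishart_signal n lam \<mu> \<omega>' e) ^ d / fact d) \<partial>?M \<partial>?M)"
        unfolding integral_monomial_sum_planted[OF \<pi> A]
        unfolding monomial_sum_def wishart_null_def gauss_matrix_def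
        by (rule low_degree_second_moment_bound)
           (use A in \<open>auto simp: entry_monomials_def intro!: prob_space_wishart_signal[OF \<pi>] all_moments_wishart_signal[OF \<pi>]\<close>)
      also have "\<dots> \<le> ?Q * C" by (intro mult_left_mono kernel n Q0)
      finally have "sqrt (?P\<^sup>2) \<le> sqrt (?Q * C)" by (rule real_sqrt_le_mono)
      then show ?thesis by (simp add: real_sqrt_mult mult.commute)
    qed
    with \<delta> show ?thesis by blast
  qed
  have "sqrt C \<ge> 0" by (simp add: C_def)
  with bound show ?thesis by blast
qed

theorem theorem5p5:
  fixes lam \<mu> \<rho> \<gamma> \<epsilon> :: real
  assumes "\<gamma> > 0" and "lam \<ge> 0" and "\<mu> \<ge> 0" and "\<rho> \<in> {0<..<1}"
    and "\<epsilon> > 0" and "spike_threshold lam \<mu> \<rho> \<gamma> < 1 - \<epsilon>"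
  shows "\<exists>C :: real. \<forall>\<pi> n N D.
    spike_prior \<rho> \<pi> \<longrightarrow> proportional_regime \<gamma> n N \<longrightarrow> subpolynomial n D \<longrightarrow>
      (\<forall>\<^sub>F k in sequentially.
         low_degree_advantage (wishart_planted \<pi> lam \<mu> (n k) (N k)) (wishart_null (n k) (N k))
           (n k) (N k) (D k) \<le> ereal C) \<and>
      \<not> (\<exists>f. (\<forall>k. f k \<in> entry_polys (n k) (N k) (D k)) \<and>
             strongly_separates (\<lambda>k. wishart_planted \<pi> lam \<mu> (n k) (N k))
               (\<lambda>k. wishart_null (n k) (N k)) (\<lambda>k. eval_entries (f k)))"
proof -
  obtain C where C0: "C \<ge> 0" and C: "\<And>\<pi>. spike_prior \<rho> \<pi> \<Longrightarrow> \<exists>\<delta>>0. \<forall>n N D A c. n \<ge> 1 \<longrightarrow> \<gamma> = real n / real N \<longrightarrow>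
    real D \<le> \<delta> * real n \<longrightarrow> A \<subseteq> entry_monomials n N D \<longrightarrow>
    \<bar>\<integral>XY. monomial_sum A c (case_sum (fst XY) (snd XY)) \<partial>wishart_planted \<pi> lam \<mu> n N\<bar>
      \<le> C * sqrt (\<integral>XY. (monomial_sum A c (case_sum (fst XY) (snd XY)))\<^sup>2 \<partial>wishart_null n N)"
    using wishart_low_degree_bound[OF assms(1-3,5,6)] by blast
  show ?thesis
  proof (intro exI[of _ C] allI impI)
    fix \<pi> and n N D :: "nat \<Rightarrow> nat"
    assume \<pi>: "spike_prior \<rho> \<pi>" and reg: "proportional_regime \<gamma> n N" and sub: "subpolynomial n D"
    let ?P = "\<lambda>k. wishart_planted \<pi> lam \<mu> (n k) (N k)" and ?Q = "\<lambda>k. wishart_null (n k) (N k)"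
    obtain \<delta> where \<delta>: "\<delta> > 0" and bound: "\<And>n N D A c. n \<ge> 1 \<Longrightarrow> \<gamma> = real n / real N \<Longrightarrow>
      real D \<le> \<delta> * real n \<Longrightarrow> A \<subseteq> entry_monomials n N D \<Longrightarrow>
      \<bar>\<integral>XY. monomial_sum A c (case_sum (fst XY) (snd XY)) \<partial>wishart_planted \<pi> lam \<mu> n N\<bar>
      \<le> C * sqrt (\<integral>XY. (monomial_sum A c (case_sum (fst XY) (snd XY)))\<^sup>2 \<partial>wishart_null n N)"
      using C[OF \<pi>] by blast
    have n_top: "filterlim n at_top sequentially" and \<gamma>: "\<gamma> = real (n k) / real (N k)" for k
      using reg by (auto simp: proportional_regime_def)
    \<comment> \<open>Eventually the exponent is below 1/2, so D \<le> sqrt n, and sqrt n \<le>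
      \<delta> n as soon as n \<ge> 1 / \<delta>^2.\<close>
    have "\<forall>\<^sub>F k in sequentially. n k \<ge> 1 \<and> real (D k) \<le> \<delta> * real (n k)"
    proof -
      obtain e where e: "e \<longlonglongrightarrow> 0" and De: "\<forall>\<^sub>F k in sequentially. real (D k) \<le> real (n k) powr e k"
        using sub by (auto simp: subpolynomial_def)
      have "\<forall>\<^sub>F k in sequentially. e k < 1 / 2"
        using e by (rule order_tendstoD) simp
      moreover have "\<forall>\<^sub>F k in sequentially. n k \<ge> 1" "\<forall>\<^sub>F k in sequentially. n k \<ge> nat \<lceil>1 / \<delta>\<^sup>2\<rceil>"
        using n_top unfolding filterlim_at_top by blast+
      ultimately show ?thesis using De
      proof eventually_elim
        case (elim k)
        have "real (D k) \<le> real (n k) powr e k" by fact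
        also have "\<dots> \<le> real (n k) powr (1 / 2)" using elim by (intro powr_mono) auto
        also have "\<dots> = sqrt (real (n k))" by (simp add: powr_half_sqrt)
        also have "\<dots> \<le> \<delta> * real (n k)"
        proof (rule real_le_lsqrt)
          have "1 / \<delta>\<^sup>2 \<le> real (n k)" using elim by linarith
          then have "1 \<le> \<delta>\<^sup>2 * real (n k)" using \<delta> by (simp add: pos_divide_le_eq mult.commute)
          then have "1 * real (n k) \<le> \<delta>\<^sup>2 * real (n k) * real (n k)" by (intro mult_right_mono) auto
          then show "real (n k) \<le> (\<delta> * real (n k))\<^sup>2" by (simp add: power_mult_distrib power2_eq_square mult_ac)
        qed (use \<delta> in auto)
        finally show ?case using elim by simp
      qed
    qed
    \<comment> \<open>The threshold on \<open>k\<close> precedes the quantifier over polynomials, as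
      the supremum demands.\<close>
    then have ev: "\<forall>\<^sub>F k in sequentially. \<forall>A c. A \<subseteq> entry_monomials (n k) (N k) (D k) \<longrightarrow>
      \<bar>\<integral>XY. monomial_sum A c (case_sum (fst XY) (snd XY)) \<partial>?P k\<bar>
      \<le> C * sqrt (\<integral>XY. (monomial_sum A c (case_sum (fst XY) (snd XY)))\<^sup>2 \<partial>?Q k)"
    proof eventually_elim
      case (elim k)
      then show ?case by (blast intro: bound \<gamma>)
    qed
    have keys: "Poly_Mapping.keys f \<subseteq> entry_monomials n N D" if "f \<in> entry_polys n N D" for f n N D
      using that by (auto simp: entry_polys_def entry_monomials_def)
    show "(\<forall>\<^sub>F k in sequentially. low_degree_advantage (?P k) (?Q k) (n k) (N k) (D k) \<le> ereal C) \<and>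
      \<not> (\<exists>f. (\<forall>k. f k \<in> entry_polys (n k) (N k) (D k)) \<and> strongly_separates ?P ?Q (\<lambda>k. eval_entries (f k)))"
    proof
      show "\<forall>\<^sub>F k in sequentially. low_degree_advantage (?P k) (?Q k) (n k) (N k) (D k) \<le> ereal C"
        using ev
      proof eventually_elim
        case (elim k)
        show ?case
          unfolding low_degree_advantage_def
        proof (rule SUP_least)
          fix f assume f: "f \<in> entry_polys (n k) (N k) (D k) - {0}"
          let ?p = "\<integral>XY. eval_entries f XY \<partial>?P k" and ?q = "\<integral>XY. (eval_entries f XY)\<^sup>2 \<partial>?Q k"
          have le: "\<bar>?p\<bar> \<le> C * sqrt ?q"
            using elim keys f by (simp add: eval_entries_monomial_sum)
          \<comment> \<open>If the second moment is 0, division by zero yields 0, and 0 \<le>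
            C.\<close>
          have "?p / sqrt ?q \<le> C"
          proof (cases "?q = 0")
            case False
            moreover have "?q \<ge> 0" by (rule Bochner_Integration.integral_nonneg) simp
            ultimately have "?q > 0" by linarith
            then have "sqrt ?q > 0" by (rule real_sqrt_gt_zero)
            moreover have "?p \<le> C * sqrt ?q" using le by linarith
            ultimately show ?thesis by (simp only: pos_divide_le_eq)
          qed (use C0 in simp)
          then show "ereal (?p / sqrt ?q) \<le> ereal C" by simp
        qed
      qed
      show "\<not> (\<exists>f. (\<forall>k. f k \<in> entry_polys (n k) (N k) (D k)) \<and> strongly_separates ?P ?Q (\<lambda>k. eval_entries (f k)))"
      proof
        assume "\<exists>f. (\<forall>k. f k \<in> entry_polys (n k) (N k) (D k)) \<and> strongly_separates ?P ?Q (\<lambda>k. eval_entries (f k))"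
        then obtain f where f: "\<And>k. f k \<in> entry_polys (n k) (N k) (D k)"
          and sep: "strongly_separates ?P ?Q (\<lambda>k. eval_entries (f k))" by blast
        define p where "p k = (\<integral>XY. eval_entries (f k) XY \<partial>?P k)" for k
        define q where "q k = (\<integral>XY. eval_entries (f k) XY \<partial>?Q k)" for k
        define V where "V k = variance_under (?Q k) (eval_entries (f k))" for k
        have ne: "\<forall>\<^sub>F k in sequentially. p k \<noteq> q k"
          using sep by (simp add: strongly_separates_def p_def q_def)
        \<comment> \<open>The rate 1 / (C + 1) is chosen against the bound with constant C: together
          they give a factor C / (C + 1) < 1, a contradiction since the means differ.\<close>
        have small: "\<forall>\<^sub>F k in sequentially. norm (sqrt (max (variance_under (?P k) (eval_entries (f k))) (V k)))
            \<le> 1 / (C + 1) * norm \<bar>p k - q k\<bar>"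
          using sep C0 unfolding strongly_separates_def p_def q_def V_def
          by (intro landau_o.smallD) auto
        have "\<forall>\<^sub>F k in sequentially. \<bar>p k - q k\<bar> \<le> C * sqrt (V k)"
          using ev
        proof eventually_elim
          case (elim k)
          \<comment> \<open>The monomial 0 carries the constant term and may be absent from the
            support of \<open>f k\<close>. With the coefficients \<open>?c\<close> the sum is
            \<open>f k\<close> minus its mean under the null law, whose second moment there is the
            variance.\<close>
          let ?A = "insert 0 (Poly_Mapping.keys (f k))"
          let ?c = "\<lambda>m. Poly_Mapping.lookup (f k) m - (if m = 0 then q k else 0)"
          have A: "?A \<subseteq> entry_monomials (n k) (N k) (D k)"
            using keys[OF f[of k]] by (auto simp: entry_monomials_def)
          have F: "monomial_sum ?A ?c z = monomial_sum (Poly_Mapping.keys (f k)) (Poly_Mapping.lookup (f k)) z - q k" for z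
          proof -
            have "monomial_sum ?A ?c z = monomial_sum ?A (Poly_Mapping.lookup (f k)) z - monomial_sum ?A (\<lambda>m. if m = 0 then q k else 0) z"
              by (simp add: monomial_sum_def left_diff_distrib sum_subtractf del: sum.insert)
            also have "monomial_sum ?A (Poly_Mapping.lookup (f k)) z = monomial_sum (Poly_Mapping.keys (f k)) (Poly_Mapping.lookup (f k)) z"
              unfolding monomial_sum_def by (rule sum.mono_neutral_right) (auto simp: in_keys_iff)
            also have "monomial_sum ?A (\<lambda>m. if m = 0 then q k else 0) z = (\<Sum>m\<in>{0 :: entry \<Rightarrow>\<^sub>0 nat}. q k)"
              unfolding monomial_sum_def by (rule sum.mono_neutral_cong_right) auto
            finally show ?thesis by simp
          qed
          interpret P: prob_space "?P k" by (rule prob_space_wishart_planted[OF \<pi>])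
          have "(\<integral>XY. monomial_sum ?A ?c (case_sum (fst XY) (snd XY)) \<partial>?P k) = p k - q k"
            unfolding F p_def eval_entries_monomial_sum
            using integrable_monomial_sum_planted[OF \<pi> keys[OF f[of k]]] P.prob_space by simp
          moreover have "(\<integral>XY. (monomial_sum ?A ?c (case_sum (fst XY) (snd XY)))\<^sup>2 \<partial>?Q k) = V k"
            unfolding F V_def variance_under_def q_def[symmetric] by (simp add: eval_entries_monomial_sum)
          ultimately show ?case using elim[rule_format, OF A, of ?c] by (simp only:)
        qed
        then have "\<forall>\<^sub>F k in sequentially. False"
          using ne small
        proof eventually_elim
          case (elim k)
          have "sqrt (V k) \<le> sqrt (max (variance_under (?P k) (eval_entries (f k))) (V k))" by simp
          also have "\<dots> \<le> 1 / (C + 1) * \<bar>p k - q k\<bar>" using elim by simp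
          finally have "C * sqrt (V k) \<le> C * (1 / (C + 1) * \<bar>p k - q k\<bar>)" using C0 by (rule mult_left_mono)
          then have "\<bar>p k - q k\<bar> \<le> C / (C + 1) * \<bar>p k - q k\<bar>" using elim by simp
          moreover have "C / (C + 1) * \<bar>p k - q k\<bar> < 1 * \<bar>p k - q k\<bar>"
            using elim C0 by (intro mult_strict_right_mono) auto
          ultimately show ?case by simp
        qed
        then show False by simp
      qed
    qed
  qed
qed

end
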